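(* Fix $T>0$, let $u\in L^\infty_{\mathrm{loc}}([0,T);W^{1,\infty}(\mathbb{T}^d))$ be divergence free, and let $\theta_0\in H^2(\mathbb{T}^d)$ be mean zero. For $\kappa>0$ let $\theta^\kappa$ be the solution of $\partial_t\theta^\kappa+u\cdot\nabla\theta^\kappa=\kappa\Delta\theta^\kappa$, and let $\theta$ be the solution of $\partial_t\theta+u\cdot\nabla\theta=0$, both with initial data $\theta_0$ (independent of $\kappa$). Suppose $$\lim_{t\to T}\int_0^t|\nabla\theta|_{L^2}^2\,\mathrm{d}s=+\infty$$ and that there is a constant $c\in(0,1)$, independent of $\kappa$ and $t$, such that $$|\theta(t)|_{\dot H^1}^2\ \ge\ c\,\bigl(|\theta(t)|_{\dot H^2}+|\theta^\kappa(t)|_{\dot H^2}\bigr)\,|\theta_0|_{L^2}$$ for all $t\in[0,T)$ and all $\kappa>0$. Then, for all $\kappa>0$, $$\kappa\int_0^T|\nabla\theta^\kappa|_{L^2}^2\,\mathrm{d}t\ \ge\ \Bigl(\frac c2\Bigr)^4|\theta_0|_{L^2}^2 .$$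
   Context: $d\ge2$ and $\mathbb{T}^d=(\mathbb{R}/2\pi\mathbb{Z})^d$. Norms: $|f|_{L^2}=(\int_{\mathbb{T}^d}|f|^2\,\mathrm{d}x)^{1/2}$, $|f|_{\dot H^1}^2=|\nabla f|_{L^2}^2=\sum_i|\partial_i f|_{L^2}^2$, $|f|_{\dot H^2}^2=\sum_{i,j}|\partial_i\partial_j f|_{L^2}^2$. "Mean zero" means $\int_{\mathbb{T}^d}\theta_0\,\mathrm{d}x=0$. *)

theory Defs
  imports "HOL-Probability.Essential_Supremum"
begin

text \<open>Functions on the torus \<open>(\<real>/2\<pi>\<int>)\<^sup>d\<close> are represented by functions on \<open>real ^ 'd\<close> that are
  \<open>2\<pi>\<close>-periodic in each variable; integrals over the torus are integrals over one period cube.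
  All norms take values in \<open>ennreal\<close> and equal \<open>\<infinity>\<close> outside the corresponding function space.\<close>

definition torus :: "(real ^ 'd::finite) measure" where
  "torus = restrict_space lborel (cbox 0 (\<chi> i. 2 * pi))"

definition periodic :: "(real ^ 'd::finite \<Rightarrow> 'b) \<Rightarrow> bool" where
  "periodic f \<longleftrightarrow> (\<forall>x i. f (x + axis i (2 * pi)) = f x)"


subsection \<open>Test functions\<close>

definition pderiv_at :: "'d::finite \<Rightarrow> (real ^ 'd \<Rightarrow> real) \<Rightarrow> real ^ 'd \<Rightarrow> real" where
  "pderiv_at i f x = frechet_derivative f (at x) (axis i 1)"

definition grad :: "(real ^ 'd::finite \<Rightarrow> real) \<Rightarrow> real ^ 'd \<Rightarrow> real ^ 'd" where
  "grad f x = (\<chi> i. pderiv_at i f x)"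

definition laplacian :: "(real ^ 'd::finite \<Rightarrow> real) \<Rightarrow> real ^ 'd \<Rightarrow> real" where
  "laplacian f x = (\<Sum>i\<in>UNIV. pderiv_at i (pderiv_at i f) x)"

fun C_times :: "nat \<Rightarrow> (real ^ 'd::finite \<Rightarrow> real) \<Rightarrow> bool" where
  "C_times 0 f \<longleftrightarrow> continuous_on UNIV f"
| "C_times (Suc k) f \<longleftrightarrow> (\<forall>x. f differentiable (at x)) \<and> (\<forall>i. C_times k (pderiv_at i f))"

definition test_functions :: "(real ^ 'd::finite \<Rightarrow> real) set" where
  "test_functions = {\<phi>. periodic \<phi> \<and> (\<forall>k. C_times k \<phi>)}"


subsection \<open>Weak derivatives and Sobolev norms\<close>

definition has_weak_pderiv ::
    "'d::finite \<Rightarrow> (real ^ 'd \<Rightarrow> real) \<Rightarrow> (real ^ 'd \<Rightarrow> real) \<Rightarrow> bool" where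
  "has_weak_pderiv i f g \<longleftrightarrow>
     periodic f \<and> integrable torus f \<and> periodic g \<and> integrable torus g \<and>
     (\<forall>\<phi>\<in>test_functions.
        (\<integral>x. f x * pderiv_at i \<phi> x \<partial>torus) = - (\<integral>x. g x * \<phi> x \<partial>torus))"

text \<open>A representative of the weak derivative, which is unique up to null sets; meaningful only if
  a weak derivative exists.\<close>
definition weak_pderiv :: "'d::finite \<Rightarrow> (real ^ 'd \<Rightarrow> real) \<Rightarrow> real ^ 'd \<Rightarrow> real" where
  "weak_pderiv i f = (SOME g. has_weak_pderiv i f g)"

definition weakly_differentiable :: "(real ^ 'd::finite \<Rightarrow> real) \<Rightarrow> bool" where
  "weakly_differentiable f \<longleftrightarrow> (\<forall>i. \<exists>g. has_weak_pderiv i f g)"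

definition esqrt :: "ennreal \<Rightarrow> ennreal" where
  "esqrt a = (if a = \<infinity> then \<infinity> else ennreal (sqrt (enn2real a)))"

definition L2_norm :: "(real ^ 'd::finite \<Rightarrow> real) \<Rightarrow> ennreal" where
  "L2_norm f = esqrt (\<integral>\<^sup>+x. ennreal ((f x)\<^sup>2) \<partial>torus)"

definition L2_space :: "(real ^ 'd::finite \<Rightarrow> real) set" where
  "L2_space = {f. periodic f \<and> f \<in> borel_measurable torus \<and> L2_norm f < \<infinity>}"

definition H1_seminorm :: "(real ^ 'd::finite \<Rightarrow> real) \<Rightarrow> ennreal" where
  "H1_seminorm f =
     (if weakly_differentiable f
      then esqrt (\<Sum>i\<in>UNIV. (L2_norm (weak_pderiv i f))\<^sup>2) else \<infinity>)"

definition H2_seminorm :: "(real ^ 'd::finite \<Rightarrow> real) \<Rightarrow> ennreal" where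
  "H2_seminorm f =
     (if weakly_differentiable f \<and> (\<forall>j. weakly_differentiable (weak_pderiv j f))
      then esqrt (\<Sum>i\<in>UNIV. \<Sum>j\<in>UNIV. (L2_norm (weak_pderiv i (weak_pderiv j f)))\<^sup>2) else \<infinity>)"

definition H2_space :: "(real ^ 'd::finite \<Rightarrow> real) set" where
  "H2_space = {f \<in> L2_space. H1_seminorm f < \<infinity> \<and> H2_seminorm f < \<infinity>}"

definition Linf_norm :: "(real ^ 'd::finite \<Rightarrow> real) \<Rightarrow> ennreal" where
  "Linf_norm f = esssup torus (\<lambda>x. ennreal \<bar>f x\<bar>)"

definition W1inf_norm :: "(real ^ 'd::finite \<Rightarrow> real) \<Rightarrow> ennreal" where
  "W1inf_norm f =
     (if weakly_differentiable f
      then Linf_norm f + (\<Sum>i\<in>UNIV. Linf_norm (weak_pderiv i f)) else \<infinity>)"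


subsection \<open>Velocity fields and solutions\<close>

definition Linf_loc_W1inf :: "real \<Rightarrow> (real \<Rightarrow> real ^ 'd::finite \<Rightarrow> real ^ 'd) \<Rightarrow> bool" where
  "Linf_loc_W1inf T u \<longleftrightarrow>
     (\<lambda>(t, x). u t x) \<in> borel_measurable (restrict_space lborel {0..<T} \<Otimes>\<^sub>M torus) \<and>
     (\<forall>t\<in>{0..<T}. \<exists>M::real. AE s in lborel. s \<in> {0..t} \<longrightarrow>
        (\<Sum>k\<in>UNIV. W1inf_norm (\<lambda>x. u s x $ k)) \<le> ennreal M)"

definition divergence_free :: "(real ^ 'd::finite \<Rightarrow> real ^ 'd) \<Rightarrow> bool" where
  "divergence_free v \<longleftrightarrow> (\<forall>\<phi>\<in>test_functions. (\<integral>x. v x \<bullet> grad \<phi> x \<partial>torus) = 0)"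

text \<open>Solutions on \<open>[0,T)\<close> of \<open>\<partial>\<^sub>t f + u \<cdot> \<nabla>f = \<kappa> \<Delta>f\<close> with initial datum \<open>f\<^sub>0\<close>, for divergence free
  \<open>u\<close> and \<open>\<kappa> \<ge> 0\<close>: \<open>f\<close> is in \<open>C([0,T); L\<^sup>2) \<inter> L\<^sup>2\<^sub>l\<^sub>o\<^sub>c([0,T); H\<^sup>1)\<close> and the equation holds
  in the sense of distributions, in the form integrated in time. For \<open>u\<close> in
  \<open>L\<^sup>\<infinity>\<^sub>l\<^sub>o\<^sub>c([0,T); W\<^bsup>1,\<infinity>\<^esup>)\<close> and \<open>f\<^sub>0\<close> in \<open>H\<^sup>1\<close> there is exactly one such solution, also for \<open>\<kappa> = 0\<close>,
  where it is the transport of \<open>f\<^sub>0\<close> by the Lipschitz flow of \<open>u\<close>.\<close>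
definition advection_diffusion_solution ::
    "real \<Rightarrow> (real \<Rightarrow> real ^ 'd::finite \<Rightarrow> real ^ 'd) \<Rightarrow> real \<Rightarrow> (real ^ 'd \<Rightarrow> real) \<Rightarrow>
     (real \<Rightarrow> real ^ 'd \<Rightarrow> real) \<Rightarrow> bool" where
  "advection_diffusion_solution T u \<kappa> f\<^sub>0 f \<longleftrightarrow>
     (\<forall>t\<in>{0..<T}. f t \<in> L2_space) \<and>
     (\<forall>t\<in>{0..<T}. ((\<lambda>s. L2_norm (\<lambda>x. f s x - f t x)) \<longlongrightarrow> 0) (at t within {0..<T})) \<and>
     (\<forall>t\<in>{0..<T}. (\<integral>\<^sup>+s\<in>{0..t}. (H1_seminorm (f s))\<^sup>2 \<partial>lborel) < \<infinity>) \<and>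
     (AE x in torus. f 0 x = f\<^sub>0 x) \<and>
     (\<forall>\<phi>\<in>test_functions. \<forall>t\<in>{0..<T}.
        has_bochner_integral (restrict_space lborel {0..t})
          (\<lambda>s. \<integral>x. f s x * (u s x \<bullet> grad \<phi> x + \<kappa> * laplacian \<phi> x) \<partial>torus)
          ((\<integral>x. f t x * \<phi> x \<partial>torus) - (\<integral>x. f 0 x * \<phi> x \<partial>torus)))"

end

theory Submission
  imports Defs
begin

text \<open>
  The proof compares the viscous solution \<open>\<theta>\<^sup>\<kappa>\<close> with the inviscid one \<open>\<theta>\<close> through the difference
  \<open>w = \<theta>\<^sup>\<kappa> - \<theta>\<close>, which vanishes at time \<open>0\<close>. Since \<open>u\<close> is divergence free, transport drops out of the
  energy balance of \<open>w\<close>, and \<open>d/dt |w|\<^sup>2 = - 2 \<kappa> \<langle>\<nabla>w, \<nabla>\<theta>\<^sup>\<kappa>\<rangle>\<close>. Interpolation between \<open>L\<^sup>2\<close> and \<open>H\<^sup>2\<close>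
  together with the hypothesis on second derivatives gives \<open>|\<nabla>w|\<^sup>2 \<le> (|w| / l) |\<nabla>\<theta>|\<^sup>2\<close> with
  \<open>l = c |\<theta>\<^sub>0|\<close>. Hence, as long as \<open>|w| \<le> r\<^sup>2 l\<close> for some \<open>r < 1\<close>, the gradients are comparable,
  \<open>(1 - r) |\<nabla>\<theta>| \<le> |\<nabla>\<theta>\<^sup>\<kappa>|\<close>, and \<open>d/dt |w|\<^sup>2 \<le> 2 \<kappa> r / (1 - r) |\<nabla>\<theta>\<^sup>\<kappa>|\<^sup>2\<close>
  (\<open>gradient_comparison\<close>, \<open>energy\<close>). If the total dissipation were smaller than claimed, then this
  inequality, used with \<open>r = 1/2\<close> up to \<open>|w| = l/4\<close> and with \<open>r = 3/4\<close> from there on, would keep \<open>|w|\<close>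
  below \<open>9/16 l\<close> (\<open>two_thresholds\<close>). The gradients would be comparable on all of \<open>[0, T)\<close>, and the
  blow-up of the integral of \<open>|\<nabla>\<theta>|\<^sup>2\<close> would make the dissipation infinite (\<open>lower_bound\<close>).

  The solutions are weak, so the energy balance has to be justified. For this everything is expressed in
  the orthonormal basis of Hartley functions \<open>cos (k \<cdot> x) + sin (k \<cdot> x)\<close>. Completeness of the basis
  (\<open>coefficients_zero_imp_zero\<close>) and the theorem of Riesz and Fischer give Parseval's identity.
  The seminorms become weighted sums of squared coefficients, so they are measurable in time and finite
  at almost all times. The equation becomes one scalar equation for each coefficient, whose square
  is differentiated with the help of Fubini's theorem (\<open>primitive_square\<close>). In the sum over all modes
  the transport term cancels, because on pairs of modes a divergence free field acts by an antisymmetric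
  matrix (\<open>weak_transport\<close>, \<open>advected_orthogonal\<close>).
\<close>

section \<open>Integration and Hartley functions on the torus\<close>

lemma torus_sets: "cbox 0 (\<chi> i. 2 * pi) \<inter> space lborel \<in> sets lborel"
  by simp

lemma space_torus: "space (torus :: (real ^ 'd::finite) measure) = cbox 0 (\<chi> i. 2 * pi)"
  by (simp add: torus_def space_restrict_space)

lemma emeasure_torus: "emeasure torus (space (torus :: (real ^ 'd::finite) measure)) = ennreal ((2 * pi) ^ CARD('d))"
proof -
  have "emeasure torus (space (torus :: (real ^ 'd) measure)) = emeasure lborel (cbox 0 (\<chi> i. 2 * pi) :: (real^'d) set)"
    unfolding space_torus unfolding torus_def by (rule emeasure_restrict_space) auto
  also have "\<dots> = ennreal (measure lborel (cbox 0 (\<chi> i. 2 * pi) :: (real^'d) set))"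
    by (rule emeasure_eq_ennreal_measure) (metis emeasure_lborel_cbox_finite infinity_ennreal_def less_irrefl)
  also have "measure lborel (cbox 0 (\<chi> i. 2 * pi) :: (real^'d) set) = (2 * pi) ^ CARD('d)"
    by (subst content_cbox_cart) (auto simp: interval_ne_empty_cart)
  finally show ?thesis .
qed

lemma finite_measure_torus: "finite_measure (torus :: (real ^ 'd::finite) measure)"
  by (rule finite_measureI) (simp add: emeasure_torus)

lemma measurable_torus [intro]: "f \<in> borel_measurable borel \<Longrightarrow> f \<in> borel_measurable torus"
  unfolding torus_def by (rule measurable_restrict_space1) simp

lemma continuous_measurable_torus:
  "continuous_on UNIV f \<Longrightarrow> f \<in> borel_measurable (torus :: (real ^ 'd::finite) measure)"
  by (intro measurable_torus borel_measurable_continuous_onI)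

lemma AE_torus_iff:
  "(AE x in torus. P x) \<longleftrightarrow> (AE x in lborel. x \<in> cbox 0 (\<chi> i::'d::finite. 2 * pi) \<longrightarrow> P x)"
  unfolding torus_def by (rule AE_restrict_space_iff) simp

lemma continuous_torus:
  fixes f :: "real ^ 'd::finite \<Rightarrow> real"
  assumes "continuous_on UNIV f"
  shows "integrable torus f" "(\<integral>x. f x \<partial>torus) = integral (cbox 0 (\<chi> i. 2 * pi)) f"
proof -
  have c: "continuous_on (cbox 0 (\<chi> i. 2 * pi)) f"
    using assms continuous_on_subset by blast
  have s: "set_integrable lborel (cbox 0 (\<chi> i. 2 * pi)) f"
    unfolding set_integrable_def by (rule borel_integrable_compact[OF _ c]) simp
  show "integrable torus f"
    unfolding torus_def integrable_restrict_space[OF torus_sets] using s[unfolded set_integrable_def] .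
  show "(\<integral>x. f x \<partial>torus) = integral (cbox 0 (\<chi> i. 2 * pi)) f"
    unfolding torus_def integral_restrict_space[OF torus_sets]
    using set_borel_integral_eq_integral(2)[OF s] by (simp add: set_lebesgue_integral_def)
qed

text \<open>Shifting the period cube along an axis removes a slab on one side and adds its translate by one
  period on the other.\<close>
lemma integral_periodic_shift:
  fixes f :: "real ^ 'd::finite \<Rightarrow> real"
  assumes f: "continuous_on UNIV f" and p: "periodic f" and h: "h \<in> {0..2 * pi}"
  shows "integral (cbox 0 (\<chi> i. 2 * pi)) (\<lambda>x. f (x + axis i h)) = integral (cbox 0 (\<chi> i. 2 * pi)) f"
proof -
  have box_coord: "x \<in> cbox l r \<longleftrightarrow> (l $ i \<le> x $ i \<and> x $ i \<le> r $ i) \<and> (\<forall>j\<in>-{i}. l $ j \<le> x $ j \<and> x $ j \<le> r $ j)"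
    for x l r :: "real ^ 'd" by (auto simp: mem_box_cart)
  define b :: "real ^ 'd" where "b = (\<chi> i. 2 * pi)"
  have c: "\<And>S. continuous_on S f" using f continuous_on_subset by blast
  have ax: "axis i (1::real) \<in> (Basis :: (real^'d) set)" by (simp add: axis_in_Basis_iff)
  have pf: "f (x + axis i (2 * pi)) = f x" for x
    using p unfolding periodic_def by blast
  have split: "integral (cbox l r) f = integral (cbox l r \<inter> {x. x $ i \<le> t}) f + integral (cbox l r \<inter> {x. x $ i \<ge> t}) f" for l r t
    using integral_split[OF integrable_continuous[OF c] ax, of l r t]
    by (simp add: inner_axis)
  let ?h = "axis i h :: real^'d"
  have "integral (cbox 0 b) (\<lambda>x. f (x + ?h)) = integral (cbox (?h - ?h) (b + ?h - ?h)) (\<lambda>x. f (x + ?h))"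
    by simp
  also have "\<dots> = integral (cbox ?h (b + ?h)) f"
    by (rule integral_shift_cbox)
  also have "\<dots> = integral (cbox ?h (b + ?h) \<inter> {x. x $ i \<le> 2 * pi}) f
       + integral (cbox ?h (b + ?h) \<inter> {x. x $ i \<ge> 2 * pi}) f"
    by (rule split)
  also have "cbox ?h (b + ?h) \<inter> {x. x $ i \<ge> 2 * pi} = cbox (axis i (2 * pi)) (b + ?h)"
    using h by (auto simp: set_eq_iff box_coord b_def axis_def)
  also have "cbox ?h (b + ?h) \<inter> {x. x $ i \<le> 2 * pi} = cbox 0 b \<inter> {x. x $ i \<ge> h}"
    using h by (auto simp: set_eq_iff box_coord b_def axis_def)
  also have "integral (cbox (axis i (2 * pi)) (b + ?h)) f
      = integral (cbox (axis i (2 * pi) - axis i (2 * pi)) (b + ?h - axis i (2 * pi))) (\<lambda>x. f (x + axis i (2 * pi)))"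
    by (rule integral_shift_cbox[symmetric])
  also have "\<dots> = integral (cbox 0 (b + ?h - axis i (2 * pi))) f"
    by (simp add: pf)
  also have "cbox 0 (b + ?h - axis i (2 * pi)) = cbox 0 b \<inter> {x. x $ i \<le> h}"
    using h by (auto simp: set_eq_iff box_coord b_def axis_def)
  finally show ?thesis
    using split[of 0 b h] by (simp add: b_def)
qed

text \<open>The integral of \<open>f (x + h e\<^sub>i)\<close> over the torus does not depend on \<open>h\<close>; its derivative at \<open>h = 0\<close>,
  taken under the integral, is the integral of \<open>\<partial>\<^sub>i f\<close>.\<close>
lemma integral_pderiv_periodic:
  fixes f :: "real ^ 'd::finite \<Rightarrow> real"
  assumes p: "periodic f" and d: "\<And>x. f differentiable (at x)"
    and c: "continuous_on UNIV (pderiv_at i f)"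
  shows "(\<integral>x. pderiv_at i f x \<partial>torus) = 0"
proof -
  let ?C = "cbox 0 (\<chi> i. 2 * pi) :: (real^'d) set"
  let ?U = "{0..2 * pi :: real}"
  have cf: "continuous_on UNIV f"
    using d by (meson continuous_at_imp_continuous_on differentiable_imp_continuous_within)
  define v where "v = (axis i 1 :: real^'d)"
  have lin: "axis i h = h *\<^sub>R v" for h
    by (auto simp: v_def axis_def vec_eq_iff)
  have D: "((\<lambda>h. f (x + axis i h)) has_vector_derivative pderiv_at i f (x + axis i h)) (at h within ?U)" for h x
  proof -
    have "(f has_derivative frechet_derivative f (at (x + h *\<^sub>R v))) (at (x + h *\<^sub>R v))"
      using d frechet_derivative_works by blast
    moreover have "((\<lambda>h. x + h *\<^sub>R v :: real^'d) has_derivative (\<lambda>t. t *\<^sub>R v)) (at h within ?U)"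
      by (auto intro!: derivative_eq_intros)
    ultimately have "((\<lambda>h. f (x + h *\<^sub>R v)) has_derivative
        (\<lambda>t. frechet_derivative f (at (x + h *\<^sub>R v)) (t *\<^sub>R v))) (at h within ?U)"
      by (rule has_derivative_compose[rotated])
    moreover have "linear (frechet_derivative f (at (x + h *\<^sub>R v)))"
      using d linear_frechet_derivative by blast
    ultimately show ?thesis
      unfolding has_vector_derivative_def pderiv_at_def lin by (simp add: linear_cmul)
  qed
  have "((\<lambda>h. integral ?C (\<lambda>x. f (x + axis i h))) has_vector_derivative
     integral ?C (\<lambda>x. pderiv_at i f (x + axis i 0))) (at 0 within ?U)"
  proof (rule leibniz_rule_vector_derivative)
    show "\<And>h. (\<lambda>x. f (x + axis i h)) integrable_on ?C"
      unfolding lin by (intro integrable_continuous continuous_on_compose2[OF cf] continuous_intros) auto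
    show "continuous_on (?U \<times> ?C) (\<lambda>(h, x). pderiv_at i f (x + axis i h))"
      unfolding split_beta lin
      by (intro continuous_on_compose2[OF c] continuous_intros) auto
  qed (use D in auto)
  moreover have "((\<lambda>h. integral ?C (\<lambda>x. f (x + axis i h))) has_vector_derivative 0) (at 0 within ?U)"
  proof (rule has_vector_derivative_transform[where f = "\<lambda>_. integral ?C f"])
    show "integral ?C (\<lambda>x. f (x + axis i h)) = integral ?C f" if "h \<in> ?U" for h
      by (rule integral_periodic_shift[OF cf p that])
  qed auto
  ultimately have "integral ?C (\<lambda>x. pderiv_at i f (x + axis i 0)) = 0"
    using vector_derivative_unique_within_closed_interval[of 0 "2 * pi" 0] by (smt (verit) atLeastAtMost_iff box_real(2) pi_gt_zero)
  then show ?thesis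
    using continuous_torus(2)[OF c] by (simp add: axis_def zero_vec_def[symmetric])
qed

definition phase :: "int ^ 'd::finite \<Rightarrow> real ^ 'd \<Rightarrow> real" where
  "phase k x = (\<Sum>i\<in>UNIV. of_int (k $ i) * x $ i)"

lemma phase_simps [simp]:
  "phase (k + l) x = phase k x + phase l x" "phase (k - l) x = phase k x - phase l x"
  "phase (- k) x = - phase k x" "phase 0 x = 0"
  by (simp_all add: phase_def algebra_simps sum.distrib sum_subtractf sum_negf)

lemma phase_axis: "phase k (axis i t) = of_int (k $ i) * t"
  by (simp add: phase_def axis_def if_distrib[of "\<lambda>y. _ * y"] cong: if_cong)

lemma phase_axis_left: "phase (axis i 1) x = x $ i"
  by (simp add: phase_def axis_def if_distrib[of of_int] if_distrib[of "\<lambda>y. y * _"] cong: if_cong)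

lemma phase_add: "phase k (x + y) = phase k x + phase k y"
  by (simp add: phase_def algebra_simps sum.distrib)

lemma has_derivative_phase: "(phase k has_derivative phase k) (at x)"
  unfolding phase_def
  by (intro has_derivative_sum has_derivative_mult_right bounded_linear_imp_has_derivative bounded_linear_vec_nth)

lemma continuous_phase: "continuous_on A (phase k)"
  unfolding phase_def by (intro continuous_intros)

lemma has_derivative_osc:
  "((\<lambda>x. a * cos (phase k x + b)) has_derivative (\<lambda>h. (a * cos (phase k x + (b + pi / 2))) * phase k h)) (at x)"
proof -
  have "((\<lambda>x. a * cos (phase k x + b)) has_derivative (\<lambda>h. a * (- sin (phase k x + b) * (phase k h + 0)))) (at x)"
    by (auto intro!: derivative_eq_intros has_derivative_phase)
  moreover have "cos (phase k x + (b + pi / 2)) = - sin (phase k x + b)"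
    by (simp add: minus_sin_cos_eq add.assoc)
  ultimately show ?thesis by (simp add: mult.assoc)
qed

text \<open>The derivative of a cosine is written as a cosine with shifted phase, so that the family of these
  functions is closed under differentiation and smoothness follows by induction.\<close>
lemma pderiv_at_osc:
  "pderiv_at i (\<lambda>x. a * cos (phase k x + b)) = (\<lambda>x. (a * of_int (k $ i)) * cos (phase k x + (b + pi / 2)))"
  unfolding pderiv_at_def fun_eq_iff
  using frechet_derivative_at[OF has_derivative_osc, of a k _ b, symmetric]
  by (simp add: phase_axis)

lemma differentiable_osc: "(\<lambda>x. a * cos (phase k x + b)) differentiable (at x)"
  unfolding differentiable_def using has_derivative_osc by blast

lemma C_times_osc: "C_times n (\<lambda>x. a * cos (phase k x + b))"
proof (induction n arbitrary: a b)
  case 0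
  show ?case by (auto intro!: continuous_intros continuous_phase)
next
  case (Suc n)
  show ?case
    unfolding C_times.simps pderiv_at_osc using differentiable_osc Suc.IH by blast
qed

lemma pderiv_at_add:
  assumes "\<And>x. f differentiable (at x)" "\<And>x. g differentiable (at x)"
  shows "pderiv_at i (\<lambda>x. f x + g x) = (\<lambda>x. pderiv_at i f x + pderiv_at i g x)"
proof
  fix x
  have "((\<lambda>x. f x + g x) has_derivative (\<lambda>h. frechet_derivative f (at x) h + frechet_derivative g (at x) h)) (at x)"
    using assms by (intro has_derivative_add) (auto simp: frechet_derivative_works[symmetric])
  from frechet_derivative_at[OF this] show "pderiv_at i (\<lambda>x. f x + g x) x = pderiv_at i f x + pderiv_at i g x"
    unfolding pderiv_at_def by metis
qed

lemma C_times_add: "C_times n f \<Longrightarrow> C_times n g \<Longrightarrow> C_times n (\<lambda>x. f x + g x)"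
proof (induction n arbitrary: f g)
  case 0
  then show ?case by (simp add: continuous_on_add)
next
  case (Suc n)
  then have d: "\<And>x. f differentiable (at x)" "\<And>x. g differentiable (at x)"
    and c: "\<And>i. C_times n (pderiv_at i f)" "\<And>i. C_times n (pderiv_at i g)" by simp_all
  show ?case
    unfolding C_times.simps pderiv_at_add[OF d] using d c Suc.IH by (blast intro: differentiable_add)
qed

lemma periodic_osc: "periodic (\<lambda>x. a * cos (phase k x + b))"
  unfolding periodic_def
proof (intro allI)
  fix x i
  have "phase k (x + axis i (2 * pi)) + b = (phase k x + b) + 2 * pi * of_int (k $ i)"
    by (simp add: phase_add phase_axis)
  then show "a * cos (phase k (x + axis i (2 * pi)) + b) = a * cos (phase k x + b)"
    by (simp only: cos_add[of _ "2 * pi * of_int (k $ i)"] cos_int_2pin sin_int_2pin) simp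
qed

lemma periodic_add: "periodic f \<Longrightarrow> periodic g \<Longrightarrow> periodic (\<lambda>x. f x + g x)"
  by (simp add: periodic_def)

lemma test_osc: "(\<lambda>x. a * cos (phase k x + b)) \<in> test_functions"
  unfolding test_functions_def using periodic_osc C_times_osc by auto

lemma test_add: "f \<in> test_functions \<Longrightarrow> g \<in> test_functions \<Longrightarrow> (\<lambda>x. f x + g x) \<in> test_functions"
  unfolding test_functions_def by (auto intro: periodic_add C_times_add)

lemma osc_integral_nonzero:
  assumes "k \<noteq> (0 :: int ^ 'd::finite)"
  shows "(\<integral>x. cos (phase k x + b) \<partial>torus) = 0"
proof -
  obtain i where i: "k $ i \<noteq> 0" using assms by (auto simp: vec_eq_iff)
  let ?f = "\<lambda>x. (1 / of_int (k $ i)) * cos (phase k x + (b - pi / 2))"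
  have e: "pderiv_at i ?f = (\<lambda>x. cos (phase k x + b))"
    unfolding pderiv_at_osc using i by simp
  show ?thesis
    using integral_pderiv_periodic[OF periodic_osc differentiable_osc, of i "1 / of_int (k $ i)" k "b - pi / 2"]
    unfolding e by (simp add: continuous_phase continuous_on_add continuous_on_cos)
qed

text \<open>The normalized Hartley functions. They form a real orthonormal basis of \<open>L\<^sup>2\<close> that is indexed by the
  whole lattice, without pairing sines and cosines, and \<open>\<partial>\<^sub>i\<close> maps mode \<open>k\<close> to \<open>k\<^sub>i\<close> times mode \<open>- k\<close>.\<close>
definition hartley :: "int ^ 'd::finite \<Rightarrow> real ^ 'd \<Rightarrow> real" where
  "hartley k x = (cos (phase k x) + sin (phase k x)) / sqrt ((2 * pi) ^ CARD('d))"

lemma hartley_osc: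
  "hartley k x = (1 / sqrt ((2 * pi) ^ CARD('d))) * cos (phase k x + 0)
      + (1 / sqrt ((2 * pi) ^ CARD('d))) * cos (phase k x + (- pi / 2))" for k :: "int ^ 'd::finite"
proof -
  have "cos (phase k x + (- pi / 2)) = sin (phase k x)" by (simp add: cos_diff)
  then show ?thesis by (simp add: hartley_def add_divide_distrib)
qed

lemma hartley_test: "hartley k \<in> test_functions"
  unfolding hartley_osc[abs_def] by (intro test_add test_osc)

lemma continuous_hartley: "continuous_on A (hartley k)"
  unfolding hartley_def[abs_def] by (intro continuous_intros continuous_phase) auto

lemma pderiv_at_hartley: "pderiv_at i (hartley k) = (\<lambda>x. of_int (k $ i) * hartley (- k) x)"
proof -
  define N where "N = 1 / sqrt ((2 * pi) ^ CARD('a))"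
  have e: "hartley k = (\<lambda>x. N * cos (phase k x + 0) + N * cos (phase k x + (- pi / 2)))"
    unfolding hartley_osc[abs_def] N_def ..
  have "pderiv_at i (hartley k) x = of_int (k $ i) * hartley (- k) x" for x
    unfolding e pderiv_at_add[OF differentiable_osc differentiable_osc] pderiv_at_osc
    by (simp add: hartley_def cos_add N_def algebra_simps add_divide_distrib diff_divide_distrib)
  then show ?thesis by auto
qed

text \<open>The eigenvalue \<open>|k|\<^sup>2\<close> of \<open>- \<Delta>\<close> on mode \<open>k\<close>.\<close>
definition freq2 :: "int ^ 'd::finite \<Rightarrow> real" where
  "freq2 k = (\<Sum>i\<in>UNIV. (of_int (k $ i))\<^sup>2)"

lemma test_differentiable: "f \<in> test_functions \<Longrightarrow> f differentiable (at x)"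
  unfolding test_functions_def using C_times.simps(2)[of 0 f] by blast

lemma pderiv_at_scale:
  assumes "\<And>x. f differentiable (at x)"
  shows "pderiv_at i (\<lambda>x. c * f x) = (\<lambda>x. c * pderiv_at i f x)"
proof
  fix x
  have "((\<lambda>x. c * f x) has_derivative (\<lambda>h. c * frechet_derivative f (at x) h)) (at x)"
    using assms by (intro has_derivative_mult_right) (auto simp: frechet_derivative_works[symmetric])
  from frechet_derivative_at[OF this] show "pderiv_at i (\<lambda>x. c * f x) x = c * pderiv_at i f x"
    unfolding pderiv_at_def by metis
qed

lemma laplacian_hartley: "laplacian (hartley k) x = - freq2 k * hartley k x"
proof -
  have "pderiv_at i (pderiv_at i (hartley k)) x = - ((of_int (k $ i))\<^sup>2 * hartley k x)" for i
    unfolding pderiv_at_hartley pderiv_at_scale[OF test_differentiable[OF hartley_test]]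
    by (simp add: power2_eq_square)
  then show ?thesis
    by (simp add: laplacian_def freq2_def sum_negf sum_distrib_right)
qed

lemma hartley_mult:
  "hartley k x * hartley l x = 1 / (2 * pi) ^ CARD('d) * cos (phase (k - l) x + 0)
     + 1 / (2 * pi) ^ CARD('d) * cos (phase (k + l) x + (- pi / 2))" for k l :: "int ^ 'd::finite"
proof -
  have "cos (phase (k + l) x + (- pi / 2)) = sin (phase k x + phase l x)"
    by (simp add: cos_diff[of "_ + _"])
  moreover have "cos (phase (k - l) x + 0) = cos (phase k x - phase l x)" by simp
  moreover have "hartley k x * hartley l x =
      (cos (phase k x) + sin (phase k x)) * (cos (phase l x) + sin (phase l x)) / (2 * pi) ^ CARD('d)"
    unfolding hartley_def by simp
  ultimately show ?thesis by (simp add: cos_diff sin_add algebra_simps add_divide_distrib)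
qed

text \<open>In the product of two modes only the term \<open>cos ((k - l) \<cdot> x)\<close> with \<open>k = l\<close> has a nonzero mean.\<close>
lemma hartley_orthonormal:
  "(\<integral>x. hartley k x * hartley l x \<partial>torus) = (if k = l then 1 else 0)" for k l :: "int ^ 'd::finite"
proof -
  define V where "V = (2 * pi) ^ CARD('d)"
  have V: "V > 0" by (simp add: V_def)
  have e: "hartley k x * hartley l x = (cos (phase (k - l) x + 0) + cos (phase (k + l) x + (- pi / 2))) / V" for x
    unfolding hartley_mult V_def[symmetric] by (simp add: add_divide_distrib)
  have i: "integrable torus (\<lambda>x. cos (phase m x + b))" for m :: "int^'d" and b
    by (intro continuous_torus continuous_intros continuous_phase)
  have z: "(\<integral>x. cos (phase m x + (- pi / 2)) \<partial>torus) = 0" for m :: "int^'d"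
    using osc_integral_nonzero[of m "- pi / 2"] by (cases "m = 0") simp_all
  interpret finite_measure "torus :: (real^'d) measure" by (rule finite_measure_torus)
  have m: "measure torus (space (torus :: (real^'d) measure)) = V"
    by (simp add: measure_def emeasure_torus V_def)
  have "(\<integral>x. hartley k x * hartley l x \<partial>torus) = ((\<integral>x. cos (phase (k - l) x + 0) \<partial>torus) + 0) / V"
    unfolding e using i[of "k - l" 0] i[of "k + l" "- pi / 2"] z[of "k + l"] by (simp add: Bochner_Integration.integral_add)
  also have "\<dots> = (if k = l then 1 else 0)"
    using osc_integral_nonzero[of "k - l" 0] V m by auto
  finally show ?thesis .
qed

section \<open>Uniqueness of Hartley coefficients\<close>

definition hcoeff :: "(real ^ 'd::finite \<Rightarrow> real) \<Rightarrow> int ^ 'd \<Rightarrow> real" where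
  "hcoeff f k = (\<integral>x. f x * hartley k x \<partial>torus)"

lemma osc_hartley:
  "\<exists>p q. \<forall>x. cos (phase k x + b) = p * hartley k x + q * hartley (- k) x" for k :: "int ^ 'd::finite"
proof (intro exI allI)
  define N where "N = sqrt ((2 * pi) ^ CARD('d))"
  have N: "N > 0" by (simp add: N_def)
  fix x :: "real ^ 'd"
  show "cos (phase k x + b) = (N / 2 * (cos b - sin b)) * hartley k x + (N / 2 * (cos b + sin b)) * hartley (- k) x"
    unfolding hartley_def N_def[symmetric] using N by (simp add: cos_add field_simps)
qed

lemma integrable_mult_bounded:
  fixes f \<psi> :: "'a \<Rightarrow> real"
  assumes "integrable M f" "\<psi> \<in> borel_measurable M" "\<And>x. \<bar>\<psi> x\<bar> \<le> C"
  shows "integrable M (\<lambda>x. f x * \<psi> x)"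
proof (rule Bochner_Integration.integrable_bound)
  show "integrable M (\<lambda>x. C * \<bar>f x\<bar>)" using assms(1) by simp
  show "(\<lambda>x. f x * \<psi> x) \<in> borel_measurable M" using assms(1,2) by measurable
  show "AE x in M. norm (f x * \<psi> x) \<le> norm (C * \<bar>f x\<bar>)"
  proof (rule AE_I2)
    fix x
    have "\<bar>f x\<bar> * \<bar>\<psi> x\<bar> \<le> \<bar>f x\<bar> * \<bar>C\<bar>"
      by (rule mult_left_mono) (use assms(3)[of x] in auto)
    then show "norm (f x * \<psi> x) \<le> norm (C * \<bar>f x\<bar>)" by (simp add: abs_mult mult.commute)
  qed
qed

lemma hartley_bounded: "\<bar>hartley k x\<bar> \<le> 2 / sqrt ((2 * pi) ^ CARD('d))" for k :: "int ^ 'd::finite"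
proof -
  have "\<bar>cos (phase k x) + sin (phase k x)\<bar> \<le> 2"
    using abs_triangle_ineq[of "cos (phase k x)" "sin (phase k x)"] abs_cos_le_one[of "phase k x"] abs_sin_le_one[of "phase k x"]
    by linarith
  then show ?thesis by (simp add: hartley_def divide_right_mono)
qed

lemma integrable_mult_hartley: "integrable torus f \<Longrightarrow> integrable torus (\<lambda>x. f x * hartley k x)"
  by (rule integrable_mult_bounded[OF _ continuous_measurable_torus[OF continuous_hartley] hartley_bounded])

text \<open>The bounded functions \<open>\<psi>\<close> for which \<open>f \<psi>\<close> has no trigonometric moments. This class is closed under
  multiplication by \<open>cos (x\<^sub>i - m)\<close> and under bounded limits, so it grows from the constant \<open>1\<close> to the
  indicators of boxes once all coefficients of \<open>f\<close> vanish.\<close>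
definition annihilates :: "(real ^ 'd::finite \<Rightarrow> real) \<Rightarrow> (real ^ 'd \<Rightarrow> real) \<Rightarrow> bool" where
  "annihilates f \<psi> \<longleftrightarrow> \<psi> \<in> borel_measurable torus \<and> (\<exists>C. \<forall>x. \<bar>\<psi> x\<bar> \<le> C) \<and>
     (\<forall>k b. (\<integral>x. f x * \<psi> x * cos (phase k x + b) \<partial>torus) = 0)"

lemma osc_measurable [measurable]: "(\<lambda>x. cos (phase k x + b)) \<in> borel_measurable torus"
  by (intro continuous_measurable_torus continuous_intros continuous_phase)

lemma coord_measurable [measurable]: "(\<lambda>x. x $ i) \<in> borel_measurable (torus :: (real ^ 'd::finite) measure)"
  by (intro continuous_measurable_torus continuous_intros)

lemma coord_compose_measurable:
  assumes "g \<in> borel_measurable borel"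
  shows "(\<lambda>x. g (x $ i) :: real) \<in> borel_measurable (torus :: (real ^ 'd::finite) measure)"
  using measurable_compose[OF coord_measurable assms] .

context
  fixes f :: "real ^ 'd::finite \<Rightarrow> real"
  assumes f: "integrable torus f"
begin

lemma annihilates_integrable:
  assumes "annihilates f \<psi>"
  shows "integrable torus (\<lambda>x. f x * \<psi> x * cos (phase k x + b))"
proof -
  obtain C where "\<And>x. \<bar>\<psi> x\<bar> \<le> C" using assms annihilates_def by blast
  then have "integrable torus (\<lambda>x. f x * \<psi> x)"
    using assms by (intro integrable_mult_bounded[OF f]) (auto simp: annihilates_def)
  then show ?thesis by (rule integrable_mult_bounded[where C=1]) auto
qed

lemma annihilates_limit:
  assumes a: "\<And>n. annihilates f (\<psi> n)" and C: "\<And>n x. \<bar>\<psi> n x\<bar> \<le> C"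
    and l: "AE x in torus. (\<lambda>n. \<psi> n x) \<longlonglongrightarrow> \<phi> x" and m: "\<phi> \<in> borel_measurable torus"
    and B: "\<And>x. \<bar>\<phi> x\<bar> \<le> B"
  shows "annihilates f \<phi>"
  unfolding annihilates_def
proof (intro conjI allI)
  show "\<exists>C. \<forall>x. \<bar>\<phi> x\<bar> \<le> C" using B by blast
  fix k b
  have [measurable]: "f \<in> borel_measurable torus" using f by auto
  have [measurable]: "\<psi> n \<in> borel_measurable torus" for n using a annihilates_def by blast
  note m[measurable]
  have "(\<lambda>n. \<integral>x. f x * \<psi> n x * cos (phase k x + b) \<partial>torus) \<longlonglongrightarrow> (\<integral>x. f x * \<phi> x * cos (phase k x + b) \<partial>torus)"
  proof (rule integral_dominated_convergence[where w = "\<lambda>x. C * \<bar>f x\<bar>"])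
    show "AE x in torus. (\<lambda>n. f x * \<psi> n x * cos (phase k x + b)) \<longlonglongrightarrow> f x * \<phi> x * cos (phase k x + b)"
      using l by eventually_elim (intro tendsto_intros)
    show "AE x in torus. norm (f x * \<psi> n x * cos (phase k x + b)) \<le> C * \<bar>f x\<bar>" for n
    proof (rule AE_I2)
      fix x
      have "\<bar>f x\<bar> * \<bar>\<psi> n x\<bar> * \<bar>cos (phase k x + b)\<bar> \<le> \<bar>f x\<bar> * C * 1"
        by (intro mult_mono mult_left_mono C) (use C[of n x] in auto)
      then show "norm (f x * \<psi> n x * cos (phase k x + b)) \<le> C * \<bar>f x\<bar>" by (simp add: abs_mult mult.commute)
    qed
  qed (use f in auto)
  moreover have "(\<integral>x. f x * \<psi> n x * cos (phase k x + b) \<partial>torus) = 0" for n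
    using a annihilates_def by blast
  ultimately show "(\<integral>x. f x * \<phi> x * cos (phase k x + b) \<partial>torus) = 0"
    by (simp add: LIMSEQ_const_iff)
qed (rule m)

lemma annihilates_AE_cong:
  assumes "annihilates f \<psi>" "AE x in torus. \<psi> x = \<phi> x" "\<phi> \<in> borel_measurable torus" "\<And>x. \<bar>\<phi> x\<bar> \<le> B"
  shows "annihilates f \<phi>"
proof -
  obtain C where "\<And>x. \<bar>\<psi> x\<bar> \<le> C" using assms annihilates_def by blast
  moreover have "AE x in torus. (\<lambda>n::nat. \<psi> x) \<longlonglongrightarrow> \<phi> x"
    using assms(2) by eventually_elim simp
  ultimately show ?thesis
    by (intro annihilates_limit[of "\<lambda>_. \<psi>" C \<phi> B] assms)
qed

lemma annihilates_lin:
  assumes "annihilates f \<psi>" "annihilates f \<phi>"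
  shows "annihilates f (\<lambda>x. a * \<psi> x + c * \<phi> x)"
  unfolding annihilates_def
proof (intro conjI allI)
  obtain C D where C: "\<And>x. \<bar>\<psi> x\<bar> \<le> C" "\<And>x. \<bar>\<phi> x\<bar> \<le> D" using assms annihilates_def by metis
  have "\<bar>a * \<psi> x + c * \<phi> x\<bar> \<le> \<bar>a\<bar> * C + \<bar>c\<bar> * D" for x
    using abs_triangle_ineq[of "a * \<psi> x" "c * \<phi> x"] mult_left_mono[OF C(1)[of x], of "\<bar>a\<bar>"]
      mult_left_mono[OF C(2)[of x], of "\<bar>c\<bar>"] by (simp add: abs_mult)
  then show "\<exists>C. \<forall>x. \<bar>a * \<psi> x + c * \<phi> x\<bar> \<le> C" by blast
  show "(\<lambda>x. a * \<psi> x + c * \<phi> x) \<in> borel_measurable torus"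
    using assms unfolding annihilates_def by (auto intro!: borel_measurable_add borel_measurable_times)
  fix k b
  have "(\<integral>x. a * (f x * \<psi> x * cos (phase k x + b)) + c * (f x * \<phi> x * cos (phase k x + b)) \<partial>torus) = 0"
    using annihilates_integrable[OF assms(1), of k b] annihilates_integrable[OF assms(2), of k b] assms
    by (simp add: annihilates_def)
  then show "(\<integral>x. f x * (a * \<psi> x + c * \<phi> x) * cos (phase k x + b) \<partial>torus) = 0"
    by (simp add: algebra_simps)
qed

text \<open>A product of cosines is a sum of two cosines, with frequencies shifted by \<open>\<plusminus> e\<^sub>i\<close>.\<close>
lemma annihilates_mult_cos:
  assumes "annihilates f \<psi>"
  shows "annihilates f (\<lambda>x. \<psi> x * cos (x $ i - m))"
  unfolding annihilates_def
proof (intro conjI allI)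
  obtain C where C: "\<And>x. \<bar>\<psi> x\<bar> \<le> C" using assms annihilates_def by blast
  have "\<bar>\<psi> x * cos (x $ i - m)\<bar> \<le> C * 1" for x
    unfolding abs_mult by (intro mult_mono C) (use C[of x] in auto)
  then show "\<exists>C. \<forall>x. \<bar>\<psi> x * cos (x $ i - m)\<bar> \<le> C" by blast
  show "(\<lambda>x. \<psi> x * cos (x $ i - m)) \<in> borel_measurable torus"
    using assms coord_compose_measurable[of "\<lambda>t. cos (t - m)" i] unfolding annihilates_def by (auto intro!: borel_measurable_times)
  fix k b
  have e: "f x * (\<psi> x * cos (x $ i - m)) * cos (phase k x + b) =
      1/2 * (f x * \<psi> x * cos (phase (k + axis i 1) x + (b - m)))
      + 1/2 * (f x * \<psi> x * cos (phase (k - axis i 1) x + (b + m)))" for x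
  proof -
    have "cos (phase k x + b) * cos (x $ i - m) = (cos (phase k x + b - (x $ i - m)) + cos (phase k x + b + (x $ i - m))) / 2"
      by (rule cos_times_cos)
    then have "cos (x $ i - m) * cos (phase k x + b) =
       1/2 * cos (phase (k + axis i 1) x + (b - m)) + 1/2 * cos (phase (k - axis i 1) x + (b + m))"
      by (simp add: phase_axis_left algebra_simps)
    then show ?thesis by (simp add: algebra_simps)
  qed
  show "(\<integral>x. f x * (\<psi> x * cos (x $ i - m)) * cos (phase k x + b) \<partial>torus) = 0"
    unfolding e
    using annihilates_integrable[OF assms, of "k + axis i 1" "b - m"] annihilates_integrable[OF assms, of "k - axis i 1" "b + m"] assms
    by (simp add: annihilates_def del: phase_simps)
qed

lemma annihilates_mult_poly:
  assumes "real_polynomial_function p" "annihilates f \<psi>"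
  shows "annihilates f (\<lambda>x. \<psi> x * p (cos (x $ i - m)))"
  using assms
proof (induction arbitrary: \<psi>)
  case (linear p)
  have p: "p y = y * p 1" for y :: real
    using linear_cmul[OF bounded_linear.linear[OF linear(1)], of y 1] by simp
  have "(\<lambda>x. \<psi> x * p (cos (x $ i - m))) = (\<lambda>x. p 1 * (\<psi> x * cos (x $ i - m)) + 0 * \<psi> x)"
    by (subst p) (simp add: mult_ac)
  then show ?case using annihilates_lin[OF annihilates_mult_cos[OF linear(2), of i m] linear(2), of "p 1" 0] by simp
next
  case (const c)
  then show ?case using annihilates_lin[of \<psi> \<psi> c 0] by (simp add: mult.commute)
next
  case (add p q)
  then show ?case
    using annihilates_lin[of "\<lambda>x. \<psi> x * p (cos (x $ i - m))" "\<lambda>x. \<psi> x * q (cos (x $ i - m))" 1 1]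
    by (simp add: algebra_simps)
next
  case (mult p q)
  from mult.IH(2)[OF mult.IH(1)[OF mult.prems]] show ?case by (simp add: mult.assoc)
qed

text \<open>Weierstrass approximation of \<open>g\<close> by polynomials on \<open>[-1, 1]\<close>.\<close>
lemma annihilates_mult_continuous:
  fixes g :: "real \<Rightarrow> real"
  assumes a: "annihilates f \<psi>" and g: "continuous_on UNIV g"
  shows "annihilates f (\<lambda>x. \<psi> x * g (cos (x $ i - m)))"
proof -
  have gc: "continuous_on {-1..1} g" by (rule continuous_on_subset[OF g]) simp
  have "\<exists>p. real_polynomial_function p \<and> (\<forall>y\<in>{-1..1}. \<bar>g y - p y\<bar> < 1 / real (Suc n))" for n
    by (rule Stone_Weierstrass_real_polynomial_function[OF compact_Icc gc, of "1 / real (Suc n)"]) auto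
  then obtain p where p: "\<And>n. real_polynomial_function (p n)"
    "\<And>n y. y \<in> {-1..1} \<Longrightarrow> \<bar>g y - p n y\<bar> < 1 / real (Suc n)" by metis
  obtain G where G: "\<And>y. y \<in> {-1..1} \<Longrightarrow> \<bar>g y\<bar> \<le> G"
    using compact_imp_bounded[OF compact_continuous_image[OF gc compact_Icc]]
    unfolding bounded_iff by (metis imageI real_norm_def)
  obtain C where C: "\<And>x. \<bar>\<psi> x\<bar> \<le> C" using a annihilates_def by blast
  have C0: "C \<ge> 0" using C[of 0] by simp
  have cs: "cos t \<in> {-1..1}" for t :: real by simp
  have pG: "\<bar>p n (cos t)\<bar> \<le> G + 1" for n t
  proof -
    have "1 / real (Suc n) \<le> 1" by simp
    then show ?thesis using p(2)[OF cs, of t n] G[OF cs, of t] by linarith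
  qed
  show ?thesis
  proof (rule annihilates_limit)
    show "annihilates f (\<lambda>x. \<psi> x * p n (cos (x $ i - m)))" for n
      using annihilates_mult_poly p(1) a by blast
    show "\<bar>\<psi> x * p n (cos (x $ i - m))\<bar> \<le> C * (G + 1)" for n x
      unfolding abs_mult by (intro mult_mono C pG C0) auto
    show "\<bar>\<psi> x * g (cos (x $ i - m))\<bar> \<le> C * G" for x
      unfolding abs_mult by (intro mult_mono C G cs C0) auto
    have "(\<lambda>x. g (cos (x $ i - m))) \<in> borel_measurable torus"
      by (intro continuous_measurable_torus continuous_on_compose2[OF g] continuous_intros) auto
    then show "(\<lambda>x. \<psi> x * g (cos (x $ i - m))) \<in> borel_measurable torus"
      using a unfolding annihilates_def by (auto intro!: borel_measurable_times)
    show "AE x in torus. (\<lambda>n. \<psi> x * p n (cos (x $ i - m))) \<longlonglongrightarrow> \<psi> x * g (cos (x $ i - m))"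
    proof (rule AE_I2, rule tendsto_mult_left)
      fix x
      have "(\<lambda>n. p n (cos (x $ i - m)) - g (cos (x $ i - m))) \<longlonglongrightarrow> 0"
      proof (rule tendsto_rabs_zero_cancel, rule tendsto_sandwich[OF _ _ tendsto_const LIMSEQ_inverse_real_of_nat])
        show "\<forall>\<^sub>F n in sequentially. \<bar>p n (cos (x $ i - m)) - g (cos (x $ i - m))\<bar> \<le> inverse (real (Suc n))"
        proof (rule always_eventually, rule allI)
          fix n
          show "\<bar>p n (cos (x $ i - m)) - g (cos (x $ i - m))\<bar> \<le> inverse (real (Suc n))"
            using p(2)[OF cs, of "x $ i - m" n] unfolding inverse_eq_divide by linarith
        qed
      qed auto
      then show "(\<lambda>n. p n (cos (x $ i - m))) \<longlonglongrightarrow> g (cos (x $ i - m))"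
        by (rule LIM_zero_cancel)
    qed
  qed
qed

text \<open>The indicator of an arc is a bounded limit of continuous functions of the one variable
  \<open>cos (x\<^sub>i - m)\<close>.\<close>
lemma annihilates_mult_arc:
  assumes a: "annihilates f \<psi>"
  shows "annihilates f (\<lambda>x. \<psi> x * indicator {c<..} (cos (x $ i - m)))"
proof -
  define g where "g n y = min 1 (max 0 (real n * (y - c)))" for n and y :: real
  obtain C where C: "\<And>x. \<bar>\<psi> x\<bar> \<le> C" using a annihilates_def by blast
  have C0: "C \<ge> 0" using C[of 0] by simp
  have lim: "(\<lambda>n. g n y) \<longlonglongrightarrow> indicator {c<..} y" for y
  proof (cases "c < y")
    case True
    then obtain N :: nat where N: "1 < real N * (y - c)" using ex_less_of_nat_mult[of "y - c" 1] by auto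
    have "g n y = 1" if "n \<ge> N" for n
    proof -
      have "real N * (y - c) \<le> real n * (y - c)" using that True by (intro mult_right_mono) auto
      then show ?thesis using N by (simp add: g_def)
    qed
    then have "\<forall>\<^sub>F n in sequentially. g n y = 1" using eventually_sequentially by blast
    then show ?thesis using True by (simp add: tendsto_eventually)
  next
    case False
    then have "g n y = 0" for n by (simp add: g_def mult_nonneg_nonpos max_absorb1)
    then show ?thesis using False by simp
  qed
  have gb: "\<bar>g n y\<bar> \<le> 1" for n y by (auto simp: g_def)
  show ?thesis
  proof (rule annihilates_limit)
    have "continuous_on UNIV (g n)" for n
      unfolding g_def by (intro continuous_intros)
    then show "annihilates f (\<lambda>x. \<psi> x * g n (cos (x $ i - m)))" for n
      using annihilates_mult_continuous[OF a, of "g n" i m] by simp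
    show "\<bar>\<psi> x * g n (cos (x $ i - m))\<bar> \<le> C * 1" for n x
      unfolding abs_mult by (intro mult_mono C gb C0) auto
    show "\<bar>\<psi> x * indicator {c<..} (cos (x $ i - m))\<bar> \<le> C * 1" for x
      unfolding abs_mult by (intro mult_mono C C0) (auto simp: indicator_def)
    show "(\<lambda>x. \<psi> x * indicator {c<..} (cos (x $ i - m))) \<in> borel_measurable torus"
      using a coord_compose_measurable[of "\<lambda>t. indicator {c<..} (cos (t - m))" i] unfolding annihilates_def by (auto intro!: borel_measurable_times)
    show "AE x in torus. (\<lambda>n. \<psi> x * g n (cos (x $ i - m))) \<longlonglongrightarrow> \<psi> x * indicator {c<..} (cos (x $ i - m))"
      by (rule AE_I2, rule tendsto_mult_left, rule lim)
  qed
qed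

end

text \<open>An arc of half length \<open>h\<close> is where the cosine of the distance \<open>t\<close> to its centre exceeds \<open>cos h\<close>. The
  bound on \<open>t\<close> keeps the point away from the neighbouring periodic copies of the arc.\<close>
lemma cos_gt_arc:
  assumes "0 < h" "h \<le> pi" "\<bar>t\<bar> \<le> 2 * pi - h"
  shows "cos h < cos t \<longleftrightarrow> \<bar>t\<bar> < h"
proof (cases "\<bar>t\<bar> \<le> pi")
  case True
  then have "cos h < cos \<bar>t\<bar> \<longleftrightarrow> \<bar>t\<bar> < h" using assms by (intro cos_mono_less_eq) auto
  then show ?thesis by simp
next
  case False
  have "cos (2 * pi - \<bar>t\<bar>) = cos t" by (simp add: cos_diff)
  moreover have "cos (2 * pi - \<bar>t\<bar>) \<le> cos h" using assms False by (intro cos_monotone_0_pi_le) auto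
  ultimately show ?thesis using False assms by auto
qed

lemma AE_torus_coord_neq: "AE x in torus. x $ i \<noteq> (c::real)"
proof -
  have "negligible {x :: real^'a. x $ i = c}"
    using negligible_standard_hyperplane[of "axis i 1 :: real^'a" c]
    by (simp add: axis_in_Basis_iff inner_axis)
  then have "{x :: real^'a. x $ i = c} \<in> null_sets lebesgue"
    by (simp add: negligible_iff_null_sets)
  moreover have "closed {x :: real^'a. x $ i = c}"
    by (intro closed_Collect_eq continuous_intros)
  ultimately have "{x :: real^'a. x $ i = c} \<in> null_sets lborel"
    by (simp add: null_sets_def borel_closed emeasure_completion)
  then have "AE x in lborel. x \<notin> {x :: real^'a. x $ i = c}" by (rule AE_not_in)
  then show ?thesis unfolding AE_torus_iff by auto
qed

context
  fixes f :: "real ^ 'd::finite \<Rightarrow> real"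
  assumes f: "integrable torus f"
begin

text \<open>Inside the period cube a slab is an arc in the variable \<open>x\<^sub>i\<close>, up to the two faces, which are null sets.\<close>
lemma annihilates_mult_slab:
  assumes a: "annihilates f \<psi>"
  shows "annihilates f (\<lambda>x. \<psi> x * indicator {l<..<r} (x $ i))"
proof -
  obtain C where C: "\<And>x. \<bar>\<psi> x\<bar> \<le> C" using a annihilates_def by blast
  have C0: "C \<ge> 0" using C[of 0] by simp
  have bd: "\<bar>\<psi> x * indicator {l<..<r} (x $ i)\<bar> \<le> C * 1" for x
    unfolding abs_mult by (intro mult_mono C C0) (auto simp: indicator_def)
  have ms: "(\<lambda>x. \<psi> x * indicator {l<..<r} (x $ i)) \<in> borel_measurable torus"
    using a coord_compose_measurable[of "indicator {l<..<r}" i] unfolding annihilates_def by (auto intro!: borel_measurable_times)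
  define l' r' where "l' = max l 0" and "r' = min r (2 * pi)"
  have sp: "AE x in torus. x \<in> space torus \<and> x $ i \<noteq> 0 \<and> x $ i \<noteq> 2 * pi"
    using AE_space AE_torus_coord_neq[of i 0] AE_torus_coord_neq[of i "2 * pi"] by eventually_elim auto
  show ?thesis
  proof (cases "l' < r'")
    case True
    \<comment> \<open>Centre and half length of the part of the slab inside the period cube.\<close>
    define m h where "m = (l' + r') / 2" and "h = (r' - l') / 2"
    have "annihilates f (\<lambda>x. \<psi> x * indicator {cos h<..} (cos (x $ i - m)))"
      by (rule annihilates_mult_arc[OF f a])
    then show ?thesis
    proof (rule annihilates_AE_cong[OF f _ _ ms bd])
      show "AE x in torus. \<psi> x * indicator {cos h<..} (cos (x $ i - m)) = \<psi> x * indicator {l<..<r} (x $ i)"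
        using sp
      proof eventually_elim
        case (elim x)
        then have x: "0 < x $ i" "x $ i < 2 * pi" by (auto simp: space_torus mem_box_cart less_le)
        have b: "0 \<le> l'" "r' \<le> 2 * pi" by (auto simp: l'_def r'_def)
        have "cos h < cos (x $ i - m) \<longleftrightarrow> \<bar>x $ i - m\<bar> < h"
          by (rule cos_gt_arc) (use True x b in \<open>auto simp: m_def h_def abs_le_iff field_simps\<close>)
        also have "\<dots> \<longleftrightarrow> l' < x $ i \<and> x $ i < r'" by (auto simp: m_def h_def abs_less_iff field_simps)
        also have "\<dots> \<longleftrightarrow> l < x $ i \<and> x $ i < r" using x by (auto simp: l'_def r'_def)
        finally show ?case by (simp add: indicator_def)
      qed
    qed
  next
    case False
    show ?thesis
    proof (rule annihilates_AE_cong[OF f _ _ ms bd])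
      show "annihilates f (\<lambda>x. 0 * \<psi> x + 0 * \<psi> x)" by (rule annihilates_lin[OF f a a])
      show "AE x in torus. 0 * \<psi> x + 0 * \<psi> x = \<psi> x * indicator {l<..<r} (x $ i)"
        using sp
      proof eventually_elim
        case (elim x)
        then have "0 < x $ i" "x $ i < 2 * pi" by (auto simp: space_torus mem_box_cart less_le)
        then have "\<not> (l < x $ i \<and> x $ i < r)" using False by (auto simp: l'_def r'_def)
        then show ?case by (auto simp: indicator_def)
      qed
    qed
  qed
qed

text \<open>The indicator of a box is a product of indicators of slabs, so \<open>f\<close> integrates to zero over all boxes.
  These generate the Borel sets and are stable under intersection, hence \<open>f\<close> integrates to zero over
  every Borel set.\<close>
lemma coefficients_zero_imp_zero:
  assumes z: "\<And>k. hcoeff f k = 0"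
  shows "AE x in torus. f x = 0"
proof -
  have fh: "integrable torus (\<lambda>x. f x * hartley k x)" for k by (rule integrable_mult_hartley[OF f])
  have base: "annihilates f (\<lambda>_. 1)"
    unfolding annihilates_def
  proof (intro conjI allI)
    fix k :: "int^'d" and b :: real
    obtain p q where e: "\<And>x. cos (phase k x + b) = p * hartley k x + q * hartley (- k) x"
      using osc_hartley by blast
    have "(\<integral>x. f x * 1 * cos (phase k x + b) \<partial>torus) = (\<integral>x. p * (f x * hartley k x) + q * (f x * hartley (- k) x) \<partial>torus)"
      unfolding e by (simp add: algebra_simps)
    also have "\<dots> = p * hcoeff f k + q * hcoeff f (- k)"
      using fh[of k] fh[of "- k"] by (simp add: hcoeff_def)
    finally show "(\<integral>x. f x * 1 * cos (phase k x + b) \<partial>torus) = 0" using z by simp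
  qed (auto intro!: exI[of _ 1])
  have prod: "annihilates f (\<lambda>x. \<Prod>i\<in>S. indicator {a $ i<..<b $ i} (x $ i))" if "finite S" for S and a b :: "real^'d"
    using that
  proof (induction S)
    case (insert i S)
    then show ?case using annihilates_mult_slab[OF insert.IH, of "a $ i" "b $ i" i] by (simp add: mult.commute)
  qed (use base in simp)
  let ?C = "cbox 0 (\<chi> i. 2 * pi) :: (real^'d) set"
  \<comment> \<open>The extension of \<open>f\<close> by zero, so that the argument runs over all Borel sets of the whole space.\<close>
  define F where "F x = indicator ?C x *\<^sub>R f x" for x
  have F: "integrable lborel F"
    using f unfolding torus_def F_def[abs_def] by (subst (asm) integrable_restrict_space) auto
  have set: "set_lebesgue_integral lborel A F = (\<integral>x. f x * indicator A x \<partial>torus)" for A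
    unfolding torus_def set_lebesgue_integral_def F_def
    by (subst integral_restrict_space) (auto simp: mult_ac)
  have bx: "set_lebesgue_integral lborel (box a b) F = 0" for a b
  proof -
    have "indicator (box a b) x = (\<Prod>i\<in>UNIV. indicator {a $ i<..<b $ i} (x $ i) :: real)" for x
      by (auto simp: mem_box_cart indicator_def)
    then show ?thesis
      using prod[of UNIV a b] unfolding annihilates_def set by (auto dest!: spec[of _ 0])
  qed
  have all: "set_lebesgue_integral lborel UNIV F = 0"
    using base unfolding annihilates_def set by (auto dest!: spec[of _ 0])
  have "set_lebesgue_integral lborel A F = 0" if "A \<in> sets borel" for A
  proof -
    let ?E = "range (\<lambda>(a, b). box a b :: (real^'d) set)"
    have sE: "sigma_sets UNIV ?E = sets borel" by (subst borel_eq_box) simp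
    have st: "Int_stable ?E" by (auto simp: Int_stable_def box_Int_box)
    have sub: "?E \<subseteq> Pow UNIV" by simp
    have intF: "set_integrable lborel A F" if "A \<in> sets borel" for A
      using F that unfolding set_integrable_def by (intro integrable_mult_indicator) auto
    from that have "A \<in> sigma_sets UNIV ?E" unfolding sE .
    then show ?thesis
    proof (induction rule: sigma_sets_induct_disjoint[OF st sub, consumes 1])
      case (1 A) then show ?case using bx by auto
    next
      case 2 then show ?case by (simp add: set_lebesgue_integral_def)
    next
      case (3 A)
      then have A: "A \<in> sets borel" using sE by simp
      have "set_lebesgue_integral lborel (A \<union> (UNIV - A)) F
          = set_lebesgue_integral lborel A F + set_lebesgue_integral lborel (UNIV - A) F"
        using A by (intro set_integral_Un intF) auto
      then show ?case using all 3 by (simp add: Un_commute)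
    next
      case (4 A)
      then have A: "A i \<in> sets borel" for i using sE by auto
      have "set_lebesgue_integral lborel (\<Union>i. A i) F = (\<Sum>i. set_lebesgue_integral lborel (A i) F)"
        using A 4(1) by (intro lebesgue_integral_countable_add intF) (auto simp: disjoint_family_on_def)
      then show ?case using 4 by simp
    qed
  qed
  then have "AE x in lborel. F x = 0" by (intro sigma_finite_measure.density_zero[OF sigma_finite_lborel F]) simp
  then show ?thesis unfolding AE_torus_iff F_def by eventually_elim auto
qed

end

section \<open>Parseval's identity\<close>

definition sq_integrable :: "'a measure \<Rightarrow> ('a \<Rightarrow> real) \<Rightarrow> bool" where
  "sq_integrable M f \<longleftrightarrow> f \<in> borel_measurable M \<and> integrable M (\<lambda>x. (f x)\<^sup>2)"

lemma sq_integrable_iff_nn: "sq_integrable M f \<longleftrightarrow> f \<in> borel_measurable M \<and> (\<integral>\<^sup>+x. ennreal ((f x)\<^sup>2) \<partial>M) < \<infinity>"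
proof (cases "f \<in> borel_measurable M")
  case True
  then have "(\<lambda>x. (f x)\<^sup>2) \<in> borel_measurable M" by measurable
  then show ?thesis by (simp add: sq_integrable_def integrable_iff_bounded True)
qed (simp add: sq_integrable_def)

lemma sq_integrable_nn: "sq_integrable M f \<Longrightarrow> (\<integral>\<^sup>+x. ennreal ((f x)\<^sup>2) \<partial>M) = ennreal (\<integral>x. (f x)\<^sup>2 \<partial>M)"
  unfolding sq_integrable_def by (intro nn_integral_eq_integral) auto

lemma sq_integrable_mult_integrable:
  assumes "sq_integrable M f" "sq_integrable M g" shows "integrable M (\<lambda>x. f x * g x)"
proof (rule Bochner_Integration.integrable_bound)
  show "integrable M (\<lambda>x. (f x)\<^sup>2 + (g x)\<^sup>2)" using assms by (simp add: sq_integrable_def)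
  show "(\<lambda>x. f x * g x) \<in> borel_measurable M" using assms by (auto simp: sq_integrable_def)
  have "\<bar>a * b\<bar> \<le> a\<^sup>2 + b\<^sup>2" for a b :: real
    using sum_squares_bound[of a b] sum_squares_bound[of "- a" b] by (simp add: abs_le_iff)
  then show "AE x in M. norm (f x * g x) \<le> norm ((f x)\<^sup>2 + (g x)\<^sup>2)"
    by (intro AE_I2) simp
qed

lemma sq_integrable_lin:
  assumes "sq_integrable M f" "sq_integrable M g" shows "sq_integrable M (\<lambda>x. a * f x + b * g x)"
proof -
  have "integrable M (\<lambda>x. a\<^sup>2 * (f x)\<^sup>2 + b\<^sup>2 * (g x)\<^sup>2 + 2 * a * b * (f x * g x))"
    using assms sq_integrable_mult_integrable[OF assms] by (auto simp: sq_integrable_def)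
  moreover have "(\<lambda>x. (a * f x + b * g x)\<^sup>2) = (\<lambda>x. a\<^sup>2 * (f x)\<^sup>2 + b\<^sup>2 * (g x)\<^sup>2 + 2 * a * b * (f x * g x))"
    by (auto simp: power2_eq_square algebra_simps)
  ultimately show ?thesis using assms by (auto simp: sq_integrable_def)
qed

lemma sq_integrable_add: "sq_integrable M f \<Longrightarrow> sq_integrable M g \<Longrightarrow> sq_integrable M (\<lambda>x. f x + g x)"
  using sq_integrable_lin[of M f g 1 1] by simp
lemma sq_integrable_diff: "sq_integrable M f \<Longrightarrow> sq_integrable M g \<Longrightarrow> sq_integrable M (\<lambda>x. f x - g x)"
  using sq_integrable_lin[of M f g 1 "-1"] by simp
lemma sq_integrable_scale: "sq_integrable M f \<Longrightarrow> sq_integrable M (\<lambda>x. a * f x)"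
  using sq_integrable_lin[of M f f a 0] by simp
lemma sq_integrable_zero: "sq_integrable M (\<lambda>x. 0)"
  by (simp add: sq_integrable_def)
lemma sq_integrable_sum: "(\<And>i. i \<in> I \<Longrightarrow> sq_integrable M (f i)) \<Longrightarrow> sq_integrable M (\<lambda>x. \<Sum>i\<in>I. f i x)"
  by (induction I rule: infinite_finite_induct) (simp_all add: sq_integrable_zero sq_integrable_add)

lemma sq_integrable_bounded_mult:
  assumes "sq_integrable M f" "g \<in> borel_measurable M" "AE x in M. \<bar>g x\<bar> \<le> C"
  shows "sq_integrable M (\<lambda>x. g x * f x)"
  unfolding sq_integrable_def
proof
  show "(\<lambda>x. g x * f x) \<in> borel_measurable M" using assms by (auto simp: sq_integrable_def)
  show "integrable M (\<lambda>x. (g x * f x)\<^sup>2)"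
  proof (rule Bochner_Integration.integrable_bound)
    show "integrable M (\<lambda>x. C\<^sup>2 * (f x)\<^sup>2)" using assms by (simp add: sq_integrable_def)
    show "(\<lambda>x. (g x * f x)\<^sup>2) \<in> borel_measurable M" using assms by (auto simp: sq_integrable_def)
    show "AE x in M. norm ((g x * f x)\<^sup>2) \<le> norm (C\<^sup>2 * (f x)\<^sup>2)"
      using assms(3)
    proof eventually_elim
      case (elim x)
      then have "(g x)\<^sup>2 \<le> C\<^sup>2" unfolding abs_le_square_iff[symmetric] by linarith
      then show ?case by (simp add: power_mult_distrib mult_right_mono)
    qed
  qed
qed

lemma sq_integrable_Cauchy_Schwarz:
  assumes "sq_integrable M f" "sq_integrable M g"
  shows "(\<integral>x. \<bar>f x * g x\<bar> \<partial>M)\<^sup>2 \<le> (\<integral>x. (f x)\<^sup>2 \<partial>M) * (\<integral>x. (g x)\<^sup>2 \<partial>M)"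
proof -
  have m [measurable]: "f \<in> borel_measurable M" "g \<in> borel_measurable M" using assms by (auto simp: sq_integrable_def)
  have "(\<integral>\<^sup>+x. ennreal \<bar>f x\<bar> * ennreal \<bar>g x\<bar> \<partial>M)\<^sup>2 \<le> (\<integral>\<^sup>+x. ennreal \<bar>f x\<bar> ^ 2 \<partial>M) * (\<integral>\<^sup>+x. ennreal \<bar>g x\<bar> ^ 2 \<partial>M)"
    by (rule Cauchy_Schwarz_nn_integral) auto
  also have "(\<integral>\<^sup>+x. ennreal \<bar>f x\<bar> * ennreal \<bar>g x\<bar> \<partial>M) = ennreal (\<integral>x. \<bar>f x * g x\<bar> \<partial>M)"
    using nn_integral_eq_integral[OF integrable_abs[OF sq_integrable_mult_integrable[OF assms]]]
    by (simp add: abs_mult ennreal_mult)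
  also have "(\<integral>\<^sup>+x. ennreal \<bar>f x\<bar> ^ 2 \<partial>M) = ennreal (\<integral>x. (f x)\<^sup>2 \<partial>M)"
    using sq_integrable_nn[OF assms(1)] by (simp add: ennreal_power)
  also have "(\<integral>\<^sup>+x. ennreal \<bar>g x\<bar> ^ 2 \<partial>M) = ennreal (\<integral>x. (g x)\<^sup>2 \<partial>M)"
    using sq_integrable_nn[OF assms(2)] by (simp add: ennreal_power)
  finally show ?thesis
    by (simp add: ennreal_power ennreal_mult[symmetric])
qed

lemma sq_integrable_square_add:
  assumes u: "sq_integrable M u" and v: "sq_integrable M v"
  shows "(\<integral>x. (u x + v x)\<^sup>2 \<partial>M) = (\<integral>x. (u x)\<^sup>2 \<partial>M) + (\<integral>x. (v x)\<^sup>2 \<partial>M) + 2 * (\<integral>x. u x * v x \<partial>M)"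
proof -
  have "(\<integral>x. (u x + v x)\<^sup>2 \<partial>M) = (\<integral>x. (u x)\<^sup>2 + (v x)\<^sup>2 + 2 * (u x * v x) \<partial>M)"
    by (simp add: power2_eq_square algebra_simps)
  then show ?thesis using u v sq_integrable_mult_integrable[OF u v] by (simp add: sq_integrable_def)
qed

lemma integral_abs_square_le:
  assumes "sq_integrable M f" "sq_integrable M g"
  shows "(\<integral>x. f x * g x \<partial>M)\<^sup>2 \<le> (\<integral>x. (f x)\<^sup>2 \<partial>M) * (\<integral>x. (g x)\<^sup>2 \<partial>M)"
proof -
  have "\<bar>\<integral>x. f x * g x \<partial>M\<bar> \<le> (\<integral>x. \<bar>f x * g x\<bar> \<partial>M)" by (rule integral_abs_bound)
  then have "(\<integral>x. f x * g x \<partial>M)\<^sup>2 \<le> (\<integral>x. \<bar>f x * g x\<bar> \<partial>M)\<^sup>2"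
    by (metis abs_ge_zero power2_abs power_mono)
  with sq_integrable_Cauchy_Schwarz[OF assms] show ?thesis by linarith
qed

lemma sq_integrable_torus_integrable: "sq_integrable torus f \<Longrightarrow> integrable torus f"
  unfolding sq_integrable_def using finite_measure.square_integrable_imp_integrable[OF finite_measure_torus] by blast

lemma sq_integrable_hartley: "sq_integrable torus (hartley k)"
  unfolding sq_integrable_def
  by (intro conjI continuous_measurable_torus continuous_hartley continuous_torus(1) continuous_intros)

lemma hcoeff_lin: "integrable torus f \<Longrightarrow> integrable torus g \<Longrightarrow> hcoeff (\<lambda>x. a * f x + b * g x) k = a * hcoeff f k + b * hcoeff g k"
  using integrable_mult_hartley[of f k] integrable_mult_hartley[of g k]
  by (simp add: hcoeff_def distrib_right mult.assoc)

lemma hcoeff_add: "integrable torus f \<Longrightarrow> integrable torus g \<Longrightarrow> hcoeff (\<lambda>x. f x + g x) k = hcoeff f k + hcoeff g k"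
  using hcoeff_lin[of f g 1 1 k] by simp
lemma hcoeff_diff: "integrable torus f \<Longrightarrow> integrable torus g \<Longrightarrow> hcoeff (\<lambda>x. f x - g x) k = hcoeff f k - hcoeff g k"
  using hcoeff_lin[of f g 1 "-1" k] by simp

lemma hcoeff_cong_AE:
  assumes "AE x in torus. f x = g x" "f \<in> borel_measurable torus" "g \<in> borel_measurable torus"
  shows "hcoeff f k = hcoeff g k"
proof -
  have [measurable]: "hartley k \<in> borel_measurable torus"
    by (rule continuous_measurable_torus[OF continuous_hartley])
  show ?thesis
    unfolding hcoeff_def using assms by (intro integral_cong_AE) auto
qed

definition trig :: "(int ^ 'd::finite \<Rightarrow> real) \<Rightarrow> (int ^ 'd) set \<Rightarrow> real ^ 'd \<Rightarrow> real" where
  "trig c A x = (\<Sum>k\<in>A. c k * hartley k x)"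

lemma sq_integrable_trig: "sq_integrable torus (trig c A)"
  unfolding trig_def[abs_def] by (intro sq_integrable_sum sq_integrable_scale sq_integrable_hartley)

lemma inner_trig:
  assumes "sq_integrable torus f" "finite A"
  shows "(\<integral>x. f x * trig c A x \<partial>torus) = (\<Sum>k\<in>A. c k * hcoeff f k)"
proof -
  have "(\<integral>x. f x * trig c A x \<partial>torus) = (\<integral>x. (\<Sum>k\<in>A. c k * (f x * hartley k x)) \<partial>torus)"
    by (simp add: trig_def sum_distrib_left mult_ac)
  also have "\<dots> = (\<Sum>k\<in>A. c k * hcoeff f k)"
    using integrable_mult_hartley[OF sq_integrable_torus_integrable[OF assms(1)]] by (subst Bochner_Integration.integral_sum) (auto simp: hcoeff_def)
  finally show ?thesis .
qed

lemma hcoeff_hartley: "hcoeff (hartley k) l = (if k = l then 1 else 0)"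
  by (simp add: hcoeff_def hartley_orthonormal)

lemma hcoeff_trig:
  assumes "finite A" shows "hcoeff (trig c A) l = (if l \<in> A then c l else 0)"
proof -
  have "hcoeff (trig c A) l = (\<integral>x. hartley l x * trig c A x \<partial>torus)" by (simp add: hcoeff_def mult.commute)
  also have "\<dots> = (\<Sum>k\<in>A. c k * (if l = k then 1 else 0))"
    unfolding inner_trig[OF sq_integrable_hartley assms] hcoeff_hartley ..
  also have "\<dots> = (if l \<in> A then c l else 0)" using assms by (simp add: if_distrib cong: if_cong)
  finally show ?thesis .
qed

lemma norm_trig:
  assumes "finite A" shows "(\<integral>x. (trig c A x)\<^sup>2 \<partial>torus) = (\<Sum>k\<in>A. (c k)\<^sup>2)"
  using inner_trig[OF sq_integrable_trig[of c A] assms, of c] hcoeff_trig[OF assms, of c]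
  by (simp add: power2_eq_square)

text \<open>The distance from \<open>f\<close> to its partial sum has a nonnegative square.\<close>
lemma Bessel_finite:
  assumes f: "sq_integrable torus f" and A: "finite A"
  shows "(\<Sum>k\<in>A. (hcoeff f k)\<^sup>2) \<le> (\<integral>x. (f x)\<^sup>2 \<partial>torus)"
proof -
  let ?S = "trig (hcoeff f) A"
  have "0 \<le> (\<integral>x. (f x - ?S x)\<^sup>2 \<partial>torus)" by simp
  also have "\<dots> = (\<integral>x. (f x)\<^sup>2 + (?S x)\<^sup>2 - 2 * (f x * ?S x) \<partial>torus)"
    by (simp add: power2_eq_square algebra_simps)
  also have "\<dots> = (\<integral>x. (f x)\<^sup>2 \<partial>torus) + (\<integral>x. (?S x)\<^sup>2 \<partial>torus) - 2 * (\<integral>x. f x * ?S x \<partial>torus)"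
    using f sq_integrable_trig[of "hcoeff f" A] sq_integrable_mult_integrable[OF f sq_integrable_trig[of "hcoeff f" A]] by (simp add: sq_integrable_def)
  also have "\<dots> = (\<integral>x. (f x)\<^sup>2 \<partial>torus) - (\<Sum>k\<in>A. (hcoeff f k)\<^sup>2)"
    unfolding norm_trig[OF A] inner_trig[OF f A] by (simp add: power2_eq_square)
  finally show ?thesis by simp
qed

text \<open>An exhaustion of the lattice by finite sets, taken from an enumeration.\<close>
definition freqs :: "nat \<Rightarrow> (int ^ 'd::finite) set" where
  "freqs n = {k. to_nat k < n}"

lemma finite_freqs: "finite (freqs n)"
  unfolding freqs_def by (rule finite_subset[of _ "from_nat ` {..<n}"]) (auto, metis from_nat_to_nat imageI lessThan_iff)

lemma nn_integral_freqs:
  fixes f :: "int ^ 'd::finite \<Rightarrow> ennreal"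
  shows "(\<integral>\<^sup>+k. f k \<partial>count_space UNIV) = (SUP n. \<Sum>k\<in>freqs n. f k)"
proof -
  have i: "incseq (\<lambda>n k. f k * indicator (freqs n) k)"
    by (auto simp: incseq_def le_fun_def freqs_def indicator_def)
  have "(SUP n. f k * indicator (freqs n) k) = f k" for k
  proof (rule antisym)
    show "(SUP n. f k * indicator (freqs n) k) \<le> f k" by (rule SUP_least) (auto simp: indicator_def)
    have "f k = f k * indicator (freqs (Suc (to_nat k))) k" by (simp add: freqs_def)
    also have "\<dots> \<le> (SUP n. f k * indicator (freqs n) k)" by (rule SUP_upper) simp
    finally show "f k \<le> (SUP n. f k * indicator (freqs n) k)" .
  qed
  then have "(\<integral>\<^sup>+k. f k \<partial>count_space UNIV) = (\<integral>\<^sup>+k. (SUP n. f k * indicator (freqs n) k) \<partial>count_space UNIV)"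
    by simp
  also have "\<dots> = (SUP n. \<integral>\<^sup>+k. f k * indicator (freqs n) k \<partial>count_space UNIV)"
    by (rule nn_integral_monotone_convergence_SUP[OF i]) simp
  also have "\<dots> = (SUP n. \<Sum>k\<in>freqs n. f k)"
  proof (rule SUP_cong[OF refl])
    fix n
    have "(\<integral>\<^sup>+k. f k * indicator (freqs n) k \<partial>count_space UNIV) = (\<Sum>k\<in>freqs n. f k * indicator (freqs n) k)"
      by (rule nn_integral_count_space'[OF finite_freqs]) auto
    then show "(\<integral>\<^sup>+k. f k * indicator (freqs n) k \<partial>count_space UNIV) = (\<Sum>k\<in>freqs n. f k)"
      by simp
  qed
  finally show ?thesis .
qed

lemma Bessel:
  assumes f: "sq_integrable torus f"
  shows "(\<integral>\<^sup>+k. ennreal ((hcoeff f k)\<^sup>2) \<partial>count_space UNIV) \<le> ennreal (\<integral>x. (f x)\<^sup>2 \<partial>torus)"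
  unfolding nn_integral_freqs
  by (rule SUP_least) (simp add: sum_ennreal ennreal_leI Bessel_finite[OF f finite_freqs])

text \<open>Along a subsequence whose tails decay geometrically, the blocks of the trigonometric series are
  summable in \<open>L\<^sup>1\<close>, so they have an integrable sum. It is defined pointwise as a series of periodic
  functions and is therefore periodic everywhere. The bound of its \<open>L\<^sup>2\<close> norm is Fatou's lemma.\<close>
lemma Riesz_Fischer:
  fixes c :: "int ^ 'd::finite \<Rightarrow> real"
  assumes fin: "(\<integral>\<^sup>+k. ennreal ((c k)\<^sup>2) \<partial>count_space UNIV) < \<infinity>"
  shows "\<exists>g. periodic g \<and> integrable torus g \<and> (\<forall>k. hcoeff g k = c k) \<and>
     (\<integral>\<^sup>+x. ennreal ((g x)\<^sup>2) \<partial>torus) \<le> (\<integral>\<^sup>+k. ennreal ((c k)\<^sup>2) \<partial>count_space UNIV)"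
proof -
  define I where "I = (\<integral>\<^sup>+k. ennreal ((c k)\<^sup>2) \<partial>count_space UNIV)"
  define \<sigma> where "\<sigma> n = (\<Sum>k\<in>freqs n. (c k)\<^sup>2)" for n
  define s where "s = enn2real I"
  have Is: "I = ennreal s" using fin unfolding s_def I_def by simp
  have s0: "s \<ge> 0" by (simp add: s_def)
  have I_SUP: "I = (SUP n. ennreal (\<sigma> n))"
    unfolding I_def nn_integral_freqs \<sigma>_def by (simp add: sum_ennreal)
  have sub: "m \<le> n \<Longrightarrow> freqs m \<subseteq> (freqs n :: (int^'d) set)" for m n by (auto simp: freqs_def)
  have mono: "m \<le> n \<Longrightarrow> \<sigma> m \<le> \<sigma> n" for m n
    unfolding \<sigma>_def by (intro sum_mono2 finite_freqs sub) auto
  have \<sigma>s: "\<sigma> n \<le> s" for n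
  proof -
    have "ennreal (\<sigma> n) \<le> ennreal s" unfolding Is[symmetric] I_SUP by (rule SUP_upper) simp
    then show ?thesis using s0 by (simp add: ennreal_le_iff)
  qed
  have "\<exists>m. s - \<sigma> m < e" if "e > 0" for e
  proof (rule ccontr)
    assume "\<not> ?thesis"
    then have le: "\<sigma> m \<le> s - e" for m by (simp add: not_less) (metis add.commute le_diff_eq)
    then have "I \<le> ennreal (s - e)" unfolding I_SUP by (intro SUP_least ennreal_leI)
    then have "s \<le> s - e \<or> s = 0" unfolding Is using s0 that by (auto simp: ennreal_le_iff2)
    moreover have "s - e \<ge> 0" using le[of 0] by (simp add: \<sigma>_def freqs_def)
    ultimately show False using that by auto
  qed
  then have "\<exists>m. s - \<sigma> m < (1/4) ^ j" for j :: nat by simp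
  then obtain M where M: "\<And>j::nat. s - \<sigma> (M j) < (1/4) ^ j" by metis
  \<comment> \<open>Beyond \<open>N (j + 1)\<close> the remaining sum of squares is below \<open>(1/4)\<^sup>j\<close>; adding \<open>1\<close> lets \<open>N\<close> exhaust the lattice.\<close>
  define N where "N = rec_nat 0 (\<lambda>j n. n + M j + 1)"
  have N: "N 0 = 0" "N (Suc j) = N j + M j + 1" for j by (simp_all add: N_def)
  have Nj: "j \<le> N j" for j by (induction j) (auto simp: N)
  define D where "D j = (freqs (N (Suc j)) - freqs (N j) :: (int^'d) set)" for j
  have finD: "finite (D j)" for j by (simp add: D_def finite_freqs)
  define b where "b j = trig c (D j)" for j
  have part: "(\<Sum>j<J. b j x) = trig c (freqs (N J)) x" for J x
  proof (induction J)
    case 0 show ?case by (simp add: N freqs_def trig_def)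
  next
    case (Suc J)
    have "freqs (N (Suc J)) = freqs (N J) \<union> D J" using sub[of "N J" "N (Suc J)"] by (auto simp: D_def N)
    then have "trig c (freqs (N (Suc J))) x = trig c (freqs (N J)) x + b J x"
      unfolding trig_def b_def by (subst sum.union_disjoint[symmetric]) (auto simp: finite_freqs D_def)
    then show ?case using Suc by simp
  qed
  have b2: "(\<integral>x. (b j x)\<^sup>2 \<partial>torus) = \<sigma> (N (Suc j)) - \<sigma> (N j)" for j
    unfolding b_def norm_trig[OF finD] unfolding \<sigma>_def D_def
    by (rule sum_diff[OF finite_freqs sub]) (simp add: N)
  have b2': "(\<integral>x. (b (Suc j) x)\<^sup>2 \<partial>torus) \<le> (1/4) ^ j" for j
  proof -
    have "\<sigma> (N (Suc (Suc j))) - \<sigma> (N (Suc j)) \<le> s - \<sigma> (M j)"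
      using \<sigma>s[of "N (Suc (Suc j))"] mono[of "M j" "N (Suc j)"] by (simp add: N)
    then show ?thesis unfolding b2 using M[of j] by linarith
  qed
  have sqb: "sq_integrable torus (b j)" for j unfolding b_def by (rule sq_integrable_trig)
  have ib: "integrable torus (b j)" for j by (rule sq_integrable_torus_integrable[OF sqb])
  define V where "V = sqrt (\<integral>x. (1::real)\<^sup>2 \<partial>(torus :: (real^'d) measure))"
  have sq1: "sq_integrable (torus :: (real^'d) measure) (\<lambda>_. 1)"
    by (auto simp: sq_integrable_def intro!: continuous_torus(1))
  have bV: "(\<integral>x. \<bar>b (Suc j) x\<bar> \<partial>torus) \<le> V * (1/2) ^ j" for j
  proof -
    \<comment> \<open>Cauchy-Schwarz against the constant \<open>1\<close>; \<open>V\<^sup>2\<close> is the volume of the torus.\<close>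
    have "(\<integral>x. \<bar>b (Suc j) x\<bar> \<partial>torus)\<^sup>2 \<le> (\<integral>x. (b (Suc j) x)\<^sup>2 \<partial>torus) * V\<^sup>2"
      using sq_integrable_Cauchy_Schwarz[OF sqb[of "Suc j"] sq1] by (simp add: V_def)
    also have "\<dots> \<le> (1/4) ^ j * V\<^sup>2" by (intro mult_right_mono b2') auto
    also have "\<dots> = (V * (1/2) ^ j)\<^sup>2"
      by (simp add: power_mult_distrib power2_eq_square flip: power_mult_distrib)
    finally show ?thesis by (rule power2_le_imp_le) (simp add: V_def)
  qed
  have sumb: "summable (\<lambda>j. \<integral>x. norm (b j x) \<partial>torus)"
  proof (subst summable_Suc_iff[symmetric], rule summable_comparison_test')
    show "summable (\<lambda>j. V * (1/2::real) ^ j)" by (intro summable_mult summable_geometric) simp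
    show "norm (\<integral>x. norm (b (Suc j) x) \<partial>torus) \<le> V * (1/2) ^ j" for j using bV[of j] by simp
  qed
  have AEb: "AE x in torus. summable (\<lambda>j. norm (b j x))"
  proof -
    have m [measurable]: "b j \<in> borel_measurable torus" for j using ib by auto
    have "(\<integral>\<^sup>+x. (\<Sum>j. ennreal (norm (b j x))) \<partial>torus) = (\<Sum>j. \<integral>\<^sup>+x. ennreal (norm (b j x)) \<partial>torus)"
      by (rule nn_integral_suminf) auto
    also have "\<dots> = (\<Sum>j. ennreal (\<integral>x. norm (b j x) \<partial>torus))"
      using ib by (intro arg_cong[where f = suminf] ext nn_integral_eq_integral) auto
    also have "\<dots> = ennreal (\<Sum>j. \<integral>x. norm (b j x) \<partial>torus)"
      by (rule suminf_ennreal2[OF _ sumb]) simp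
    finally have "(\<integral>\<^sup>+x. (\<Sum>j. ennreal (norm (b j x))) \<partial>torus) \<noteq> \<infinity>" by simp
    then have "AE x in torus. (\<Sum>j. ennreal (norm (b j x))) \<noteq> \<infinity>"
      by (intro nn_integral_PInf_AE) auto
    then show ?thesis
      by eventually_elim (auto intro: summable_suminf_not_top)
  qed
  define g where "g x = (\<Sum>j. b j x)" for x
  have per: "periodic g"
    unfolding periodic_def
  proof (intro allI)
    fix x :: "real ^ 'd" and i
    have "hartley k (x + axis i (2 * pi)) = hartley k x" for k
      using hartley_test[of k] unfolding test_functions_def periodic_def by blast
    then show "g (x + axis i (2 * pi)) = g x" by (simp add: g_def b_def trig_def)
  qed
  have ig: "integrable torus g" unfolding g_def[abs_def] by (rule integrable_suminf[OF ib AEb sumb])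
  have hcg: "hcoeff g k = c k" for k
  proof -
    have AEbk: "AE x in torus. summable (\<lambda>j. norm (b j x * hartley k x))"
      using AEb by eventually_elim (simp add: abs_mult summable_mult2)
    have bd: "(\<integral>x. norm (b j x * hartley k x) \<partial>torus) \<le> (2 / sqrt ((2 * pi) ^ CARD('d))) * (\<integral>x. norm (b j x) \<partial>torus)" for j
    proof -
      have "(\<integral>x. norm (b j x * hartley k x) \<partial>torus) \<le> (\<integral>x. (2 / sqrt ((2 * pi) ^ CARD('d))) * norm (b j x) \<partial>torus)"
      proof (rule integral_mono)
        show "integrable torus (\<lambda>x. norm (b j x * hartley k x))" using integrable_mult_hartley[OF ib] by auto
        show "integrable torus (\<lambda>x. (2 / sqrt ((2 * pi) ^ CARD('d))) * norm (b j x))" using ib by auto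
        show "norm (b j x * hartley k x) \<le> (2 / sqrt ((2 * pi) ^ CARD('d))) * norm (b j x)" for x
          using mult_right_mono[OF hartley_bounded[of k x], of "\<bar>b j x\<bar>"] by (simp add: abs_mult mult.commute)
      qed
      then show ?thesis by simp
    qed
    have sumbk: "summable (\<lambda>j. \<integral>x. norm (b j x * hartley k x) \<partial>torus)"
    proof (rule summable_comparison_test')
      show "summable (\<lambda>j. (2 / sqrt ((2 * pi) ^ CARD('d))) * (\<integral>x. norm (b j x) \<partial>torus))"
        by (rule summable_mult[OF sumb])
      show "norm (\<integral>x. norm (b j x * hartley k x) \<partial>torus) \<le> (2 / sqrt ((2 * pi) ^ CARD('d))) * (\<integral>x. norm (b j x) \<partial>torus)" for j
        using bd[of j] by simp
    qed
    have "(\<lambda>j. hcoeff (b j) k) sums (\<integral>x. (\<Sum>j. b j x * hartley k x) \<partial>torus)"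
      unfolding hcoeff_def by (rule sums_integral[OF integrable_mult_hartley[OF ib] AEbk sumbk])
    also have "(\<integral>x. (\<Sum>j. b j x * hartley k x) \<partial>torus) = hcoeff g k"
      unfolding hcoeff_def
    proof (rule integral_cong_AE)
      show "(\<lambda>x. \<Sum>j. b j x * hartley k x) \<in> borel_measurable torus"
        using integrable_suminf[OF integrable_mult_hartley[OF ib] AEbk sumbk] by auto
      show "(\<lambda>x. g x * hartley k x) \<in> borel_measurable torus" using integrable_mult_hartley[OF ig] by auto
      show "AE x in torus. (\<Sum>j. b j x * hartley k x) = g x * hartley k x"
        using AEb
      proof eventually_elim
        case (elim x)
        show ?case unfolding g_def by (rule suminf_mult2[OF summable_norm_cancel[OF elim], symmetric])
      qed
    qed
    finally have "(\<lambda>J. \<Sum>j<J. hcoeff (b j) k) \<longlonglongrightarrow> hcoeff g k" by (simp add: sums_def)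
    moreover
    have "\<forall>\<^sub>F J in sequentially. (\<Sum>j<J. hcoeff (b j) k) = c k"
      unfolding eventually_sequentially
    proof (intro exI allI impI)
      fix J assume J: "Suc (to_nat k) \<le> J"
      have "(\<Sum>j<J. hcoeff (b j) k) = (\<integral>x. (\<Sum>j<J. b j x * hartley k x) \<partial>torus)"
        unfolding hcoeff_def using integrable_mult_hartley[OF ib] by (subst Bochner_Integration.integral_sum) auto
      also have "\<dots> = hcoeff (trig c (freqs (N J))) k"
        unfolding hcoeff_def part[symmetric] by (simp add: sum_distrib_right)
      also have "\<dots> = c k" unfolding hcoeff_trig[OF finite_freqs] using J Nj[of J] by (simp add: freqs_def)
      finally show "(\<Sum>j<J. hcoeff (b j) k) = c k" .
    qed
    then have "(\<lambda>J. \<Sum>j<J. hcoeff (b j) k) \<longlonglongrightarrow> c k" by (rule tendsto_eventually)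
    ultimately show ?thesis by (rule LIMSEQ_unique)
  qed
  have "(\<integral>\<^sup>+x. ennreal ((g x)\<^sup>2) \<partial>torus) \<le> I"
  proof -
    let ?S = "\<lambda>J. trig c (freqs (N J))"
    have [measurable]: "?S J \<in> borel_measurable torus" for J using sq_integrable_trig[of c "freqs (N J)"] by (simp add: sq_integrable_def)
    have "(\<integral>\<^sup>+x. ennreal ((g x)\<^sup>2) \<partial>torus) \<le> (\<integral>\<^sup>+x. liminf (\<lambda>J. ennreal ((?S J x)\<^sup>2)) \<partial>torus)"
    proof (rule nn_integral_mono_AE)
      show "AE x in torus. ennreal ((g x)\<^sup>2) \<le> liminf (\<lambda>J. ennreal ((?S J x)\<^sup>2))"
        using AEb
      proof eventually_elim
        case (elim x)
        have "(\<lambda>J. \<Sum>j<J. b j x) \<longlonglongrightarrow> g x"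
          unfolding g_def by (rule summable_LIMSEQ[OF summable_norm_cancel[OF elim]])
        then have "(\<lambda>J. ennreal ((?S J x)\<^sup>2)) \<longlonglongrightarrow> ennreal ((g x)\<^sup>2)"
          unfolding part by (intro tendsto_ennrealI tendsto_power)
        from lim_imp_Liminf[OF sequentially_bot this] show ?case by simp
      qed
    qed
    also have "\<dots> \<le> liminf (\<lambda>J. \<integral>\<^sup>+x. ennreal ((?S J x)\<^sup>2) \<partial>torus)"
      by (rule nn_integral_liminf) measurable
    also have "\<dots> \<le> liminf (\<lambda>J. I)"
    proof (rule Liminf_mono, rule always_eventually, rule allI)
      fix J
      show "(\<integral>\<^sup>+x. ennreal ((?S J x)\<^sup>2) \<partial>torus) \<le> I"
        unfolding sq_integrable_nn[OF sq_integrable_trig] norm_trig[OF finite_freqs] Is using \<sigma>s[of "N J"] by (simp add: \<sigma>_def ennreal_leI)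
    qed
    finally show ?thesis by (simp add: Liminf_const)
  qed
  then show ?thesis using per ig hcg unfolding I_def by blast
qed

text \<open>For integrable \<open>g\<close>, with values in \<open>[0, \<infinity>]\<close>: square summable coefficients force \<open>g\<close> into \<open>L\<^sup>2\<close>. Indeed
  the theorem of Riesz and Fischer provides an \<open>L\<^sup>2\<close> function with the coefficients of \<open>g\<close>, and
  coefficients determine an integrable function.\<close>
lemma Parseval:
  assumes g: "integrable torus g"
  shows "(\<integral>\<^sup>+x. ennreal ((g x)\<^sup>2) \<partial>torus) = (\<integral>\<^sup>+k. ennreal ((hcoeff g k)\<^sup>2) \<partial>count_space UNIV)"
proof (rule antisym)
  show "(\<integral>\<^sup>+k. ennreal ((hcoeff g k)\<^sup>2) \<partial>count_space UNIV) \<le> (\<integral>\<^sup>+x. ennreal ((g x)\<^sup>2) \<partial>torus)"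
  proof (cases "(\<integral>\<^sup>+x. ennreal ((g x)\<^sup>2) \<partial>torus) < \<infinity>")
    case True
    then have "sq_integrable torus g" using g by (auto simp: sq_integrable_iff_nn)
    then show ?thesis using Bessel[of g] sq_integrable_nn[of torus g] by simp
  qed (simp add: not_less top_unique)
  show "(\<integral>\<^sup>+x. ennreal ((g x)\<^sup>2) \<partial>torus) \<le> (\<integral>\<^sup>+k. ennreal ((hcoeff g k)\<^sup>2) \<partial>count_space UNIV)"
  proof (cases "(\<integral>\<^sup>+k. ennreal ((hcoeff g k)\<^sup>2) \<partial>count_space UNIV) < \<infinity>")
    case True
    from Riesz_Fischer[OF this] obtain h where h: "integrable torus h" "\<And>k. hcoeff h k = hcoeff g k"
      "(\<integral>\<^sup>+x. ennreal ((h x)\<^sup>2) \<partial>torus) \<le> (\<integral>\<^sup>+k. ennreal ((hcoeff g k)\<^sup>2) \<partial>count_space UNIV)" by blast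
    have "AE x in torus. g x - h x = 0"
      by (rule coefficients_zero_imp_zero) (use g h hcoeff_diff[OF g h(1)] in auto)
    then have "AE x in torus. ennreal ((g x)\<^sup>2) = ennreal ((h x)\<^sup>2)" by eventually_elim simp
    then have "(\<integral>\<^sup>+x. ennreal ((g x)\<^sup>2) \<partial>torus) = (\<integral>\<^sup>+x. ennreal ((h x)\<^sup>2) \<partial>torus)"
      by (rule nn_integral_cong_AE)
    then show ?thesis using h(3) by simp
  qed (simp add: not_less top_unique)
qed

abbreviation counting :: "(int ^ 'd::finite) measure" where "counting \<equiv> count_space UNIV"

lemma sq_integrable_hcoeff: "sq_integrable torus f \<Longrightarrow> sq_integrable counting (hcoeff f)"
  using Parseval[OF sq_integrable_torus_integrable, of f] by (auto simp: sq_integrable_iff_nn)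

lemma Parseval_square: "sq_integrable torus f \<Longrightarrow> (\<integral>x. (f x)\<^sup>2 \<partial>torus) = (\<integral>k. (hcoeff f k)\<^sup>2 \<partial>counting)"
  using Parseval[OF sq_integrable_torus_integrable, of f] sq_integrable_nn[of torus f] sq_integrable_nn[OF sq_integrable_hcoeff, of f] by simp

lemma Parseval_inner:
  assumes f: "sq_integrable torus f" and g: "sq_integrable torus g"
  shows "(\<integral>x. f x * g x \<partial>torus) = (\<integral>k. hcoeff f k * hcoeff g k \<partial>counting)"
proof -
  have "hcoeff (\<lambda>x. f x + g x) k = hcoeff f k + hcoeff g k" for k
    by (intro hcoeff_add sq_integrable_torus_integrable f g)
  then show ?thesis
    using Parseval_square[OF sq_integrable_add[OF f g]] sq_integrable_square_add[OF f g] sq_integrable_square_add[OF sq_integrable_hcoeff[OF f] sq_integrable_hcoeff[OF g]]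
      Parseval_square[OF f] Parseval_square[OF g] by simp
qed

section \<open>Sobolev seminorms in terms of coefficients\<close>

lemma test_continuous:
  assumes "\<phi> \<in> test_functions"
  shows "continuous_on A \<phi>" "continuous_on A (pderiv_at i \<phi>)"
proof -
  have "C_times 0 \<phi>" "C_times (Suc 0) \<phi>" using assms unfolding test_functions_def by blast+
  then have "continuous_on UNIV \<phi>" "continuous_on UNIV (pderiv_at i \<phi>)" by auto
  then show "continuous_on A \<phi>" "continuous_on A (pderiv_at i \<phi>)"
    by (auto intro: continuous_on_subset)
qed

lemma pderiv_at_mult:
  assumes "\<And>x. f differentiable (at x)" "\<And>x. g differentiable (at x)"
  shows "pderiv_at i (\<lambda>x. f x * g x) = (\<lambda>x. f x * pderiv_at i g x + pderiv_at i f x * g x)"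
proof
  fix x
  have "((\<lambda>x. f x * g x) has_derivative (\<lambda>h. f x * frechet_derivative g (at x) h + frechet_derivative f (at x) h * g x)) (at x)"
    using assms by (intro has_derivative_mult) (auto simp: frechet_derivative_works[symmetric])
  from frechet_derivative_at[OF this] show "pderiv_at i (\<lambda>x. f x * g x) x = f x * pderiv_at i g x + pderiv_at i f x * g x"
    unfolding pderiv_at_def by metis
qed

lemma test_integration_by_parts:
  assumes f: "f \<in> test_functions" and g: "g \<in> test_functions"
  shows "(\<integral>x. pderiv_at i f x * g x \<partial>torus) = - (\<integral>x. f x * pderiv_at i g x \<partial>torus)"
proof -
  note c = test_continuous[OF f, of UNIV] test_continuous[OF g, of UNIV]
  note d = test_differentiable[OF f] test_differentiable[OF g]
  have "periodic f" "periodic g" using f g by (auto simp: test_functions_def)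
  then have p: "periodic (\<lambda>x. f x * g x)" by (simp add: periodic_def)
  have e: "pderiv_at i (\<lambda>x. f x * g x) = (\<lambda>x. f x * pderiv_at i g x + pderiv_at i f x * g x)"
    by (rule pderiv_at_mult[OF d])
  have "(\<integral>x. f x * pderiv_at i g x + pderiv_at i f x * g x \<partial>torus) = 0"
    unfolding e[symmetric]
  proof (rule integral_pderiv_periodic[OF p])
    show "(\<lambda>x. f x * g x) differentiable at x" for x by (intro differentiable_mult d)
    show "continuous_on UNIV (pderiv_at i (\<lambda>x. f x * g x))"
      unfolding e by (intro continuous_intros c)
  qed
  moreover have "integrable torus (\<lambda>x. f x * pderiv_at i g x)" "integrable torus (\<lambda>x. pderiv_at i f x * g x)"
    by (intro continuous_torus(1) continuous_intros c)+
  ultimately show ?thesis by simp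
qed

lemma sq_integrable_continuous: "continuous_on UNIV f \<Longrightarrow> sq_integrable torus f"
  unfolding sq_integrable_def by (intro conjI continuous_measurable_torus continuous_torus(1) continuous_intros)

lemma integral_mult_mid: "(\<integral>x. f x * (c * h x) \<partial>M) = c * (\<integral>x. f x * h x \<partial>M)" for c :: real
  by (subst mult.left_commute) simp

lemma hcoeff_test_pderiv:
  assumes "\<phi> \<in> test_functions"
  shows "hcoeff (pderiv_at i \<phi>) k = - of_int (k $ i) * hcoeff \<phi> (- k)"
  unfolding hcoeff_def test_integration_by_parts[OF assms hartley_test] pderiv_at_hartley integral_mult_mid by simp

lemma has_weak_pderiv_hcoeff:
  assumes "has_weak_pderiv i f g"
  shows "hcoeff g k = - of_int (k $ i) * hcoeff f (- k)"
proof -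
  have "(\<integral>x. f x * pderiv_at i (hartley k) x \<partial>torus) = - (\<integral>x. g x * hartley k x \<partial>torus)"
    using assms hartley_test unfolding has_weak_pderiv_def by blast
  then show ?thesis unfolding hcoeff_def pderiv_at_hartley integral_mult_mid by simp
qed

lemma integral_counting_uminus: "(\<integral>k. f (- k) \<partial>counting) = (\<integral>k. f k \<partial>counting)" for f :: "int ^ 'd::finite \<Rightarrow> real"
  by (rule integral_bij_count_space) (auto simp: bij_betw_def inj_on_def surj_def intro: exI[of _ "- y" for y])

lemma nn_integral_counting_uminus: "(\<integral>\<^sup>+k. f (- k) \<partial>counting) = (\<integral>\<^sup>+k. f k \<partial>counting)" for f :: "int ^ 'd::finite \<Rightarrow> ennreal"
  by (rule nn_integral_bij_count_space) (auto simp: bij_betw_def inj_on_def surj_def intro: exI[of _ "- y" for y])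

lemma integrable_counting_uminus: "integrable counting (\<lambda>k. f (- k)) \<longleftrightarrow> integrable counting f" for f :: "int ^ 'd::finite \<Rightarrow> real"
  by (rule integrable_bij_count_space) (auto simp: bij_betw_def inj_on_def surj_def intro: exI[of _ "- y" for y])

lemma freq2_nonneg: "freq2 k \<ge> 0"
  by (simp add: freq2_def sum_nonneg)

lemma sqrt_freq2_mult: "(sqrt (freq2 k) * x) * (sqrt (freq2 k) * z) = freq2 k * x * z"
proof -
  have "(sqrt (freq2 k) * x) * (sqrt (freq2 k) * z) = (sqrt (freq2 k))\<^sup>2 * x * z"
    by (simp only: power2_eq_square mult_ac)
  then show ?thesis by (simp only: real_sqrt_pow2[OF freq2_nonneg])
qed

lemma freq2_uminus [simp]: "freq2 (- k) = freq2 k"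
  by (simp add: freq2_def)

text \<open>By Parseval both sides of the defining identity are sums over modes, and they differ by the
  substitution \<open>k \<mapsto> - k\<close>.\<close>
lemma has_weak_pderiv_Fourier:
  assumes f: "sq_integrable torus f" "periodic f"
    and g: "periodic g" "integrable torus g" "sq_integrable torus g" "\<And>k. hcoeff g k = - of_int (k $ i) * hcoeff f (- k)"
  shows "has_weak_pderiv i f g"
  unfolding has_weak_pderiv_def
proof (intro conjI ballI f g sq_integrable_torus_integrable)
  fix \<phi> :: "real ^ 'a \<Rightarrow> real" assume \<phi>: "\<phi> \<in> test_functions"
  have s: "sq_integrable torus \<phi>" "sq_integrable torus (pderiv_at i \<phi>)"
    by (intro sq_integrable_continuous test_continuous[OF \<phi>])+
  have "(\<integral>x. f x * pderiv_at i \<phi> x \<partial>torus) = (\<integral>k. hcoeff f k * hcoeff (pderiv_at i \<phi>) k \<partial>counting)"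
    by (rule Parseval_inner[OF f(1) s(2)])
  also have "\<dots> = (\<integral>k. - of_int (k $ i) * hcoeff f k * hcoeff \<phi> (- k) \<partial>counting)"
    unfolding hcoeff_test_pderiv[OF \<phi>] by (simp add: mult_ac)
  also have "\<dots> = (\<integral>k. - of_int ((- k) $ i) * hcoeff f (- k) * hcoeff \<phi> (- (- k)) \<partial>counting)"
    by (rule integral_counting_uminus[symmetric])
  also have "\<dots> = (\<integral>k. - (hcoeff g k * hcoeff \<phi> k) \<partial>counting)"
    unfolding g(4) by simp
  also have "\<dots> = - (\<integral>x. g x * \<phi> x \<partial>torus)"
    unfolding Parseval_inner[OF g(3) s(1)] by simp
  finally show "(\<integral>x. f x * pderiv_at i \<phi> x \<partial>torus) = - (\<integral>x. g x * \<phi> x \<partial>torus)" .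
qed

lemma weak_pderiv:
  "weakly_differentiable f \<Longrightarrow> has_weak_pderiv i f (weak_pderiv i f)"
  unfolding weakly_differentiable_def weak_pderiv_def by (metis someI_ex)

lemma esqrt_square: "(esqrt a)\<^sup>2 = a"
  by (cases a) (auto simp: esqrt_def ennreal_power top_power_ennreal)

lemma L2_norm_square: "(L2_norm f)\<^sup>2 = (\<integral>\<^sup>+x. ennreal ((f x)\<^sup>2) \<partial>torus)"
  by (simp add: L2_norm_def esqrt_square)

lemma L2_norm_square_hcoeff:
  "integrable torus f \<Longrightarrow> (L2_norm f)\<^sup>2 = (\<integral>\<^sup>+k. ennreal ((hcoeff f k)\<^sup>2) \<partial>counting)"
  by (simp add: L2_norm_square Parseval)

lemma esqrt_less_top: "esqrt a < \<infinity> \<longleftrightarrow> a < \<infinity>"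
  by (simp add: esqrt_def less_top)

lemma L2_space_sq_integrable: "f \<in> L2_space \<Longrightarrow> sq_integrable torus f"
  by (auto simp: L2_space_def L2_norm_def esqrt_less_top[simplified] sq_integrable_iff_nn)

lemma has_weak_pderiv_integrable: "has_weak_pderiv i f g \<Longrightarrow> integrable torus g"
  by (simp add: has_weak_pderiv_def)

text \<open>The identity includes the value \<open>\<infinity>\<close>: if the sum is finite, then the theorem of Riesz and Fischer
  provides functions with the coefficients of the partial derivatives, and these are weak derivatives.
  Along a solution this makes the seminorm a measurable function of time.\<close>
lemma H1_seminorm_hcoeff:
  assumes f: "f \<in> L2_space"
  shows "(H1_seminorm f)\<^sup>2 = (\<integral>\<^sup>+k. ennreal (freq2 k * (hcoeff f k)\<^sup>2) \<partial>counting)"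
proof -
  let ?S = "\<integral>\<^sup>+k. ennreal (freq2 k * (hcoeff f k)\<^sup>2) \<partial>counting"
  let ?I = "\<lambda>i. \<integral>\<^sup>+k. ennreal ((- of_int (k $ i) * hcoeff f (- k))\<^sup>2) \<partial>counting"
  have S: "(\<Sum>i\<in>UNIV. ?I i) = ?S"
  proof -
    have "(\<Sum>i\<in>UNIV. ?I i) = (\<integral>\<^sup>+k. (\<Sum>i\<in>UNIV. ennreal ((- of_int (k $ i) * hcoeff f (- k))\<^sup>2)) \<partial>counting)"
      by (rule nn_integral_sum[symmetric]) simp
    also have "\<dots> = (\<integral>\<^sup>+k. ennreal (freq2 (- k) * (hcoeff f (- k))\<^sup>2) \<partial>counting)"
      by (simp add: sum_ennreal freq2_def sum_distrib_right power_mult_distrib)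
    finally show ?thesis
      using nn_integral_counting_uminus[of "\<lambda>k. ennreal (freq2 k * (hcoeff f k)\<^sup>2)"] by simp
  qed
  show ?thesis
  proof (cases "weakly_differentiable f")
    case True
    have "(H1_seminorm f)\<^sup>2 = (\<Sum>i\<in>UNIV. (L2_norm (weak_pderiv i f))\<^sup>2)"
      using True by (simp add: H1_seminorm_def esqrt_square)
    also have "\<dots> = (\<Sum>i\<in>UNIV. ?I i)"
      unfolding L2_norm_square_hcoeff[OF has_weak_pderiv_integrable[OF weak_pderiv[OF True]]]
        has_weak_pderiv_hcoeff[OF weak_pderiv[OF True]] ..
    finally show ?thesis using S by simp
  next
    case False
    have "?S = \<infinity>"
    proof (rule ccontr)
      assume "?S \<noteq> \<infinity>"
      have "\<exists>g. has_weak_pderiv i f g" for i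
      proof -
        have "?I i \<le> (\<Sum>i\<in>UNIV. ?I i)" by (rule member_le_sum) auto
        then have "?I i < \<infinity>" using \<open>?S \<noteq> \<infinity>\<close> S by (simp add: less_top[symmetric] top_unique neq_top_trans)
        from Riesz_Fischer[OF this] obtain g where g: "periodic g" "integrable torus g"
          "\<And>k. hcoeff g k = - of_int (k $ i) * hcoeff f (- k)" "(\<integral>\<^sup>+x. ennreal ((g x)\<^sup>2) \<partial>torus) \<le> ?I i" by blast
        have "sq_integrable torus g" using g \<open>?I i < \<infinity>\<close> by (auto simp: sq_integrable_iff_nn)
        then show ?thesis
          using has_weak_pderiv_Fourier[OF L2_space_sq_integrable[OF f] _ g(1,2) _ g(3)] f unfolding L2_space_def by blast
      qed
      with False show False by (simp add: weakly_differentiable_def)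
    qed
    then show ?thesis using False by (simp add: H1_seminorm_def)
  qed
qed

text \<open>Differentiating twice multiplies the coefficient by \<open>- k\<^sub>i k\<^sub>j\<close>, and the squares of these factors sum
  to \<open>|k|\<^sup>4\<close>.\<close>
lemma H2_seminorm_hcoeff:
  assumes H: "H2_seminorm f < \<infinity>"
  shows "(H2_seminorm f)\<^sup>2 = (\<integral>\<^sup>+k. ennreal ((freq2 k * hcoeff f k)\<^sup>2) \<partial>counting)"
proof -
  have w: "weakly_differentiable f" "\<And>j. weakly_differentiable (weak_pderiv j f)"
    using H by (auto simp: H2_seminorm_def split: if_splits)
  have "(L2_norm (weak_pderiv i (weak_pderiv j f)))\<^sup>2
      = (\<integral>\<^sup>+k. ennreal ((of_int (k $ i))\<^sup>2 * (of_int (k $ j))\<^sup>2 * (hcoeff f k)\<^sup>2) \<partial>counting)" for i j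
    unfolding L2_norm_square_hcoeff[OF has_weak_pderiv_integrable[OF weak_pderiv[OF w(2)]]]
      has_weak_pderiv_hcoeff[OF weak_pderiv[OF w(2)]] has_weak_pderiv_hcoeff[OF weak_pderiv[OF w(1)]]
    by (simp add: power_mult_distrib mult_ac)
  then have "(H2_seminorm f)\<^sup>2 = (\<Sum>i\<in>UNIV. \<Sum>j\<in>UNIV. (\<integral>\<^sup>+k. ennreal ((of_int (k $ i))\<^sup>2 * (of_int (k $ j))\<^sup>2 * (hcoeff f k)\<^sup>2) \<partial>counting))"
    using w by (simp add: H2_seminorm_def esqrt_square)
  also have "\<dots> = (\<integral>\<^sup>+k. (\<Sum>i\<in>UNIV. \<Sum>j\<in>UNIV. ennreal ((of_int (k $ i))\<^sup>2 * (of_int (k $ j))\<^sup>2 * (hcoeff f k)\<^sup>2)) \<partial>counting)"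
    by (simp add: nn_integral_sum del: sum_ennreal)
  also have "\<dots> = (\<integral>\<^sup>+k. ennreal ((freq2 k * hcoeff f k)\<^sup>2) \<partial>counting)"
  proof (rule nn_integral_cong)
    fix k :: "int ^ 'a"
    have "(\<Sum>i\<in>UNIV. \<Sum>j\<in>UNIV. (of_int (k $ i))\<^sup>2 * (of_int (k $ j))\<^sup>2 * (hcoeff f k)\<^sup>2) = freq2 k * freq2 k * (hcoeff f k)\<^sup>2"
    proof -
      have "freq2 k * freq2 k = (\<Sum>i\<in>UNIV. \<Sum>j\<in>UNIV. (of_int (k $ i))\<^sup>2 * (of_int (k $ j))\<^sup>2)"
        unfolding freq2_def by (rule sum_product)
      then show ?thesis by (simp only: sum_distrib_right)
    qed
    then show "(\<Sum>i\<in>UNIV. \<Sum>j\<in>UNIV. ennreal ((of_int (k $ i))\<^sup>2 * (of_int (k $ j))\<^sup>2 * (hcoeff f k)\<^sup>2)) = ennreal ((freq2 k * hcoeff f k)\<^sup>2)"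
      by (simp add: sum_ennreal sum_nonneg power_mult_distrib power2_eq_square[of "freq2 k"])
  qed
  finally show ?thesis .
qed

section \<open>Transport by a divergence free field\<close>

lemma inner_grad_hartley:
  "v \<bullet> grad (hartley k) x = (\<Sum>i\<in>UNIV. of_int (k $ i) * (v $ i * hartley (- k) x))"
  by (simp add: inner_vec_def grad_def pderiv_at_hartley mult_ac)

lemma hartley_mult_test: "(\<lambda>x. hartley k x * hartley l x) \<in> test_functions"
  unfolding hartley_mult by (intro test_add test_osc)

text \<open>Here \<open>p\<close> stands for the gradient of \<open>w\<close>, described by its coefficients.\<close>
locale transport =
  fixes v :: "real ^ 'd::finite \<Rightarrow> real ^ 'd" and M :: real
    and w :: "real ^ 'd \<Rightarrow> real" and p :: "'d \<Rightarrow> real ^ 'd \<Rightarrow> real"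
  assumes div: "divergence_free v"
    and v_meas: "\<And>i. (\<lambda>x. v x $ i) \<in> borel_measurable torus"
    and v_bound: "\<And>i. AE x in torus. \<bar>v x $ i\<bar> \<le> M"
    and w: "sq_integrable torus w"
    and p: "\<And>i. sq_integrable torus (p i)"
    and p_hcoeff: "\<And>i k. hcoeff (p i) k = - of_int (k $ i) * hcoeff w (- k)"
begin

text \<open>The function \<open>v \<cdot> \<nabla>w\<close>.\<close>
definition advected where "advected x = (\<Sum>i\<in>UNIV. v x $ i * p i x)"

lemma sq_integrable_v: "sq_integrable torus f \<Longrightarrow> sq_integrable torus (\<lambda>x. v x $ i * f x)"
  by (rule sq_integrable_bounded_mult[OF _ v_meas v_bound])

lemma sq_integrable_advected: "sq_integrable torus advected"
  unfolding advected_def by (intro sq_integrable_sum sq_integrable_v p)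

lemma sq_integrable_v_grad: "sq_integrable torus (\<lambda>x. v x \<bullet> grad (hartley k) x)"
  unfolding inner_grad_hartley by (intro sq_integrable_sum sq_integrable_scale sq_integrable_v sq_integrable_hartley)

lemma integral_v_grad:
  assumes f: "sq_integrable torus f"
  shows "(\<integral>x. f x * (v x \<bullet> grad (hartley k) x) \<partial>torus) = (\<Sum>i\<in>UNIV. of_int (k $ i) * hcoeff (\<lambda>x. v x $ i * f x) (- k))"
proof -
  have "(\<integral>x. f x * (v x \<bullet> grad (hartley k) x) \<partial>torus) = (\<integral>x. (\<Sum>i\<in>UNIV. of_int (k $ i) * ((v x $ i * f x) * hartley (- k) x)) \<partial>torus)"
    by (simp add: inner_grad_hartley sum_distrib_left mult_ac)
  also have "\<dots> = (\<Sum>i\<in>UNIV. of_int (k $ i) * hcoeff (\<lambda>x. v x $ i * f x) (- k))"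
    using integrable_mult_hartley[OF sq_integrable_torus_integrable[OF sq_integrable_v[OF f]], of _ "- k"]
    by (subst Bochner_Integration.integral_sum) (auto simp: hcoeff_def)
  finally show ?thesis .
qed

text \<open>Since \<open>v\<close> is divergence free, it is orthogonal to the gradient of the product of two modes.\<close>
lemma antisym:
  "(\<integral>x. hartley l x * (v x \<bullet> grad (hartley k) x) \<partial>torus) = - (\<integral>x. hartley k x * (v x \<bullet> grad (hartley l) x) \<partial>torus)"
proof -
  have "grad (\<lambda>x. hartley k x * hartley l x) x = hartley k x *\<^sub>R grad (hartley l) x + hartley l x *\<^sub>R grad (hartley k) x" for x
    unfolding grad_def pderiv_at_mult[OF test_differentiable[OF hartley_test] test_differentiable[OF hartley_test]]
    by (simp add: vec_eq_iff mult.commute)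
  then have "(\<integral>x. hartley k x * (v x \<bullet> grad (hartley l) x) + hartley l x * (v x \<bullet> grad (hartley k) x) \<partial>torus) = 0"
    using div hartley_mult_test[of k l] unfolding divergence_free_def by (auto simp: inner_add_right)
  then show ?thesis
    using sq_integrable_mult_integrable[OF sq_integrable_hartley sq_integrable_v_grad, of k l] sq_integrable_mult_integrable[OF sq_integrable_hartley sq_integrable_v_grad, of l k]
    by simp
qed

text \<open>Both factors are expanded in modes, and the factor \<open>k\<^sub>i\<close> from the gradient of \<open>w\<close> is moved to the mode
  that \<open>f\<close> is tested with.\<close>
lemma advected_inner:
  assumes f: "sq_integrable torus f"
  shows "(\<integral>x. advected x * f x \<partial>torus) = (\<integral>k. hcoeff w k * (\<integral>x. f x * (v x \<bullet> grad (hartley k) x) \<partial>torus) \<partial>counting)"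
proof -
  have i: "integrable counting (\<lambda>k. hcoeff (p i) k * hcoeff (\<lambda>x. v x $ i * f x) k)" for i
    by (rule sq_integrable_mult_integrable[OF sq_integrable_hcoeff[OF p] sq_integrable_hcoeff[OF sq_integrable_v[OF f]]])
  then have i': "integrable counting (\<lambda>k. hcoeff (p i) (- k) * hcoeff (\<lambda>x. v x $ i * f x) (- k))" for i
    using integrable_counting_uminus[of "\<lambda>k. hcoeff (p i) k * hcoeff (\<lambda>x. v x $ i * f x) k"] by simp
  have "(\<integral>x. advected x * f x \<partial>torus) = (\<integral>x. (\<Sum>i\<in>UNIV. p i x * (v x $ i * f x)) \<partial>torus)"
    unfolding advected_def sum_distrib_right by (simp add: mult_ac)
  also have "\<dots> = (\<Sum>i\<in>UNIV. \<integral>x. p i x * (v x $ i * f x) \<partial>torus)"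
    by (rule Bochner_Integration.integral_sum) (rule sq_integrable_mult_integrable[OF p sq_integrable_v[OF f]])
  also have "\<dots> = (\<Sum>i\<in>UNIV. \<integral>k. hcoeff (p i) k * hcoeff (\<lambda>x. v x $ i * f x) k \<partial>counting)"
    by (simp add: Parseval_inner[OF p sq_integrable_v[OF f]])
  also have "\<dots> = (\<Sum>i\<in>UNIV. \<integral>k. hcoeff (p i) (- k) * hcoeff (\<lambda>x. v x $ i * f x) (- k) \<partial>counting)"
    by (rule sum.cong[OF refl], rule integral_counting_uminus[symmetric])
  also have "\<dots> = (\<integral>k. (\<Sum>i\<in>UNIV. hcoeff (p i) (- k) * hcoeff (\<lambda>x. v x $ i * f x) (- k)) \<partial>counting)"
    by (rule Bochner_Integration.integral_sum[symmetric]) (rule i')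
  also have "\<dots> = (\<integral>k. hcoeff w k * (\<integral>x. f x * (v x \<bullet> grad (hartley k) x) \<partial>torus) \<partial>counting)"
    unfolding integral_v_grad[OF f] p_hcoeff by (simp add: sum_distrib_left mult_ac)
  finally show ?thesis .
qed

text \<open>The distributional form of \<open>v \<cdot> \<nabla>w\<close> agrees with the pointwise one: on pairs of modes this is the
  antisymmetry of the transport matrix.\<close>
lemma weak_transport: "(\<integral>x. w x * (v x \<bullet> grad (hartley l) x) \<partial>torus) = - hcoeff advected l"
proof -
  have "(\<integral>x. w x * (v x \<bullet> grad (hartley l) x) \<partial>torus) = (\<integral>k. hcoeff w k * hcoeff (\<lambda>x. v x \<bullet> grad (hartley l) x) k \<partial>counting)"
    by (rule Parseval_inner[OF w sq_integrable_v_grad])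
  also have "\<dots> = (\<integral>k. - (hcoeff w k * (\<integral>x. hartley l x * (v x \<bullet> grad (hartley k) x) \<partial>torus)) \<partial>counting)"
    unfolding antisym[of l] by (simp add: hcoeff_def mult.commute)
  also have "\<dots> = - hcoeff advected l"
    using advected_inner[OF sq_integrable_hartley, of l] by (simp add: hcoeff_def)
  finally show ?thesis .
qed

text \<open>Transport by a divergence free field does no work: by the two expansions above, the integral is equal
  to its own negative.\<close>
lemma advected_orthogonal: "(\<integral>x. advected x * w x \<partial>torus) = 0"
proof -
  have "(\<integral>x. advected x * w x \<partial>torus) = - (\<integral>k. hcoeff w k * hcoeff advected k \<partial>counting)"
    unfolding advected_inner[OF w] weak_transport by simp
  also have "\<dots> = - (\<integral>x. advected x * w x \<partial>torus)"
    using Parseval_inner[OF w sq_integrable_advected] by (simp add: mult.commute)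
  finally show ?thesis by simp
qed

lemma advected_bound: "(\<integral>x. (advected x)\<^sup>2 \<partial>torus) \<le> real CARD('d) * M\<^sup>2 * (\<integral>k. freq2 k * (hcoeff w k)\<^sup>2 \<partial>counting)"
proof -
  have ip: "integrable torus (\<lambda>x. (p i x)\<^sup>2)" for i using p by (simp add: sq_integrable_def)
  have AEall: "AE x in torus. \<forall>i. \<bar>v x $ i\<bar> \<le> M" using v_bound by (simp add: AE_all_countable)
  have "(\<integral>x. (advected x)\<^sup>2 \<partial>torus) \<le> (\<integral>x. real CARD('d) * M\<^sup>2 * (\<Sum>i\<in>UNIV. (p i x)\<^sup>2) \<partial>torus)"
  proof (rule integral_mono_AE)
    show "integrable torus (\<lambda>x. (advected x)\<^sup>2)" using sq_integrable_advected by (simp add: sq_integrable_def)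
    show "integrable torus (\<lambda>x. real CARD('d) * M\<^sup>2 * (\<Sum>i\<in>UNIV. (p i x)\<^sup>2))" using ip by simp
    show "AE x in torus. (advected x)\<^sup>2 \<le> real CARD('d) * M\<^sup>2 * (\<Sum>i\<in>UNIV. (p i x)\<^sup>2)"
      using AEall
    proof eventually_elim
      case (elim x)
      have "(advected x)\<^sup>2 \<le> (\<Sum>i\<in>UNIV. (v x $ i)\<^sup>2) * (\<Sum>i\<in>UNIV. (p i x)\<^sup>2)"
        unfolding advected_def by (rule Cauchy_Schwarz_ineq_sum)
      also have "\<dots> \<le> (\<Sum>i\<in>(UNIV::'d set). M\<^sup>2) * (\<Sum>i\<in>UNIV. (p i x)\<^sup>2)"
        using elim by (intro mult_right_mono sum_mono sum_nonneg) (auto simp: abs_le_square_iff[symmetric] intro: order_trans)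
      finally show ?case by simp
    qed
  qed
  also have "\<dots> = real CARD('d) * M\<^sup>2 * (\<Sum>i\<in>UNIV. \<integral>k. (hcoeff (p i) (- k))\<^sup>2 \<partial>counting)"
    using ip by (simp add: Parseval_square[OF p] integral_counting_uminus[of "\<lambda>k. (hcoeff _ k)\<^sup>2"])
  also have "(\<Sum>i\<in>UNIV. \<integral>k. (hcoeff (p i) (- k))\<^sup>2 \<partial>counting) = (\<integral>k. (\<Sum>i\<in>UNIV. (hcoeff (p i) (- k))\<^sup>2) \<partial>counting)"
    using sq_integrable_hcoeff[OF p] integrable_counting_uminus[of "\<lambda>k. (hcoeff (p _) k)\<^sup>2"]
    by (intro Bochner_Integration.integral_sum[symmetric]) (simp add: sq_integrable_def)
  also have "\<dots> = (\<integral>k. freq2 k * (hcoeff w k)\<^sup>2 \<partial>counting)"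
    unfolding p_hcoeff freq2_def by (simp add: sum_distrib_right power_mult_distrib)
  finally show ?thesis .
qed

end

section \<open>Energy of a sequence of modes\<close>

abbreviation lborel_upto :: "real \<Rightarrow> real measure" where "lborel_upto t \<equiv> restrict_space lborel {0..t}"

lemma upto_integrable: "integrable (lborel_upto t) f \<longleftrightarrow> integrable lborel (\<lambda>x. indicator {0..t} x * f x)" for f :: "real \<Rightarrow> real"
  by (subst integrable_restrict_space) auto

lemma upto_integral: "(\<integral>x. f x \<partial>lborel_upto t) = (\<integral>x. indicator {0..t} x * f x \<partial>lborel)" for f :: "real \<Rightarrow> real"
  by (subst integral_restrict_space) auto

text \<open>A substitute for the chain rule \<open>(W\<^sup>2)' = 2 W G\<close> when \<open>G\<close> is only integrable: the integral of
  \<open>G s G x\<close> over the square is twice its integral over the triangle \<open>x \<le> s\<close>.\<close>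
lemma primitive_square:
  fixes G W :: "real \<Rightarrow> real"
  assumes W: "\<And>s. s \<in> {0..t} \<Longrightarrow> has_bochner_integral (lborel_upto s) G (W s)" and t: "0 \<le> t"
  shows "integrable (lborel_upto t) (\<lambda>s. W s * G s)" "(W t)\<^sup>2 = 2 * (\<integral>s. W s * G s \<partial>lborel_upto t)"
proof -
  define g where "g x = indicator {0..t} x * G x" for x
  have g: "integrable lborel g"
    using W[of t] t unfolding g_def[abs_def] upto_integrable[symmetric] by (auto simp: has_bochner_integral_iff)
  have [measurable]: "g \<in> borel_measurable lborel" using g by auto
  have Wg: "W s = (\<integral>x. g x * indicator {..s} x \<partial>lborel)" if "s \<in> {0..t}" for s
  proof -
    have "W s = (\<integral>x. indicator {0..s} x * G x \<partial>lborel)"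
      using W[OF that] by (simp add: has_bochner_integral_iff upto_integral)
    also have "(\<lambda>x. indicator {0..s} x * G x) = (\<lambda>x. g x * indicator {..s} x)"
      using that by (auto simp: g_def indicator_def)
    finally show ?thesis .
  qed
  define f where "f s x = g s * (g x * indicator {..s} x)" for s x
  have g2: "integrable (lborel \<Otimes>\<^sub>M lborel) (\<lambda>(s, x). g s * g x)"
  proof (rule lborel_pair.Fubini_integrable)
    show "integrable lborel (\<lambda>x. \<integral>y. norm (case (x, y) of (s, x) \<Rightarrow> g s * g x) \<partial>lborel)"
      using g by (simp add: abs_mult)
  qed (use g in auto)
  have f: "integrable (lborel \<Otimes>\<^sub>M lborel) (case_prod f)"
  proof (rule Bochner_Integration.integrable_bound[OF g2])
    have "case_prod f = (\<lambda>p. g (fst p) * (g (snd p) * (if snd p \<le> fst p then 1 else 0)))"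
      by (auto simp: f_def fun_eq_iff)
    also have "\<dots> \<in> borel_measurable (lborel \<Otimes>\<^sub>M lborel)" by measurable
    finally show "case_prod f \<in> borel_measurable (lborel \<Otimes>\<^sub>M lborel)" .
    show "AE x in lborel \<Otimes>\<^sub>M lborel. norm (case x of (s, x) \<Rightarrow> f s x) \<le> norm (case x of (s, x) \<Rightarrow> g s * g x)"
      by (rule AE_I2) (auto simp: f_def indicator_def)
  qed
  have inner: "(\<integral>x. f s x \<partial>lborel) = indicator {0..t} s * (W s * G s)" for s
  proof (cases "s \<in> {0..t}")
    case True then show ?thesis using Wg[OF True] by (simp add: f_def) (simp add: g_def)
  qed (simp add: f_def g_def)
  show I: "integrable (lborel_upto t) (\<lambda>s. W s * G s)"
    unfolding upto_integrable using lborel_pair.integrable_fst[OF f] by (simp add: inner)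
  define J where "J = (\<integral>s. W s * G s \<partial>lborel_upto t)"
  have Wt: "(\<integral>x. g x \<partial>lborel) = W t"
    unfolding Wg[of t, OF atLeastAtMost_iff[THEN iffD2, OF conjI[OF t order_refl]]]
    by (intro Bochner_Integration.integral_cong) (auto simp: g_def indicator_def)
  \<comment> \<open>The other order of integration covers the complementary triangle.\<close>
  have inner2: "(\<integral>s. f s x \<partial>lborel) = W t * g x - indicator {0..t} x * (W x * G x)" for x
  proof (cases "x \<in> {0..t}")
    case True
    have i: "integrable lborel (\<lambda>s. g s * indicator {..x} s)"
      using g by (rule integrable_mult_bounded[where C = 1]) auto
    have "(\<integral>s. f s x \<partial>lborel) = (\<integral>s. g x * (g s - g s * indicator {..x} s) \<partial>lborel)"
    proof (rule integral_cong_AE)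
      have "AE s in lborel. s \<noteq> x" by (rule AE_lborel_singleton)
      then show "AE s in lborel. f s x = g x * (g s - g s * indicator {..x} s)"
        by eventually_elim (auto simp: f_def indicator_def)
      have "(\<lambda>s. f s x) = (\<lambda>s. g s * (g x * indicator {x..} s))" by (auto simp: f_def indicator_def)
      also have "\<dots> \<in> borel_measurable lborel" by measurable
      finally show "(\<lambda>s. f s x) \<in> borel_measurable lborel" .
    qed measurable
    also have "\<dots> = g x * (W t - W x)"
      using g i Wt Wg[OF True] by simp
    finally show ?thesis using True by (simp add: g_def algebra_simps)
  qed (simp add: f_def g_def)
  have "J = (\<integral>s. (\<integral>x. f s x \<partial>lborel) \<partial>lborel)" unfolding J_def upto_integral inner ..
  also have "\<dots> = (\<integral>x. (\<integral>s. f s x \<partial>lborel) \<partial>lborel)" by (rule lborel_pair.Fubini_integral[OF f, symmetric])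
  also have "\<dots> = W t * W t - J"
    unfolding inner2 J_def upto_integral using g I[unfolded upto_integrable] Wt by simp
  finally show "(W t)\<^sup>2 = 2 * (\<integral>s. W s * G s \<partial>lborel_upto t)" by (simp add: J_def power2_eq_square)
qed

text \<open>The chain rule for each mode, summed over all modes; the bound permits to exchange the sum and the
  time integral.\<close>
lemma energy_sum:
  fixes G W :: "real \<Rightarrow> int ^ 'd::finite \<Rightarrow> real"
  assumes W: "\<And>k s. s \<in> {0..t} \<Longrightarrow> has_bochner_integral (lborel_upto s) (\<lambda>r. G r k) (W s k)" and t: "0 \<le> t"
    and fin: "(\<integral>\<^sup>+s. (\<integral>\<^sup>+k. ennreal \<bar>W s k * G s k\<bar> \<partial>counting) \<partial>lborel_upto t) < \<infinity>"
  shows "integrable (lborel_upto t) (\<lambda>s. \<integral>k. W s k * G s k \<partial>counting)"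
    "(\<integral>k. (W t k)\<^sup>2 \<partial>counting) = 2 * (\<integral>s. (\<integral>k. W s k * G s k \<partial>counting) \<partial>lborel_upto t)"
proof -
  interpret C: sigma_finite_measure "counting :: (int ^ 'd) measure"
    by (rule sigma_finite_measure_count_space_countable) simp
  interpret U: sigma_finite_measure "lborel_upto t"
    by (rule sigma_finite_measure_restrict_space) (auto intro: sigma_finite_lborel)
  interpret P: pair_sigma_finite "counting :: (int ^ 'd) measure" "lborel_upto t" ..
  note sq = primitive_square[of t "\<lambda>r. G r k" "\<lambda>r. W r k" for k, OF W t]
  let ?f = "\<lambda>(k, s). W s k * G s k"
  have m: "?f \<in> borel_measurable ((counting :: (int ^ 'd) measure) \<Otimes>\<^sub>M lborel_upto t)"
    using borel_measurable_integrable[OF sq(1)] by (intro measurable_pair_measure_countable1) auto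
  have i: "integrable ((counting :: (int ^ 'd) measure) \<Otimes>\<^sub>M lborel_upto t) ?f"
  proof (rule integrableI_bounded[OF m])
    have "(\<integral>\<^sup>+p. ennreal (norm (?f p)) \<partial>(counting \<Otimes>\<^sub>M lborel_upto t)) =
       (\<integral>\<^sup>+s. (\<integral>\<^sup>+k. ennreal (norm (?f (k, s))) \<partial>counting) \<partial>lborel_upto t)"
      by (rule P.nn_integral_snd[symmetric]) (rule measurable_compose[OF m measurable_compose[OF borel_measurable_norm measurable_ennreal]])
    then show "(\<integral>\<^sup>+p. ennreal (norm (?f p)) \<partial>((counting :: (int ^ 'd) measure) \<Otimes>\<^sub>M lborel_upto t)) < \<infinity>"
      using fin by simp
  qed
  show "integrable (lborel_upto t) (\<lambda>s. \<integral>k. W s k * G s k \<partial>counting)" by (rule P.integrable_snd[OF i])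
  have "(\<integral>k. (W t k)\<^sup>2 \<partial>counting) = (\<integral>k. 2 * (\<integral>s. W s k * G s k \<partial>lborel_upto t) \<partial>counting)"
    by (rule Bochner_Integration.integral_cong) (use sq(2) in auto)
  also have "\<dots> = 2 * (\<integral>s. (\<integral>k. W s k * G s k \<partial>counting) \<partial>lborel_upto t)"
    using P.Fubini_integral[OF i] by simp
  finally show "(\<integral>k. (W t k)\<^sup>2 \<partial>counting) = 2 * (\<integral>s. (\<integral>k. W s k * G s k \<partial>counting) \<partial>lborel_upto t)" .
qed

lemma first_hitting:
  fixes f :: "real \<Rightarrow> real"
  assumes c: "continuous_on {0..t} f" and "f 0 < q" "q \<le> f t" "0 \<le> t"
  shows "\<exists>s\<in>{0..t}. f s = q \<and> (\<forall>r\<in>{0..s}. f r \<le> q)"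
proof -
  let ?S = "{s \<in> {0..t}. q \<le> f s}"
  have "?S = {0..t} \<inter> f -` {q..}" by auto
  also have "closed \<dots>" by (rule continuous_closed_preimage[OF c]) auto
  finally have "closed ?S" .
  moreover have "bounded ?S" by (rule bounded_subset[OF bounded_closed_interval[of 0 t]]) auto
  ultimately have cS: "compact ?S" by (simp add: compact_eq_bounded_closed)
  have "t \<in> ?S" using assms by simp
  then have "?S \<noteq> {}" by blast
  from continuous_attains_inf[OF cS this continuous_on_id] obtain s where s: "s \<in> ?S" "\<And>r. r \<in> ?S \<Longrightarrow> s \<le> r"
    by auto
  have less: "f r < q" if "r \<in> {0..t}" "r < s" for r using s(2)[of r] that by force
  have "f s = q"
  proof (rule ccontr)
    assume "f s \<noteq> q"
    then have fs: "q < f s" using s(1) by simp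
    have "continuous_on {0..s} f" using c s(1) by (auto intro: continuous_on_subset)
    from IVT'[of f 0 q s, OF _ _ _ this] obtain r where "0 \<le> r" "r \<le> s" "f r = q" using assms fs s(1) by auto
    then show False using s fs less[of r] by (cases "r = s") auto
  qed
  moreover have "f r \<le> q" if "r \<in> {0..s}" for r
    using less[of r] that s(1) \<open>f s = q\<close> by (cases "r = s") auto
  ultimately show ?thesis using s(1) by blast
qed

text \<open>The climb of \<open>y\<close> from \<open>0\<close> to \<open>q1\<close>, and the one from \<open>q1\<close> to \<open>q2\<close>, each cost a definite amount of the
  integral of \<open>A\<close>.\<close>
lemma two_thresholds:
  fixes y Y A :: "real \<Rightarrow> real"
  assumes t: "0 \<le> t" and Y: "integrable (lborel_upto t) Y" and A: "integrable (lborel_upto t) A" "\<And>s. A s \<ge> 0"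
    and y: "\<And>s. s \<in> {0..t} \<Longrightarrow> y s = (\<integral>r. Y r \<partial>lborel_upto s)"
    and q: "0 < q1" "q1 \<le> q2" and C: "0 < C1" "0 < C2"
    and Y1: "AE s in lborel. s \<in> {0..t} \<longrightarrow> y s \<le> q1 \<longrightarrow> Y s \<le> C1 * A s"
    and Y2: "AE s in lborel. s \<in> {0..t} \<longrightarrow> y s \<le> q2 \<longrightarrow> Y s \<le> C2 * A s"
    and hit: "q2 \<le> y t"
  shows "q1 / C1 + (q2 - q1) / C2 \<le> (\<integral>s. A s \<partial>lborel_upto t)"
proof -
  have setint: "set_integrable lborel S f" if "integrable (lborel_upto t) f" "S \<subseteq> {0..t}" "S \<in> sets lborel" for S and f :: "real \<Rightarrow> real"
    by (rule set_integrable_subset[OF _ that(3,2)]) (use that(1) in \<open>simp add: upto_integrable set_integrable_def\<close>)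
  have yset: "y s = (LINT r:{0..s}|lborel. Y r)" if "s \<in> {0..t}" for s
    using y[OF that] by (simp add: upto_integral set_lebesgue_integral_def)
  have cont: "continuous_on {0..t} y"
  proof -
    have "Y integrable_on {0..t}" by (rule set_borel_integral_eq_integral(1)[OF setint[OF Y]]) auto
    then have "continuous_on {0..t} (\<lambda>s. integral {0..s} Y)" by (rule indefinite_integral_continuous_1)
    moreover have "y s = integral {0..s} Y" if "s \<in> {0..t}" for s
      unfolding yset[OF that] by (rule set_borel_integral_eq_integral(2)[OF setint[OF Y]]) (use that in auto)
    ultimately show ?thesis using continuous_on_cong by (metis (no_types, lifting))
  qed
  have y0: "y 0 = 0"
  proof -
    have "AE r in lborel. r \<notin> {0..0::real}" using AE_lborel_singleton[of "0::real"] by simp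
    then show ?thesis unfolding yset[of 0, simplified, OF t] set_lebesgue_integral_def
      by (intro integral_eq_zero_AE) (auto elim!: eventually_mono)
  qed
  from first_hitting[OF cont, of q2] y0 q hit t obtain t2 where
    t2: "t2 \<in> {0..t}" "y t2 = q2" "\<And>r. r \<in> {0..t2} \<Longrightarrow> y r \<le> q2" by auto
  have "continuous_on {0..t2} y" using cont t2(1) by (auto intro: continuous_on_subset)
  from first_hitting[OF this, of q1] y0 q t2 obtain t1 where
    t1: "t1 \<in> {0..t2}" "y t1 = q1" "\<And>r. r \<in> {0..t1} \<Longrightarrow> y r \<le> q1" by auto
  have s1: "{0..t1} \<subseteq> {0..t}" "{t1<..t2} \<subseteq> {0..t}" using t1 t2 by auto
  have split: "(LINT r:{0..t2}|lborel. f r) = (LINT r:{0..t1}|lborel. f r) + (LINT r:{t1<..t2}|lborel. f r)"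
    if f: "integrable (lborel_upto t) f" for f :: "real \<Rightarrow> real"
  proof -
    have u: "{0..t2} = {0..t1} \<union> {t1<..t2}" and e: "{0..t1} \<inter> {t1<..t2} = {}" using t1 by auto
    show ?thesis
      unfolding u by (rule set_integral_Un[OF e setint[OF f s1(1)] setint[OF f s1(2)]]) auto
  qed
  have mono: "(LINT r:S|lborel. Y r) \<le> C * (LINT r:S|lborel. A r)"
    if S: "S \<subseteq> {0..t}" "S \<in> sets lborel" and ae: "AE s in lborel. s \<in> S \<longrightarrow> Y s \<le> C * A s" for S C
  proof -
    have "(LINT r:S|lborel. Y r) \<le> (LINT r:S|lborel. C * A r)"
      unfolding set_lebesgue_integral_def
    proof (rule integral_mono_AE)
      show "integrable lborel (\<lambda>x. indicat_real S x *\<^sub>R Y x)" using setint[OF Y S] by (simp add: set_integrable_def)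
      show "integrable lborel (\<lambda>x. indicat_real S x *\<^sub>R (C * A x))"
        using setint[OF integrable_mult_right[OF A(1), of C] S] by (simp add: set_integrable_def)
      show "AE x in lborel. indicat_real S x *\<^sub>R Y x \<le> indicat_real S x *\<^sub>R (C * A x)"
        using ae by eventually_elim (auto simp: indicator_def)
    qed
    then show ?thesis by simp
  qed
  have "q1 \<le> C1 * (LINT r:{0..t1}|lborel. A r)"
    unfolding t1(2)[symmetric] yset[OF subsetD[OF s1(1)], of t1, simplified, OF conjunct1[OF t1(1)[unfolded atLeastAtMost_iff]]]
    by (rule mono) (use Y1 s1 t1 in \<open>auto elim!: eventually_mono\<close>)
  moreover have "q2 - q1 \<le> C2 * (LINT r:{t1<..t2}|lborel. A r)"
  proof -
    have "q2 - q1 = (LINT r:{t1<..t2}|lborel. Y r)"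
      using split[OF Y] yset[OF t2(1)] yset[of t1] t1 t2 by auto
    also have "\<dots> \<le> C2 * (LINT r:{t1<..t2}|lborel. A r)"
      by (rule mono) (use Y2 s1 t1 t2 in \<open>auto elim!: eventually_mono\<close>)
    finally show ?thesis .
  qed
  moreover have "(LINT r:{0..t2}|lborel. A r) \<le> (\<integral>s. A s \<partial>lborel_upto t)"
    unfolding set_lebesgue_integral_def upto_integral real_scaleR_def
  proof (rule integral_mono)
    show "integrable lborel (\<lambda>x. indicat_real {0..t2} x * A x)" "integrable lborel (\<lambda>x. indicat_real {0..t} x * A x)"
      using setint[OF A(1), of "{0..t2}"] setint[OF A(1), of "{0..t}"] t2 by (auto simp: set_integrable_def)
    show "indicat_real {0..t2} x * A x \<le> indicat_real {0..t} x * A x" for x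
      using t2(1) A(2)[of x] by (auto simp: indicator_def)
  qed
  ultimately have "q1 / C1 \<le> (LINT r:{0..t1}|lborel. A r)" "(q2 - q1) / C2 \<le> (LINT r:{t1<..t2}|lborel. A r)"
    "(LINT r:{0..t2}|lborel. A r) \<le> (\<integral>s. A s \<partial>lborel_upto t)"
    using C by (simp_all add: divide_le_eq mult.commute)
  then show ?thesis using split[OF A(1)] by linarith
qed

definition l2_norm :: "'a measure \<Rightarrow> ('a \<Rightarrow> real) \<Rightarrow> real" where
  "l2_norm M f = sqrt (\<integral>x. (f x)\<^sup>2 \<partial>M)"

lemma l2_norm_nonneg: "l2_norm M f \<ge> 0" by (simp add: l2_norm_def)
lemma l2_norm_square: "(l2_norm M f)\<^sup>2 = (\<integral>x. (f x)\<^sup>2 \<partial>M)" by (simp add: l2_norm_def)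

lemma l2_norm_inner: assumes "sq_integrable M f" "sq_integrable M g" shows "\<bar>\<integral>x. f x * g x \<partial>M\<bar> \<le> l2_norm M f * l2_norm M g"
proof (rule power2_le_imp_le)
  show "\<bar>\<integral>x. f x * g x \<partial>M\<bar>\<^sup>2 \<le> (l2_norm M f * l2_norm M g)\<^sup>2"
    using integral_abs_square_le[OF assms] by (simp add: power_mult_distrib l2_norm_square)
qed (simp add: l2_norm_nonneg)

lemma l2_norm_triangle: assumes "sq_integrable M f" "sq_integrable M g" shows "l2_norm M (\<lambda>x. f x + g x) \<le> l2_norm M f + l2_norm M g"
proof (rule power2_le_imp_le)
  show "(l2_norm M (\<lambda>x. f x + g x))\<^sup>2 \<le> (l2_norm M f + l2_norm M g)\<^sup>2"
    using sq_integrable_square_add[OF assms] l2_norm_inner[OF assms] by (simp add: l2_norm_square power2_sum)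
qed (simp add: l2_norm_nonneg)

lemma l2_norm_uminus: "l2_norm M (\<lambda>x. - f x) = l2_norm M f" by (simp add: l2_norm_def)

lemma l2_norm_diff: assumes "sq_integrable M f" "sq_integrable M g" shows "l2_norm M (\<lambda>x. f x - g x) \<le> l2_norm M f + l2_norm M g"
  using l2_norm_triangle[OF assms(1) sq_integrable_scale[OF assms(2), of "-1"]] l2_norm_uminus[of M g] by simp

text \<open>The sequences \<open>a\<close> and \<open>b\<close> are the coefficients of the viscous and of the inviscid solution. Interpolation
  and the hypothesis on the second derivatives give \<open>|\<nabla>w|\<^sup>2 \<le> |w| |\<Delta>w| \<le> r\<^sup>2 |\<nabla>b|\<^sup>2\<close>; the rest is
  the triangle inequality \<open>|\<nabla>b| \<le> |\<nabla>a| + |\<nabla>w|\<close>.\<close>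
lemma gradient_comparison:
  fixes a b :: "int ^ 'd::finite \<Rightarrow> real"
  defines "w \<equiv> \<lambda>k. a k - b k"
  assumes a: "sq_integrable counting (\<lambda>k. sqrt (freq2 k) * a k)" "sq_integrable counting (\<lambda>k. freq2 k * a k)"
    and b: "sq_integrable counting (\<lambda>k. sqrt (freq2 k) * b k)" "sq_integrable counting (\<lambda>k. freq2 k * b k)"
    and w: "sq_integrable counting w" and l: "l > 0"
    and hyp: "l * (l2_norm counting (\<lambda>k. freq2 k * b k) + l2_norm counting (\<lambda>k. freq2 k * a k)) \<le> (l2_norm counting (\<lambda>k. sqrt (freq2 k) * b k))\<^sup>2"
    and r: "0 < r" "r < 1" and small: "l2_norm counting w \<le> r\<^sup>2 * l"
  shows "- (\<integral>k. freq2 k * w k * a k \<partial>counting) \<le> r / (1 - r) * (l2_norm counting (\<lambda>k. sqrt (freq2 k) * a k))\<^sup>2"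
    "(1 - r) * l2_norm counting (\<lambda>k. sqrt (freq2 k) * b k) \<le> l2_norm counting (\<lambda>k. sqrt (freq2 k) * a k)"
proof -
  let ?n = "l2_norm (counting :: (int ^ 'd) measure)"
  let ?A = "?n (\<lambda>k. sqrt (freq2 k) * a k)" and ?B = "?n (\<lambda>k. sqrt (freq2 k) * b k)" and ?W = "?n (\<lambda>k. sqrt (freq2 k) * w k)"
  have sw: "sq_integrable counting (\<lambda>k. sqrt (freq2 k) * w k)" "sq_integrable counting (\<lambda>k. freq2 k * w k)"
    using sq_integrable_diff[OF a(1) b(1)] sq_integrable_diff[OF a(2) b(2)] by (simp_all add: w_def algebra_simps)
  have "?W\<^sup>2 = (\<integral>k. w k * (freq2 k * w k) \<partial>counting)"
    unfolding l2_norm_square power_mult_distrib real_sqrt_pow2[OF freq2_nonneg] by (simp add: power2_eq_square mult_ac)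
  also have "\<dots> \<le> ?n w * ?n (\<lambda>k. freq2 k * w k)"
    using l2_norm_inner[OF w sw(2)] by linarith
  also have "?n (\<lambda>k. freq2 k * w k) \<le> ?n (\<lambda>k. freq2 k * a k) + ?n (\<lambda>k. freq2 k * b k)"
    using l2_norm_diff[OF a(2) b(2)] by (simp add: w_def algebra_simps)
  then have "?n w * ?n (\<lambda>k. freq2 k * w k) \<le> (r\<^sup>2 * l) * (?n (\<lambda>k. freq2 k * b k) + ?n (\<lambda>k. freq2 k * a k))"
    using small l by (intro mult_mono) (auto simp: l2_norm_nonneg)
  also have "\<dots> \<le> r\<^sup>2 * ?B\<^sup>2"
    using mult_left_mono[OF hyp, of "r\<^sup>2"] by (simp add: mult.assoc)
  finally have "?W\<^sup>2 \<le> (r * ?B)\<^sup>2" by (simp add: power_mult_distrib)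
  then have WB: "?W \<le> r * ?B" by (rule power2_le_imp_le) (use r in \<open>simp add: l2_norm_nonneg\<close>)
  have "?B \<le> ?A + ?W"
    using l2_norm_diff[OF a(1) sw(1)] by (simp add: w_def algebra_simps)
  then show AB: "(1 - r) * ?B \<le> ?A" using WB by (simp add: algebra_simps)
  then have "?B \<le> ?A / (1 - r)" using r by (simp add: field_simps)
  then have WA: "?W \<le> r / (1 - r) * ?A"
    using WB r mult_left_mono[of ?B "?A / (1 - r)" r] by simp
  have "- (\<integral>k. freq2 k * w k * a k \<partial>counting) = - (\<integral>k. (sqrt (freq2 k) * w k) * (sqrt (freq2 k) * a k) \<partial>counting)"
    unfolding sqrt_freq2_mult ..
  also have "\<dots> \<le> ?W * ?A" using l2_norm_inner[OF sw(1) a(1)] by linarith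
  also have "\<dots> \<le> r / (1 - r) * ?A * ?A" by (rule mult_right_mono[OF WA]) (simp add: l2_norm_nonneg)
  finally show "- (\<integral>k. freq2 k * w k * a k \<partial>counting) \<le> r / (1 - r) * ?A\<^sup>2" by (simp add: power2_eq_square)
qed

section \<open>Solutions of the advection-diffusion equation\<close>

lemma H1_seminorm_l2_norm:
  assumes f: "f \<in> L2_space" and H: "H1_seminorm f < \<infinity>"
  shows "sq_integrable counting (\<lambda>k. sqrt (freq2 k) * hcoeff f k)"
    "(H1_seminorm f)\<^sup>2 = ennreal ((l2_norm counting (\<lambda>k. sqrt (freq2 k) * hcoeff f k))\<^sup>2)"
proof -
  have e: "(H1_seminorm f)\<^sup>2 = (\<integral>\<^sup>+k. ennreal ((sqrt (freq2 k) * hcoeff f k)\<^sup>2) \<partial>counting)"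
    unfolding H1_seminorm_hcoeff[OF f] power_mult_distrib real_sqrt_pow2[OF freq2_nonneg] ..
  have "(H1_seminorm f)\<^sup>2 < \<infinity>" using H by (simp add: power_less_top_ennreal)
  then show s: "sq_integrable counting (\<lambda>k. sqrt (freq2 k) * hcoeff f k)" unfolding e by (simp add: sq_integrable_iff_nn)
  show "(H1_seminorm f)\<^sup>2 = ennreal ((l2_norm counting (\<lambda>k. sqrt (freq2 k) * hcoeff f k))\<^sup>2)"
    unfolding e l2_norm_square by (rule sq_integrable_nn[OF s])
qed

lemma H2_seminorm_l2_norm:
  assumes H: "H2_seminorm f < \<infinity>"
  shows "sq_integrable counting (\<lambda>k. freq2 k * hcoeff f k)"
    "H2_seminorm f = ennreal (l2_norm counting (\<lambda>k. freq2 k * hcoeff f k))"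
proof -
  note e = H2_seminorm_hcoeff[OF H]
  have "(H2_seminorm f)\<^sup>2 < \<infinity>" using H by (simp add: power_less_top_ennreal)
  then show s: "sq_integrable counting (\<lambda>k. freq2 k * hcoeff f k)" unfolding e by (simp add: sq_integrable_iff_nn)
  have "(H2_seminorm f)\<^sup>2 = ennreal ((l2_norm counting (\<lambda>k. freq2 k * hcoeff f k))\<^sup>2)"
    unfolding e l2_norm_square by (rule sq_integrable_nn[OF s])
  then have "(H2_seminorm f)\<^sup>2 = (ennreal (l2_norm counting (\<lambda>k. freq2 k * hcoeff f k)))\<^sup>2"
    by (simp add: ennreal_power l2_norm_nonneg)
  then show "H2_seminorm f = ennreal (l2_norm counting (\<lambda>k. freq2 k * hcoeff f k))"
    using H by (cases "H2_seminorm f") (auto simp: ennreal_power l2_norm_nonneg)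
qed

lemma H1_seminorm_pderiv:
  assumes f: "f \<in> L2_space" and H: "H1_seminorm f < \<infinity>"
  shows "sq_integrable torus (weak_pderiv i f)" "hcoeff (weak_pderiv i f) k = - of_int (k $ i) * hcoeff f (- k)"
proof -
  have w: "weakly_differentiable f" using H by (auto simp: H1_seminorm_def split: if_splits)
  have "(L2_norm (weak_pderiv i f))\<^sup>2 \<le> (\<Sum>i\<in>UNIV. (L2_norm (weak_pderiv i f))\<^sup>2)"
    by (rule member_le_sum) auto
  also have "\<dots> < \<infinity>" using H w by (simp add: H1_seminorm_def esqrt_less_top[simplified])
  finally have "(\<integral>\<^sup>+x. ennreal ((weak_pderiv i f x)\<^sup>2) \<partial>torus) < \<infinity>" unfolding L2_norm_square .
  then show "sq_integrable torus (weak_pderiv i f)"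
    using has_weak_pderiv_integrable[OF weak_pderiv[OF w, of i]] by (auto simp: sq_integrable_iff_nn)
  show "hcoeff (weak_pderiv i f) k = - of_int (k $ i) * hcoeff f (- k)"
    by (rule has_weak_pderiv_hcoeff[OF weak_pderiv[OF w]])
qed

lemma Linf_loc_W1inf_bound:
  fixes u :: "real \<Rightarrow> real ^ 'd::finite \<Rightarrow> real ^ 'd"
  assumes u: "Linf_loc_W1inf T u" and t: "t \<in> {0..<T}"
  shows "\<exists>M. AE s in lborel. s \<in> {0..t} \<longrightarrow>
    (\<forall>i. (\<lambda>x. u s x $ i) \<in> borel_measurable torus \<and> (AE x in torus. \<bar>u s x $ i\<bar> \<le> M))"
proof -
  obtain M where M: "AE s in lborel. s \<in> {0..t} \<longrightarrow> (\<Sum>k\<in>UNIV. W1inf_norm (\<lambda>x. u s x $ k)) \<le> ennreal M"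
    using u t unfolding Linf_loc_W1inf_def by blast
  have "AE s in lborel. s \<in> {0..t} \<longrightarrow>
    (\<forall>i. (\<lambda>x. u s x $ i) \<in> borel_measurable torus \<and> (AE x in torus. \<bar>u s x $ i\<bar> \<le> max 0 M))"
    using M
  proof (eventually_elim, intro impI allI)
    fix s i assume *: "s \<in> {0..t} \<longrightarrow> (\<Sum>k\<in>UNIV. W1inf_norm (\<lambda>x. u s x $ k)) \<le> ennreal M" and s: "s \<in> {0..t}"
    have "W1inf_norm (\<lambda>x. u s x $ i) \<le> (\<Sum>k\<in>UNIV. W1inf_norm (\<lambda>x. u s x $ k))"
      by (rule member_le_sum) auto
    then have W: "W1inf_norm (\<lambda>x. u s x $ i) \<le> ennreal M" using * s by auto
    then have w: "weakly_differentiable (\<lambda>x. u s x $ i)"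
      by (auto simp: W1inf_norm_def top_unique split: if_splits)
    then have "integrable torus (\<lambda>x. u s x $ i)"
      using weak_pderiv[OF w, of i] by (simp add: has_weak_pderiv_def)
    moreover have "Linf_norm (\<lambda>x. u s x $ i) \<le> W1inf_norm (\<lambda>x. u s x $ i)"
      using w by (simp add: W1inf_norm_def)
    then have L: "Linf_norm (\<lambda>x. u s x $ i) \<le> ennreal M" using W by (rule order_trans)
    have "AE x in torus. \<bar>u s x $ i\<bar> \<le> max 0 M"
      using esssup_AE[of "\<lambda>x. ennreal \<bar>u s x $ i\<bar>" torus]
    proof eventually_elim
      case (elim x)
      then have "ennreal \<bar>u s x $ i\<bar> \<le> ennreal M" using L unfolding Linf_norm_def by (rule order_trans)
      then show ?case by (auto simp: ennreal_le_iff2)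
    qed
    ultimately show "(\<lambda>x. u s x $ i) \<in> borel_measurable torus \<and> (AE x in torus. \<bar>u s x $ i\<bar> \<le> max 0 M)"
      by auto
  qed
  then show ?thesis by blast
qed

locale solution =
  fixes T \<kappa> :: real and u :: "real \<Rightarrow> real ^ 'd::finite \<Rightarrow> real ^ 'd"
    and f\<^sub>0 :: "real ^ 'd \<Rightarrow> real" and f :: "real \<Rightarrow> real ^ 'd \<Rightarrow> real"
  assumes sol: "advection_diffusion_solution T u \<kappa> f\<^sub>0 f"
begin

lemma L2: "t \<in> {0..<T} \<Longrightarrow> f t \<in> L2_space"
  using sol unfolding advection_diffusion_solution_def by blast

lemma sq_int_at: "t \<in> {0..<T} \<Longrightarrow> sq_integrable torus (f t)"
  by (rule L2_space_sq_integrable[OF L2])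

text \<open>A coefficient is bounded by the \<open>L\<^sup>2\<close> norm, in which solutions are continuous.\<close>
lemma hcoeff_continuous: "continuous_on {0..<T} (\<lambda>s. hcoeff (f s) k)"
  unfolding continuous_on_def
proof
  fix t assume t: "t \<in> {0..<T}"
  have lim: "((\<lambda>s. L2_norm (\<lambda>x. f s x - f t x)) \<longlongrightarrow> 0) (at t within {0..<T})"
    using sol t unfolding advection_diffusion_solution_def by blast
  have le: "ennreal \<bar>hcoeff (f s) k - hcoeff (f t) k\<bar> \<le> L2_norm (\<lambda>x. f s x - f t x)" if s: "s \<in> {0..<T}" for s
  proof -
    have i: "integrable torus (\<lambda>x. f s x - f t x)"
      by (rule sq_integrable_torus_integrable[OF sq_integrable_diff[OF sq_int_at[OF s] sq_int_at[OF t]]])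
    have "(ennreal \<bar>hcoeff (f s) k - hcoeff (f t) k\<bar>)\<^sup>2 = ennreal ((hcoeff (\<lambda>x. f s x - f t x) k)\<^sup>2)"
      using hcoeff_diff[OF sq_integrable_torus_integrable[OF sq_int_at[OF s]] sq_integrable_torus_integrable[OF sq_int_at[OF t]]]
      by (simp add: ennreal_power)
    also have "\<dots> \<le> (L2_norm (\<lambda>x. f s x - f t x))\<^sup>2"
      unfolding L2_norm_square_hcoeff[OF i] by (rule nn_integral_ge_point) simp
    finally show ?thesis
      by (cases "L2_norm (\<lambda>x. f s x - f t x)") (auto simp: ennreal_power ennreal_le_iff intro: power2_le_imp_le ennreal_leI)
  qed
  have "((\<lambda>s. ennreal \<bar>hcoeff (f s) k - hcoeff (f t) k\<bar>) \<longlongrightarrow> 0) (at t within {0..<T})"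
  proof (rule tendsto_sandwich[OF _ _ tendsto_const lim])
    show "\<forall>\<^sub>F s in at t within {0..<T}. ennreal \<bar>hcoeff (f s) k - hcoeff (f t) k\<bar> \<le> L2_norm (\<lambda>x. f s x - f t x)"
      unfolding eventually_at_filter using le by (auto intro!: always_eventually)
  qed simp
  then have "((\<lambda>s. \<bar>hcoeff (f s) k - hcoeff (f t) k\<bar>) \<longlongrightarrow> 0) (at t within {0..<T})"
    using tendsto_ennrealD[of "\<lambda>s. \<bar>hcoeff (f s) k - hcoeff (f t) k\<bar>" 0] by simp
  then have "((\<lambda>s. hcoeff (f s) k - hcoeff (f t) k) \<longlongrightarrow> 0) (at t within {0..<T})"
    by (rule tendsto_rabs_zero_cancel)
  then show "((\<lambda>s. hcoeff (f s) k) \<longlongrightarrow> hcoeff (f t) k) (at t within {0..<T})"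
    by (rule LIM_zero_cancel)
qed

lemma hcoeff_measurable:
  assumes "t \<in> {0..<T}" shows "(\<lambda>s. hcoeff (f s) k) \<in> borel_measurable (lborel_upto t)"
proof -
  have "{0..t} \<subseteq> {0..<T}" using assms by auto
  then have "continuous_on {0..t} (\<lambda>s. hcoeff (f s) k)" by (rule continuous_on_subset[OF hcoeff_continuous])
  then have "(\<lambda>s. hcoeff (f s) k) \<in> borel_measurable (restrict_space borel {0..t})"
    by (rule borel_measurable_continuous_on_restrict)
  then show ?thesis by (simp cong: measurable_cong_sets add: sets_restrict_space measurable_def space_restrict_space)
qed

definition grad_energy :: "real \<Rightarrow> ennreal" where
  "grad_energy s = (\<integral>\<^sup>+k. ennreal (freq2 k * (hcoeff (f s) k)\<^sup>2) \<partial>counting)"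

lemma grad_energy: "s \<in> {0..<T} \<Longrightarrow> (H1_seminorm (f s))\<^sup>2 = grad_energy s"
  unfolding grad_energy_def by (rule H1_seminorm_hcoeff[OF L2])

lemma grad_energy_measurable: "t \<in> {0..<T} \<Longrightarrow> grad_energy \<in> borel_measurable (lborel_upto t)"
  unfolding grad_energy_def[abs_def] nn_integral_freqs
  using hcoeff_measurable by (intro borel_measurable_SUP) (auto intro!: borel_measurable_sum)

lemma nn_grad_energy:
  assumes "t \<in> {0..<T}"
  shows "(\<integral>\<^sup>+s. grad_energy s \<partial>lborel_upto t) = (\<integral>\<^sup>+s\<in>{0..t}. (H1_seminorm (f s))\<^sup>2 \<partial>lborel)"
proof -
  have "(\<integral>\<^sup>+s. grad_energy s \<partial>lborel_upto t) = (\<integral>\<^sup>+s. grad_energy s * indicator {0..t} s \<partial>lborel)"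
    by (rule nn_integral_restrict_space) simp
  also have "\<dots> = (\<integral>\<^sup>+s\<in>{0..t}. (H1_seminorm (f s))\<^sup>2 \<partial>lborel)"
    using assms by (intro nn_integral_cong) (auto simp: grad_energy indicator_def)
  finally show ?thesis .
qed

lemma nn_grad_energy_finite: "t \<in> {0..<T} \<Longrightarrow> (\<integral>\<^sup>+s. grad_energy s \<partial>lborel_upto t) < \<infinity>"
  using sol nn_grad_energy unfolding advection_diffusion_solution_def by auto

lemma AE_H1_finite:
  assumes t: "t \<in> {0..<T}"
  shows "AE s in lborel. s \<in> {0..t} \<longrightarrow> H1_seminorm (f s) < \<infinity>"
proof -
  have "AE s in lborel_upto t. grad_energy s \<noteq> \<infinity>"
    using nn_grad_energy_finite[OF t] by (intro nn_integral_PInf_AE grad_energy_measurable[OF t]) auto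
  then have "AE s in lborel. s \<in> {0..t} \<longrightarrow> grad_energy s \<noteq> \<infinity>" by (subst (asm) AE_restrict_space_iff) auto
  then show ?thesis
  proof eventually_elim
    case (elim s)
    show ?case
    proof
      assume s: "s \<in> {0..t}"
      then have "(H1_seminorm (f s))\<^sup>2 \<noteq> \<infinity>" using elim grad_energy[of s] t by auto
      then show "H1_seminorm (f s) < \<infinity>" by (cases "H1_seminorm (f s)") (auto simp: top_power_ennreal)
    qed
  qed
qed

text \<open>Hartley functions are test functions, so each coefficient is a primitive in time.\<close>
lemma mode_equation:
  assumes "t \<in> {0..<T}"
  shows "has_bochner_integral (lborel_upto t)
    (\<lambda>s. \<integral>x. f s x * (u s x \<bullet> grad (hartley k) x + \<kappa> * laplacian (hartley k) x) \<partial>torus)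
    (hcoeff (f t) k - hcoeff (f 0) k)"
  using sol hartley_test[of k] assms unfolding advection_diffusion_solution_def hcoeff_def by blast

end

lemma freq2_ge_1:
  assumes "k \<noteq> 0" shows "1 \<le> freq2 k"
proof -
  obtain i where i: "k $ i \<noteq> 0" using assms by (auto simp: vec_eq_iff)
  then have "1 \<le> \<bar>k $ i\<bar>" by linarith
  then have "1 \<le> (k $ i)\<^sup>2" using one_le_power[of "\<bar>k $ i\<bar>" 2] by simp
  then have "1 \<le> (real_of_int (k $ i))\<^sup>2" by (metis of_int_1_le_iff of_int_power)
  also have "\<dots> \<le> freq2 k" unfolding freq2_def by (rule member_le_sum) auto
  finally show ?thesis .
qed

locale two_solutions =
  visc: solution T \<kappa> u f\<^sub>0 f + invisc: solution T 0 u f\<^sub>0 g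
  for T \<kappa> :: real and u :: "real \<Rightarrow> real ^ 'd::finite \<Rightarrow> real ^ 'd"
    and f\<^sub>0 :: "real ^ 'd \<Rightarrow> real" and f g :: "real \<Rightarrow> real ^ 'd \<Rightarrow> real" +
  assumes kappa: "\<kappa> > 0" and u: "Linf_loc_W1inf T u"
    and div: "AE t in lborel. t \<in> {0..<T} \<longrightarrow> divergence_free (u t)"
begin

definition w :: "real \<Rightarrow> int ^ 'd \<Rightarrow> real" where
  "w s k = hcoeff (f s) k - hcoeff (g s) k"

text \<open>The time derivative of \<open>w s k\<close>, as given by the two equations in distributional form.\<close>
definition diff_rate :: "real \<Rightarrow> int ^ 'd \<Rightarrow> real" where
  "diff_rate s k = (\<integral>x. f s x * (u s x \<bullet> grad (hartley k) x + \<kappa> * laplacian (hartley k) x) \<partial>torus)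
     - (\<integral>x. g s x * (u s x \<bullet> grad (hartley k) x + 0 * laplacian (hartley k) x) \<partial>torus)"

definition energy_rate :: "real \<Rightarrow> real" where
  "energy_rate s = 2 * (\<integral>k. w s k * diff_rate s k \<partial>counting)"

definition dist_square :: "real \<Rightarrow> real" where
  "dist_square s = (\<integral>k. (w s k)\<^sup>2 \<partial>counting)"

lemma w_eq: "s \<in> {0..<T} \<Longrightarrow> w s k = hcoeff (\<lambda>x. f s x - g s x) k"
  unfolding w_def by (simp add: hcoeff_diff sq_integrable_torus_integrable visc.sq_int_at invisc.sq_int_at)

lemma sq_integrable_w: "s \<in> {0..<T} \<Longrightarrow> sq_integrable counting (w s)"
  using sq_integrable_diff[OF sq_integrable_hcoeff[OF visc.sq_int_at] sq_integrable_hcoeff[OF invisc.sq_int_at], of s s] by (simp add: w_def[abs_def])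

lemma has_integral_rate:
  assumes s: "s \<in> {0..<T}"
  shows "has_bochner_integral (lborel_upto s) (\<lambda>r. diff_rate r k) (w s k)"
proof -
  have 0: "0 \<in> {0..<T}" using s by auto
  have "AE x in torus. f 0 x = g 0 x"
    using visc.sol invisc.sol unfolding advection_diffusion_solution_def by (auto elim: eventually_elim2)
  then have "hcoeff (f 0) k = hcoeff (g 0) k"
    using visc.sq_int_at[OF 0] invisc.sq_int_at[OF 0] by (intro hcoeff_cong_AE) (auto simp: sq_integrable_def)
  then show ?thesis
    using has_bochner_integral_diff[OF visc.mode_equation[OF s, of k] invisc.mode_equation[OF s, of k]]
    by (simp add: diff_rate_def[abs_def] w_def)
qed

text \<open>At a time when both solutions are in \<open>H\<^sup>1\<close>, the equation for the modes of \<open>w\<close> can be written with the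
  function \<open>u \<cdot> \<nabla>w\<close>, which is orthogonal to \<open>w\<close>; only the viscous term remains in the rate of change of
  \<open>|w|\<^sup>2\<close>. The second claim is a crude majorant whose time integral is finite; mode \<open>0\<close> is listed
  separately there because the gradient does not see it.\<close>
lemma good_time:
  assumes s: "s \<in> {0..<T}" and dv: "divergence_free (u s)"
    and um: "\<And>i. (\<lambda>x. u s x $ i) \<in> borel_measurable torus" "\<And>i. AE x in torus. \<bar>u s x $ i\<bar> \<le> M"
    and H: "H1_seminorm (f s) < \<infinity>" "H1_seminorm (g s) < \<infinity>"
  shows "energy_rate s = - 2 * \<kappa> * (\<integral>k. freq2 k * w s k * hcoeff (f s) k \<partial>counting)"
    "(\<integral>\<^sup>+k. ennreal \<bar>w s k * diff_rate s k\<bar> \<partial>counting)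
       \<le> ennreal ((w s 0)\<^sup>2) + ennreal (1 + real CARD('d) * M\<^sup>2 + \<kappa>) * (3 * visc.grad_energy s + 2 * invisc.grad_energy s)"
proof -
  let ?w = "\<lambda>x. f s x - g s x"
  define p where "p i x = weak_pderiv i (f s) x - weak_pderiv i (g s) x" for i x
  have Lf: "f s \<in> L2_space" "g s \<in> L2_space" using s visc.L2 invisc.L2 by auto
  have sf: "sq_integrable torus (f s)" "sq_integrable torus (g s)" using s visc.sq_int_at invisc.sq_int_at by auto
  have sp: "sq_integrable torus (p i)" for i
    unfolding p_def[abs_def] by (intro sq_integrable_diff H1_seminorm_pderiv Lf H)
  have hp: "hcoeff (p i) k = - of_int (k $ i) * hcoeff ?w (- k)" for i k
  proof -
    have e1: "hcoeff (p i) k = hcoeff (weak_pderiv i (f s)) k - hcoeff (weak_pderiv i (g s)) k"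
      unfolding p_def[abs_def] by (intro hcoeff_diff sq_integrable_torus_integrable H1_seminorm_pderiv Lf H)
    have e2: "hcoeff ?w (- k) = hcoeff (f s) (- k) - hcoeff (g s) (- k)"
      by (intro hcoeff_diff sq_integrable_torus_integrable sf)
    show ?thesis
      unfolding e1 e2 H1_seminorm_pderiv(2)[OF Lf(1) H(1)] H1_seminorm_pderiv(2)[OF Lf(2) H(2)]
      by (simp add: algebra_simps)
  qed
  interpret transport "u s" M ?w p
    by (unfold_locales) (use dv um sq_integrable_diff[OF sf] sp hp in auto)
  let ?a = "hcoeff (f s)"
  have wk: "w s = hcoeff ?w" using w_eq[OF s] by auto
  have diff_rate: "diff_rate s k = - hcoeff advected k - \<kappa> * (freq2 k * ?a k)" for k
  proof -
    have i: "integrable torus (\<lambda>x. h x * (u s x \<bullet> grad (hartley k) x))" if "sq_integrable torus h" for h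
      by (rule sq_integrable_mult_integrable[OF that sq_integrable_v_grad])
    have "diff_rate s k = (\<integral>x. f s x * (u s x \<bullet> grad (hartley k) x) + (- \<kappa> * freq2 k) * (f s x * hartley k x) \<partial>torus)
      - (\<integral>x. g s x * (u s x \<bullet> grad (hartley k) x) \<partial>torus)"
      unfolding diff_rate_def laplacian_hartley by (simp add: algebra_simps)
    also have "\<dots> = (\<integral>x. ?w x * (u s x \<bullet> grad (hartley k) x) \<partial>torus) - \<kappa> * freq2 k * ?a k"
      using i[OF sf(1)] i[OF sf(2)] integrable_mult_hartley[OF sq_integrable_torus_integrable[OF sf(1)], of k]
      by (simp add: left_diff_distrib hcoeff_def)
    finally show ?thesis unfolding weak_transport by simp
  qed
  have sN: "sq_integrable counting (hcoeff advected)" by (rule sq_integrable_hcoeff[OF sq_integrable_advected])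
  note sw = sq_integrable_w[OF s]
  have sa: "sq_integrable counting (\<lambda>k. sqrt (freq2 k) * ?a k)" "sq_integrable counting (\<lambda>k. sqrt (freq2 k) * hcoeff (g s) k)"
    using H1_seminorm_l2_norm(1)[OF Lf(1) H(1)] H1_seminorm_l2_norm(1)[OF Lf(2) H(2)] by auto
  have sw1: "sq_integrable counting (\<lambda>k. sqrt (freq2 k) * w s k)"
    using sq_integrable_diff[OF sa] by (simp add: w_def algebra_simps)
  have iX: "integrable counting (\<lambda>k. freq2 k * w s k * ?a k)"
    using sq_integrable_mult_integrable[OF sw1 sa(1)] unfolding sqrt_freq2_mult .
  have iN: "integrable counting (\<lambda>k. w s k * hcoeff advected k)" by (rule sq_integrable_mult_integrable[OF sw sN])
  have "(\<integral>k. w s k * diff_rate s k \<partial>counting) = (\<integral>k. - (w s k * hcoeff advected k) - \<kappa> * (freq2 k * w s k * ?a k) \<partial>counting)"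
    unfolding diff_rate by (simp add: algebra_simps)
  also have "\<dots> = - (\<integral>k. w s k * hcoeff advected k \<partial>counting) - \<kappa> * (\<integral>k. freq2 k * w s k * ?a k \<partial>counting)"
    using iX iN by simp
  also have "(\<integral>k. w s k * hcoeff advected k \<partial>counting) = 0"
    using Parseval_inner[OF sq_integrable_advected w] advected_orthogonal by (simp add: wk mult.commute)
  finally show "energy_rate s = - 2 * \<kappa> * (\<integral>k. freq2 k * w s k * ?a k \<partial>counting)"
    by (simp add: energy_rate_def)

  let ?W = "\<integral>\<^sup>+k. ennreal (freq2 k * (w s k)\<^sup>2) \<partial>counting"
  have W2: "?W \<le> 2 * visc.grad_energy s + 2 * invisc.grad_energy s"
  proof -
    have "?W \<le> (\<integral>\<^sup>+k. 2 * ennreal (freq2 k * (hcoeff (f s) k)\<^sup>2) + 2 * ennreal (freq2 k * (hcoeff (g s) k)\<^sup>2) \<partial>counting)"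
    proof (rule nn_integral_mono)
      fix k :: "int ^ 'd"
      have "(x - z)\<^sup>2 \<le> 2 * x\<^sup>2 + 2 * z\<^sup>2" for x z :: real
        using zero_le_power2[of "x + z"] by (simp add: power2_sum power2_diff)
      from mult_left_mono[OF this freq2_nonneg, of k "hcoeff (f s) k" "hcoeff (g s) k"]
      have "freq2 k * (w s k)\<^sup>2 \<le> 2 * (freq2 k * (hcoeff (f s) k)\<^sup>2) + 2 * (freq2 k * (hcoeff (g s) k)\<^sup>2)"
        by (simp add: w_def algebra_simps)
      then have "ennreal (freq2 k * (w s k)\<^sup>2) \<le> ennreal (2 * (freq2 k * (hcoeff (f s) k)\<^sup>2) + 2 * (freq2 k * (hcoeff (g s) k)\<^sup>2))"
        by (rule ennreal_leI)
      then show "ennreal (freq2 k * (w s k)\<^sup>2) \<le> 2 * ennreal (freq2 k * (hcoeff (f s) k)\<^sup>2) + 2 * ennreal (freq2 k * (hcoeff (g s) k)\<^sup>2)"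
        using freq2_nonneg[of k] by (simp add: ennreal_plus ennreal_mult)
    qed
    also have "\<dots> = 2 * visc.grad_energy s + 2 * invisc.grad_energy s"
      unfolding visc.grad_energy_def invisc.grad_energy_def by (simp add: nn_integral_add nn_integral_cmult)
    finally show ?thesis .
  qed
  have N2: "(\<integral>\<^sup>+k. ennreal ((hcoeff advected k)\<^sup>2) \<partial>counting) \<le> ennreal (real CARD('d) * M\<^sup>2) * ?W"
  proof -
    have "(\<integral>\<^sup>+k. ennreal ((hcoeff advected k)\<^sup>2) \<partial>counting) = ennreal (\<integral>x. (advected x)\<^sup>2 \<partial>torus)"
      using sq_integrable_nn[OF sN] Parseval_square[OF sq_integrable_advected] by simp
    also have "\<dots> \<le> ennreal (real CARD('d) * M\<^sup>2 * (\<integral>k. freq2 k * (w s k)\<^sup>2 \<partial>counting))"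
      unfolding wk by (rule ennreal_leI[OF advected_bound])
    also have "\<dots> = ennreal (real CARD('d) * M\<^sup>2) * ennreal (\<integral>k. freq2 k * (w s k)\<^sup>2 \<partial>counting)"
      by (simp add: ennreal_mult freq2_nonneg)
    also have "ennreal (\<integral>k. freq2 k * (w s k)\<^sup>2 \<partial>counting) = ?W"
      using sq_integrable_nn[OF sw1] unfolding power_mult_distrib real_sqrt_pow2[OF freq2_nonneg] by simp
    finally show ?thesis .
  qed
  have "(\<integral>\<^sup>+k. ennreal \<bar>w s k * diff_rate s k\<bar> \<partial>counting) \<le>
     (\<integral>\<^sup>+k. ennreal ((w s 0)\<^sup>2) * indicator {0} k + ennreal (1 + \<kappa>) * ennreal (freq2 k * (w s k)\<^sup>2)
        + ennreal ((hcoeff advected k)\<^sup>2) + ennreal \<kappa> * ennreal (freq2 k * (?a k)\<^sup>2) \<partial>counting)"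
  proof (rule nn_integral_mono)
    fix k :: "int ^ 'd"
    have ab: "\<bar>x * z\<bar> \<le> x\<^sup>2 + z\<^sup>2" for x z :: real
      using sum_squares_bound[of x z] sum_squares_bound[of "- x" z] by (simp add: abs_le_iff)
    have wp: "(w s k)\<^sup>2 \<le> (w s 0)\<^sup>2 * indicator {0} k + freq2 k * (w s k)\<^sup>2"
    proof (cases "k = 0")
      case False
      from mult_right_mono[OF freq2_ge_1[OF this], of "(w s k)\<^sup>2"] show ?thesis by (simp add: False)
    qed (simp add: freq2_nonneg)
    have "\<bar>w s k * diff_rate s k\<bar> \<le> \<bar>w s k * hcoeff advected k\<bar> + \<kappa> * freq2 k * \<bar>w s k * ?a k\<bar>"
      unfolding diff_rate using kappa freq2_nonneg[of k] abs_triangle_ineq4[of "- (w s k * hcoeff advected k)" "\<kappa> * freq2 k * (w s k * ?a k)"]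
      by (simp add: abs_mult algebra_simps)
    also have "\<dots> \<le> ((w s k)\<^sup>2 + (hcoeff advected k)\<^sup>2) + \<kappa> * freq2 k * ((w s k)\<^sup>2 + (?a k)\<^sup>2)"
      using kappa freq2_nonneg[of k] by (intro add_mono mult_left_mono ab) auto
    also have "\<dots> \<le> (w s 0)\<^sup>2 * indicator {0} k + (1 + \<kappa>) * (freq2 k * (w s k)\<^sup>2) + (hcoeff advected k)\<^sup>2 + \<kappa> * (freq2 k * (?a k)\<^sup>2)"
      using wp by (simp add: algebra_simps)
    finally have "ennreal \<bar>w s k * diff_rate s k\<bar> \<le> ennreal ((w s 0)\<^sup>2 * indicator {0} k + (1 + \<kappa>) * (freq2 k * (w s k)\<^sup>2) + (hcoeff advected k)\<^sup>2 + \<kappa> * (freq2 k * (?a k)\<^sup>2))"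
      by (rule ennreal_leI)
    also have "\<dots> = ennreal ((w s 0)\<^sup>2 * indicator {0} k) + ennreal ((1 + \<kappa>) * (freq2 k * (w s k)\<^sup>2)) + ennreal ((hcoeff advected k)\<^sup>2) + ennreal (\<kappa> * (freq2 k * (?a k)\<^sup>2))"
      using kappa freq2_nonneg[of k] by (simp add: ennreal_plus del: ennreal_plus[symmetric])
    also have "\<dots> = ennreal ((w s 0)\<^sup>2) * indicator {0} k + ennreal (1 + \<kappa>) * ennreal (freq2 k * (w s k)\<^sup>2)
        + ennreal ((hcoeff advected k)\<^sup>2) + ennreal \<kappa> * ennreal (freq2 k * (?a k)\<^sup>2)"
    proof -
      have 1: "ennreal ((w s 0)\<^sup>2 * indicator {0} k) = ennreal ((w s 0)\<^sup>2) * indicator {0} k"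
        by (simp add: indicator_def)
      have 2: "ennreal ((1 + \<kappa>) * (freq2 k * (w s k)\<^sup>2)) = ennreal (1 + \<kappa>) * ennreal (freq2 k * (w s k)\<^sup>2)"
        using kappa freq2_nonneg[of k] by (intro ennreal_mult) auto
      have 3: "ennreal (\<kappa> * (freq2 k * (?a k)\<^sup>2)) = ennreal \<kappa> * ennreal (freq2 k * (?a k)\<^sup>2)"
        using kappa freq2_nonneg[of k] by (intro ennreal_mult) auto
      show ?thesis unfolding 1 2 3 ..
    qed
    finally show "ennreal \<bar>w s k * diff_rate s k\<bar> \<le> ennreal ((w s 0)\<^sup>2) * indicator {0} k + ennreal (1 + \<kappa>) * ennreal (freq2 k * (w s k)\<^sup>2)
        + ennreal ((hcoeff advected k)\<^sup>2) + ennreal \<kappa> * ennreal (freq2 k * (?a k)\<^sup>2)" .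
  qed
  also have "\<dots> = ennreal ((w s 0)\<^sup>2) + ennreal (1 + \<kappa>) * ?W + (\<integral>\<^sup>+k. ennreal ((hcoeff advected k)\<^sup>2) \<partial>counting) + ennreal \<kappa> * visc.grad_energy s"
    unfolding visc.grad_energy_def by (simp add: nn_integral_add nn_integral_cmult nn_integral_cmult_indicator)
  also have "\<dots> \<le> ennreal ((w s 0)\<^sup>2) + ennreal (1 + \<kappa>) * ?W + ennreal (real CARD('d) * M\<^sup>2) * ?W + ennreal \<kappa> * visc.grad_energy s"
    using N2 by (intro add_mono) auto
  also have "\<dots> = ennreal ((w s 0)\<^sup>2) + (ennreal (1 + real CARD('d) * M\<^sup>2 + \<kappa>) * ?W + ennreal \<kappa> * visc.grad_energy s)"
  proof -
    have "ennreal (1 + real CARD('d) * M\<^sup>2 + \<kappa>) = ennreal (1 + \<kappa>) + ennreal (real CARD('d) * M\<^sup>2)"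
      using kappa by (subst ennreal_plus[symmetric]) (auto simp: algebra_simps)
    then show ?thesis by (simp only: distrib_right add.assoc)
  qed
  also have "\<dots> \<le> ennreal ((w s 0)\<^sup>2) + (ennreal (1 + real CARD('d) * M\<^sup>2 + \<kappa>) * (2 * visc.grad_energy s + 2 * invisc.grad_energy s)
      + ennreal (1 + real CARD('d) * M\<^sup>2 + \<kappa>) * visc.grad_energy s)"
    by (intro add_mono order_refl mult_left_mono mult_right_mono W2 ennreal_leI) auto
  also have "\<dots> = ennreal ((w s 0)\<^sup>2) + ennreal (1 + real CARD('d) * M\<^sup>2 + \<kappa>) * (3 * visc.grad_energy s + 2 * invisc.grad_energy s)"
  proof -
    have "2 * x + 2 * z + x = 3 * x + 2 * z" for x z :: ennreal
    proof -
      have "(2::ennreal) + 1 = 3" by simp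
      then have "3 * x = 2 * x + x" by (metis distrib_right mult_1)
      then show ?thesis by (simp add: ac_simps)
    qed
    then show ?thesis by (simp only: distrib_left[symmetric])
  qed
  finally show "(\<integral>\<^sup>+k. ennreal \<bar>w s k * diff_rate s k\<bar> \<partial>counting)
       \<le> ennreal ((w s 0)\<^sup>2) + ennreal (1 + real CARD('d) * M\<^sup>2 + \<kappa>) * (3 * visc.grad_energy s + 2 * invisc.grad_energy s)" .
qed

lemma AE_good:
  assumes t: "t \<in> {0..<T}"
  shows "\<exists>M. AE s in lborel. s \<in> {0..t} \<longrightarrow> divergence_free (u s) \<and>
     (\<forall>i. (\<lambda>x. u s x $ i) \<in> borel_measurable torus \<and> (AE x in torus. \<bar>u s x $ i\<bar> \<le> M)) \<and>
     H1_seminorm (f s) < \<infinity> \<and> H1_seminorm (g s) < \<infinity>"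
proof -
  obtain M where "AE s in lborel. s \<in> {0..t} \<longrightarrow>
    (\<forall>i. (\<lambda>x. u s x $ i) \<in> borel_measurable torus \<and> (AE x in torus. \<bar>u s x $ i\<bar> \<le> M))"
    using Linf_loc_W1inf_bound[OF u t] by blast
  then have "AE s in lborel. s \<in> {0..t} \<longrightarrow> divergence_free (u s) \<and>
     (\<forall>i. (\<lambda>x. u s x $ i) \<in> borel_measurable torus \<and> (AE x in torus. \<bar>u s x $ i\<bar> \<le> M)) \<and>
     H1_seminorm (f s) < \<infinity> \<and> H1_seminorm (g s) < \<infinity>"
    using div visc.AE_H1_finite[OF t] invisc.AE_H1_finite[OF t]
  proof eventually_elim
    case (elim s) then show ?case using t by auto
  qed
  then show ?thesis by blast
qed

lemma energy_finite:
  assumes t: "t \<in> {0..<T}"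
  shows "(\<integral>\<^sup>+s. (\<integral>\<^sup>+k. ennreal \<bar>w s k * diff_rate s k\<bar> \<partial>counting) \<partial>lborel_upto t) < \<infinity>"
proof -
  obtain M where M: "AE s in lborel. s \<in> {0..t} \<longrightarrow> divergence_free (u s) \<and>
     (\<forall>i. (\<lambda>x. u s x $ i) \<in> borel_measurable torus \<and> (AE x in torus. \<bar>u s x $ i\<bar> \<le> M)) \<and>
     H1_seminorm (f s) < \<infinity> \<and> H1_seminorm (g s) < \<infinity>"
    using AE_good[OF t] by blast
  let ?C = "ennreal (1 + real CARD('d) * M\<^sup>2 + \<kappa>)"
  have sub: "{0..t} \<subseteq> {0..<T}" using t by auto
  have "continuous_on {0..t} (\<lambda>s. (w s 0)\<^sup>2)"
    unfolding w_def
    by (intro continuous_intros continuous_on_subset[OF visc.hcoeff_continuous sub] continuous_on_subset[OF invisc.hcoeff_continuous sub])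
  then have "integrable lborel (\<lambda>s. indicator {0..t} s *\<^sub>R (w s 0)\<^sup>2)" by (intro borel_integrable_compact) auto
  then have i0: "integrable (lborel_upto t) (\<lambda>s. (w s 0)\<^sup>2)" by (simp add: upto_integrable)
  note [measurable] = visc.grad_energy_measurable[OF t] invisc.grad_energy_measurable[OF t] borel_measurable_integrable[OF i0]
  have "(\<integral>\<^sup>+s. (\<integral>\<^sup>+k. ennreal \<bar>w s k * diff_rate s k\<bar> \<partial>counting) \<partial>lborel_upto t)
     \<le> (\<integral>\<^sup>+s. ennreal ((w s 0)\<^sup>2) + ?C * (3 * visc.grad_energy s + 2 * invisc.grad_energy s) \<partial>lborel_upto t)"
  proof (rule nn_integral_mono_AE, subst AE_restrict_space_iff)
    show "AE s in lborel. s \<in> {0..t} \<longrightarrow> (\<integral>\<^sup>+k. ennreal \<bar>w s k * diff_rate s k\<bar> \<partial>counting)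
      \<le> ennreal ((w s 0)\<^sup>2) + ?C * (3 * visc.grad_energy s + 2 * invisc.grad_energy s)"
      using M
    proof eventually_elim
      case (elim s) then show ?case using good_time(2)[of s M] t by auto
    qed
  qed simp
  also have "\<dots> = (\<integral>\<^sup>+s. ennreal ((w s 0)\<^sup>2) \<partial>lborel_upto t) + ?C * (3 * (\<integral>\<^sup>+s. visc.grad_energy s \<partial>lborel_upto t) + 2 * (\<integral>\<^sup>+s. invisc.grad_energy s \<partial>lborel_upto t))"
    by (simp add: nn_integral_add nn_integral_cmult)
  also have "\<dots> < \<infinity>"
    using visc.nn_grad_energy_finite[OF t] invisc.nn_grad_energy_finite[OF t] nn_integral_eq_integral[OF i0]
    by (simp add: ennreal_mult_less_top)
  finally show ?thesis .
qed

text \<open>The balance \<open>d/dt |w|\<^sup>2 = - 2 \<kappa> \<langle>\<nabla>w, \<nabla>f\<rangle>\<close>, integrated in time; \<open>w\<close> vanishes at time \<open>0\<close>.\<close>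
lemma energy:
  assumes t: "t \<in> {0..<T}"
  shows "integrable (lborel_upto t) energy_rate" "dist_square t = (\<integral>s. energy_rate s \<partial>lborel_upto t)"
    "AE s in lborel. s \<in> {0..t} \<longrightarrow> energy_rate s = - 2 * \<kappa> * (\<integral>k. freq2 k * w s k * hcoeff (f s) k \<partial>counting)"
proof -
  have i: "has_bochner_integral (lborel_upto s) (\<lambda>r. diff_rate r k) (w s k)" if "s \<in> {0..t}" for s k
    by (rule has_integral_rate) (use that t in auto)
  have t0: "0 \<le> t" using t by simp
  note e = energy_sum[OF i t0 energy_finite[OF t]]
  show "integrable (lborel_upto t) energy_rate" "dist_square t = (\<integral>s. energy_rate s \<partial>lborel_upto t)"
    using e unfolding energy_rate_def[abs_def] dist_square_def by auto
  obtain M where "AE s in lborel. s \<in> {0..t} \<longrightarrow> divergence_free (u s) \<and>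
     (\<forall>i. (\<lambda>x. u s x $ i) \<in> borel_measurable torus \<and> (AE x in torus. \<bar>u s x $ i\<bar> \<le> M)) \<and>
     H1_seminorm (f s) < \<infinity> \<and> H1_seminorm (g s) < \<infinity>"
    using AE_good[OF t] by blast
  then show "AE s in lborel. s \<in> {0..t} \<longrightarrow> energy_rate s = - 2 * \<kappa> * (\<integral>k. freq2 k * w s k * hcoeff (f s) k \<partial>counting)"
  proof eventually_elim
    case (elim s) then show ?case using good_time(1)[of s M] t by auto
  qed
qed

end

section \<open>The lower bound on the dissipation\<close>

context two_solutions
begin

text \<open>Where \<open>g\<close> is in \<open>H\<^sup>1\<close>, the hypothesis makes both second order seminorms finite, so the comparison of
  gradients applies with \<open>l = c L\<close>.\<close>
lemma gradient_control:
  assumes L: "L > 0" and c: "c > 0" and s: "s \<in> {0..<T}"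
    and H: "H1_seminorm (f s) < \<infinity>" "H1_seminorm (g s) < \<infinity>"
    and hyp: "ennreal c * (H2_seminorm (g s) + H2_seminorm (f s)) * ennreal L \<le> (H1_seminorm (g s))\<^sup>2"
    and r: "0 < r" "r < 1" and small: "dist_square s \<le> (r\<^sup>2 * (c * L))\<^sup>2"
  shows "- (\<integral>k. freq2 k * w s k * hcoeff (f s) k \<partial>counting) \<le> r / (1 - r) * enn2real (visc.grad_energy s)"
    "ennreal ((1 - r)\<^sup>2) * invisc.grad_energy s \<le> visc.grad_energy s"
proof -
  have Lf: "f s \<in> L2_space" "g s \<in> L2_space" using s visc.L2 invisc.L2 by auto
  note h1 = H1_seminorm_l2_norm[OF Lf(1) H(1)] H1_seminorm_l2_norm[OF Lf(2) H(2)]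
  have "ennreal c * (H2_seminorm (g s) + H2_seminorm (f s)) * ennreal L < \<infinity>"
    using hyp h1(4) by (simp add: order_le_less_trans)
  then have fin: "H2_seminorm (g s) < \<infinity>" "H2_seminorm (f s) < \<infinity>"
    using L c by (auto simp: ennreal_mult_less_top less_top[symmetric] ennreal_mult_eq_top_iff)
  note h2 = H2_seminorm_l2_norm[OF fin(2)] H2_seminorm_l2_norm[OF fin(1)]
  let ?a = "hcoeff (f s)" and ?b = "hcoeff (g s)"
  let ?A = "l2_norm counting (\<lambda>k. sqrt (freq2 k) * ?a k)" and ?B = "l2_norm counting (\<lambda>k. sqrt (freq2 k) * ?b k)"
  have "ennreal (c * (l2_norm counting (\<lambda>k. freq2 k * ?b k) + l2_norm counting (\<lambda>k. freq2 k * ?a k)) * L) \<le> ennreal (?B\<^sup>2)"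
    using hyp unfolding h1(4) h2(2,4) using c L by (simp add: ennreal_mult l2_norm_nonneg)
  then have l: "(c * L) * (l2_norm counting (\<lambda>k. freq2 k * ?b k) + l2_norm counting (\<lambda>k. freq2 k * ?a k)) \<le> ?B\<^sup>2"
    by (simp add: ennreal_le_iff mult_ac)
  have ws: "(\<lambda>k. ?a k - ?b k) = w s" by (simp add: w_def[abs_def])
  have sm: "l2_norm counting (w s) \<le> r\<^sup>2 * (c * L)"
    by (rule power2_le_imp_le) (use small c L in \<open>simp_all add: l2_norm_square dist_square_def\<close>)
  note gc = gradient_comparison[OF h1(1) h2(1) h1(3) h2(3), unfolded ws, OF sq_integrable_w[OF s] _ l r sm]
  have cL: "0 < c * L" using c L by simp
  have A: "visc.grad_energy s = ennreal (?A\<^sup>2)" and B: "invisc.grad_energy s = ennreal (?B\<^sup>2)"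
    using h1 visc.grad_energy[OF s] invisc.grad_energy[OF s] by auto
  show "- (\<integral>k. freq2 k * w s k * ?a k \<partial>counting) \<le> r / (1 - r) * enn2real (visc.grad_energy s)"
    using gc(1)[OF cL] unfolding ws[symmetric] A by (simp add: fun_cong[OF ws])
  have "((1 - r) * ?B)\<^sup>2 \<le> ?A\<^sup>2"
    using gc(2)[OF cL] r by (intro power_mono) (auto simp: l2_norm_nonneg)
  then show "ennreal ((1 - r)\<^sup>2) * invisc.grad_energy s \<le> visc.grad_energy s"
    unfolding A B by (simp add: power_mult_distrib ennreal_leI flip: ennreal_mult)
qed

text \<open>If the dissipation of \<open>f\<close> stayed below the bound, then \<open>|w|\<close> would never reach \<open>9/16 c L\<close>, so that
  \<open>|\<nabla>g| \<le> 4 |\<nabla>f|\<close> at almost all times, and the blow-up of the integral of \<open>|\<nabla>g|\<^sup>2\<close> would carry over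
  to \<open>f\<close>.\<close>
lemma lower_bound:
  assumes L: "L > 0" and c: "0 < c" "c < 1"
    and blowup: "((\<lambda>t. \<integral>\<^sup>+s\<in>{0..t}. (H1_seminorm (g s))\<^sup>2 \<partial>lborel) \<longlongrightarrow> \<infinity>) (at_left T)"
    and T: "T > 0"
    and hyp: "\<And>t. t \<in> {0..<T} \<Longrightarrow> ennreal c * (H2_seminorm (g t) + H2_seminorm (f t)) * ennreal L \<le> (H1_seminorm (g t))\<^sup>2"
  shows "ennreal ((c / 2) ^ 4) * ennreal (L\<^sup>2) \<le> ennreal \<kappa> * (\<integral>\<^sup>+t\<in>{0..<T}. (H1_seminorm (f t))\<^sup>2 \<partial>lborel)"
proof (rule ccontr)
  define K where "K = (\<integral>\<^sup>+t\<in>{0..<T}. (H1_seminorm (f t))\<^sup>2 \<partial>lborel)"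
  define l where "l = c * L"
  have l: "l > 0" using c L by (simp add: l_def)
  assume "\<not> ?thesis"
  then have K: "ennreal \<kappa> * K < ennreal ((c / 2) ^ 4 * L\<^sup>2)"
    using c by (simp add: K_def ennreal_mult not_le)
  then have Kfin: "K < \<infinity>" using kappa by (cases K) (auto simp: ennreal_mult_top)
  have KL: "\<kappa> * enn2real K < (c / 2) ^ 4 * L\<^sup>2"
    using K Kfin kappa by (cases K) (auto simp: ennreal_mult[symmetric] ennreal_less_iff)
  have c4: "(c / 2) ^ 4 * L\<^sup>2 \<le> l\<^sup>2 / 16"
  proof -
    have "c\<^sup>2 \<le> 1" using c by (simp add: power_le_one)
    then have "(c\<^sup>2 * L\<^sup>2) * c\<^sup>2 \<le> (c\<^sup>2 * L\<^sup>2) * 1" by (intro mult_left_mono) auto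
    moreover have "(c\<^sup>2 * L\<^sup>2) * c\<^sup>2 = c ^ 4 * L\<^sup>2"
      by (simp add: power2_eq_square power4_eq_xxxx)
    ultimately show ?thesis
      by (simp add: l_def power_divide power_mult_distrib)
  qed
  have nnK: "(\<integral>\<^sup>+s. visc.grad_energy s \<partial>lborel_upto t) \<le> K" if "t \<in> {0..<T}" for t
    unfolding visc.nn_grad_energy[OF that] K_def using that
    by (intro nn_integral_mono mult_left_mono) (auto simp: indicator_def)
  have good: "AE s in lborel. s \<in> {0..t} \<longrightarrow> H1_seminorm (f s) < \<infinity> \<and> H1_seminorm (g s) < \<infinity>" if "t \<in> {0..<T}" for t
    using visc.AE_H1_finite[OF that] invisc.AE_H1_finite[OF that] by eventually_elim auto
  \<comment> \<open>The squares of \<open>|w|\<close> at which the comparison of gradients holds with \<open>r = 1/2\<close> and \<open>r = 3/4\<close>. A single value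
     of \<open>r\<close> would force a dissipation of only \<open>r\<^sup>3 (1 - r) l\<^sup>2 / 2 \<le> 27/512 l\<^sup>2\<close>, which is less than \<open>l\<^sup>2 / 16\<close>;
     passing both thresholds costs \<open>113/1536 l\<^sup>2\<close>, which is more.\<close>
  define q1 q2 where "q1 = ((1/2)\<^sup>2 * l)\<^sup>2" and "q2 = ((3/4)\<^sup>2 * l)\<^sup>2"
  have below: "dist_square t < q2" if t: "t \<in> {0..<T}" for t
  proof (rule ccontr)
    assume "\<not> dist_square t < q2"
    then have hit: "q2 \<le> dist_square t" by simp
    define A where "A s = enn2real (visc.grad_energy s)" for s
    have [measurable]: "visc.grad_energy \<in> borel_measurable (lborel_upto t)" by (rule visc.grad_energy_measurable[OF t])
    have A0: "0 \<le> A s" for s by (simp add: A_def)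
    have Am: "A \<in> borel_measurable (lborel_upto t)" unfolding A_def[abs_def] by measurable
    have nnA: "(\<integral>\<^sup>+s. ennreal (A s) \<partial>lborel_upto t) \<le> K"
    proof -
      have "(\<integral>\<^sup>+s. ennreal (A s) \<partial>lborel_upto t) \<le> (\<integral>\<^sup>+s. visc.grad_energy s \<partial>lborel_upto t)"
        unfolding A_def by (rule nn_integral_mono) (metis ennreal_enn2real_if order_refl top_greatest zero_le)
      then show ?thesis using nnK[OF t] by (rule order_trans)
    qed
    have Ai: "integrable (lborel_upto t) A"
      unfolding integrable_iff_bounded using Am nnA Kfin by (simp add: A_def order_le_less_trans)
    have "ennreal (\<integral>s. A s \<partial>lborel_upto t) \<le> K"
      using nnA by (subst nn_integral_eq_integral[OF Ai, symmetric]) (auto simp: A0)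
    then have AK: "(\<integral>s. A s \<partial>lborel_upto t) \<le> enn2real K"
      using Kfin by (cases K) (auto simp: ennreal_le_iff)
    have thr: "AE s in lborel. s \<in> {0..t} \<longrightarrow> dist_square s \<le> (r\<^sup>2 * l)\<^sup>2 \<longrightarrow> energy_rate s \<le> (2 * \<kappa> * (r / (1 - r))) * A s"
      if r: "0 < r" "r < 1" for r
      using energy(3)[OF t] good[OF t]
    proof (eventually_elim, intro impI)
      fix s assume 1: "s \<in> {0..t} \<longrightarrow> energy_rate s = - 2 * \<kappa> * (\<integral>k. freq2 k * w s k * hcoeff (f s) k \<partial>counting)"
        and 2: "s \<in> {0..t} \<longrightarrow> H1_seminorm (f s) < \<infinity> \<and> H1_seminorm (g s) < \<infinity>"
        and s: "s \<in> {0..t}" and d: "dist_square s \<le> (r\<^sup>2 * l)\<^sup>2"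
      have sT: "s \<in> {0..<T}" using s t by auto
      have "- (\<integral>k. freq2 k * w s k * hcoeff (f s) k \<partial>counting) \<le> r / (1 - r) * A s"
        unfolding A_def using gradient_control(1)[OF L c(1) sT _ _ hyp[OF sT] r d[unfolded l_def]] 2 s by blast
      from mult_left_mono[OF this, of "2 * \<kappa>"] show "energy_rate s \<le> (2 * \<kappa> * (r / (1 - r))) * A s"
        using 1 s kappa by (simp add: mult.assoc)
    qed
    have "q1 / (2 * \<kappa> * ((1/2) / (1 - 1/2))) + (q2 - q1) / (2 * \<kappa> * ((3/4) / (1 - 3/4))) \<le> (\<integral>s. A s \<partial>lborel_upto t)"
    proof (rule two_thresholds[OF _ energy(1)[OF t] Ai])
      show "dist_square s = (\<integral>r. energy_rate r \<partial>lborel_upto s)" if "s \<in> {0..t}" for s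
        by (rule energy(2)) (use that t in auto)
      show "AE s in lborel. s \<in> {0..t} \<longrightarrow> dist_square s \<le> q1 \<longrightarrow> energy_rate s \<le> (2 * \<kappa> * ((1/2) / (1 - 1/2))) * A s"
        unfolding q1_def by (rule thr) auto
      show "AE s in lborel. s \<in> {0..t} \<longrightarrow> dist_square s \<le> q2 \<longrightarrow> energy_rate s \<le> (2 * \<kappa> * ((3/4) / (1 - 3/4))) * A s"
        unfolding q2_def by (rule thr) auto
    qed (use t hit l kappa in \<open>auto simp: A_def q1_def q2_def power2_eq_square\<close>)
    then have "\<kappa> * (q1 / (2 * \<kappa> * ((1/2) / (1 - 1/2))) + (q2 - q1) / (2 * \<kappa> * ((3/4) / (1 - 3/4)))) \<le> \<kappa> * enn2real K"
      using AK kappa by (intro mult_left_mono) auto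
    also have "\<kappa> * (q1 / (2 * \<kappa> * ((1/2) / (1 - 1/2))) + (q2 - q1) / (2 * \<kappa> * ((3/4) / (1 - 3/4)))) = 113 / 1536 * l\<^sup>2"
      using kappa by (simp add: q1_def q2_def field_simps power2_eq_square)
    finally have "113 / 1536 * l\<^sup>2 \<le> l\<^sup>2 / 16" using KL c4 by linarith
    then show False using l by simp
  qed
  have bound: "(\<integral>\<^sup>+s\<in>{0..t}. (H1_seminorm (g s))\<^sup>2 \<partial>lborel) \<le> 16 * K" if t: "t \<in> {0..<T}" for t
  proof -
    have "(\<integral>\<^sup>+s. invisc.grad_energy s \<partial>lborel_upto t) \<le> (\<integral>\<^sup>+s. 16 * visc.grad_energy s \<partial>lborel_upto t)"
    proof (rule nn_integral_mono_AE, subst AE_restrict_space_iff)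
      show "AE s in lborel. s \<in> {0..t} \<longrightarrow> invisc.grad_energy s \<le> 16 * visc.grad_energy s"
        using good[OF t]
      proof (eventually_elim, intro impI)
        fix s assume 2: "s \<in> {0..t} \<longrightarrow> H1_seminorm (f s) < \<infinity> \<and> H1_seminorm (g s) < \<infinity>" and s: "s \<in> {0..t}"
        have sT: "s \<in> {0..<T}" using s t by auto
        have d: "dist_square s \<le> ((3/4)\<^sup>2 * (c * L))\<^sup>2" using below[OF sT] by (simp add: q2_def l_def)
        have "ennreal ((1 - 3/4)\<^sup>2) * invisc.grad_energy s \<le> visc.grad_energy s"
          using gradient_control(2)[OF L c(1) sT _ _ hyp[OF sT] _ _ d] 2 s by auto
        from mult_left_mono[OF this, of "ennreal 16"]
        have "ennreal 16 * (ennreal ((1 - 3/4)\<^sup>2) * invisc.grad_energy s) \<le> ennreal 16 * visc.grad_energy s" by simp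
        moreover have "ennreal 16 * (ennreal ((1 - 3/4)\<^sup>2) * invisc.grad_energy s) = invisc.grad_energy s"
          unfolding mult.assoc[symmetric] by (subst ennreal_mult[symmetric]) (auto simp: power2_eq_square)
        ultimately show "invisc.grad_energy s \<le> 16 * visc.grad_energy s" by simp
      qed
    qed simp
    also have "\<dots> = 16 * (\<integral>\<^sup>+s. visc.grad_energy s \<partial>lborel_upto t)"
      by (rule nn_integral_cmult[OF visc.grad_energy_measurable[OF t]])
    also have "\<dots> \<le> 16 * K" by (rule mult_left_mono[OF nnK[OF t]]) simp
    finally show ?thesis unfolding invisc.nn_grad_energy[OF t] .
  qed
  have "16 * K < \<infinity>" using Kfin by (simp add: ennreal_mult_less_top)
  then have "\<forall>\<^sub>F t in at_left T. 16 * K < (\<integral>\<^sup>+s\<in>{0..t}. (H1_seminorm (g s))\<^sup>2 \<partial>lborel)"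
    by (rule order_tendstoD(1)[OF blowup])
  moreover have "\<forall>\<^sub>F t in at_left T. t \<in> {0<..<T}"
    using eventually_at_left_real[OF T] .
  ultimately have "\<forall>\<^sub>F t in at_left T. False"
  proof eventually_elim
    case (elim t) then show ?case using bound[of t] by auto
  qed
  then show False by simp
qed

end

theorem proposition1p3:
  fixes T c :: real
    and u :: "real \<Rightarrow> real ^ 'd::finite \<Rightarrow> real ^ 'd"
    and \<theta>\<^sub>0 :: "real ^ 'd \<Rightarrow> real"
    and \<theta> :: "real \<Rightarrow> real ^ 'd \<Rightarrow> real"
    and \<theta>\<kappa> :: "real \<Rightarrow> real \<Rightarrow> real ^ 'd \<Rightarrow> real"
  assumes "CARD('d) \<ge> 2"
    and "T > 0"
    and "Linf_loc_W1inf T u"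
    and "AE t in lborel. t \<in> {0..<T} \<longrightarrow> divergence_free (u t)"
    and "\<theta>\<^sub>0 \<in> H2_space"
    and "(\<integral>x. \<theta>\<^sub>0 x \<partial>torus) = 0"
    and "\<And>\<kappa>. \<kappa> > 0 \<Longrightarrow> advection_diffusion_solution T u \<kappa> \<theta>\<^sub>0 (\<theta>\<kappa> \<kappa>)"
    and "advection_diffusion_solution T u 0 \<theta>\<^sub>0 \<theta>"
    and "((\<lambda>t. \<integral>\<^sup>+s\<in>{0..t}. (H1_seminorm (\<theta> s))\<^sup>2 \<partial>lborel) \<longlongrightarrow> \<infinity>) (at_left T)"
    and "0 < c" and "c < 1"
    and "\<And>t \<kappa>. t \<in> {0..<T} \<Longrightarrow> \<kappa> > 0 \<Longrightarrow>
           (H1_seminorm (\<theta> t))\<^sup>2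
             \<ge> ennreal c * (H2_seminorm (\<theta> t) + H2_seminorm (\<theta>\<kappa> \<kappa> t)) * L2_norm \<theta>\<^sub>0"
  shows "\<forall>\<kappa>>0. ennreal \<kappa> * (\<integral>\<^sup>+t\<in>{0..<T}. (H1_seminorm (\<theta>\<kappa> \<kappa> t))\<^sup>2 \<partial>lborel)
                 \<ge> ennreal ((c / 2) ^ 4) * (L2_norm \<theta>\<^sub>0)\<^sup>2"
proof (intro allI impI)
  fix \<kappa> :: real assume kappa: "\<kappa> > 0"
  interpret two_solutions T \<kappa> u \<theta>\<^sub>0 "\<theta>\<kappa> \<kappa>" \<theta>
    by unfold_locales (use assms(3,4,7,8) kappa in auto)
  have "L2_norm \<theta>\<^sub>0 < \<infinity>" using assms(5) by (simp add: H2_space_def L2_space_def)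
  then obtain L where L: "L2_norm \<theta>\<^sub>0 = ennreal L" "L \<ge> 0" by (cases "L2_norm \<theta>\<^sub>0") auto
  show "ennreal ((c / 2) ^ 4) * (L2_norm \<theta>\<^sub>0)\<^sup>2 \<le> ennreal \<kappa> * (\<integral>\<^sup>+t\<in>{0..<T}. (H1_seminorm (\<theta>\<kappa> \<kappa> t))\<^sup>2 \<partial>lborel)"
  proof (cases "L = 0")
    case False
    have "ennreal ((c / 2) ^ 4) * ennreal (L\<^sup>2) \<le> ennreal \<kappa> * (\<integral>\<^sup>+t\<in>{0..<T}. (H1_seminorm (\<theta>\<kappa> \<kappa> t))\<^sup>2 \<partial>lborel)"
      by (rule lower_bound) (use False L assms(2,9,10,11,12) kappa in auto)
    then show ?thesis using L by (simp add: ennreal_power)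
  qed (simp add: L)
qed

end
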